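(* Let $\mathcal U$, $\mathcal U'$ be commutative Hopf algebroids over $k$. Let $C$ be a cocommutative $k$-coalgebra and let $(\Psi,\psi):C\longrightarrow V(\mathcal U,\mathcal U')$ be a measuring of Hopf algebroids. Then the induced $k$-linear map $$\underline\Psi^{hoc}:C\longrightarrow Vect_k(HH_\bullet(\mathcal U),HH_\bullet(\mathcal U')),\qquad x\mapsto\big(\underline\Psi^{hoc}_\bullet(x):HH_\bullet(\mathcal U)\to HH_\bullet(\mathcal U')\big)$$ gives a measuring of algebras from $(HH_\bullet(\mathcal U),sh(\mathcal U))$ to $(HH_\bullet(\mathcal U'),sh(\mathcal U'))$.
   Context: $k$ is a field; $Vect_k(V,W)$ denotes the space of $k$-linear maps. Sweedler notation is used with summation suppressed. Left bialgebroid $(U,A_L,s_L,t_L,\Delta_L,\epsilon_L)$ over $k$ (write $A=A_L$): unital $k$-algebras $U,A$; $k$-algebra morphisms $s_L:A\to U$, $t_L:A^{op}\to U$ with commuting images; $U$ is an $(A,A)$-bimodule via $a\cdot u\cdot b=s_L(a)t_L(b)u$ and $U\otimes_{A_L}U$ is formed with this structure (so $t_L(a)u\otimes v=u\otimes s_L(a)v$); $(U,\Delta_L:U\to U\otimes_{A_L}U,\epsilon_L:U\to A_L)$ is a coalgebra in $(A,A)$-bimodules such that $\Delta_L$ takes values in $U\times_{A_L}U:=\{\sum u_i\otimes u_i' : \sum u_it_L(a)\otimes u'_i=\sum u_i\otimes u_i's_L(a)\ \forall a\in A\}$ (an algebra under factorwise multiplication), $\Delta_L:U\to U\times_{A_L}U$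 is a unital algebra morphism, and $\epsilon_L(us_L(\epsilon_L(u')))=\epsilon_L(uu')=\epsilon_L(ut_L(\epsilon_L(u')))$. Hopf algebroid $\mathcal U=(U,A_L,s_L,t_L,\Delta_L,\epsilon_L,S)$: a left bialgebroid with an involutive ($S^2=\mathrm{id}$) anti-automorphism $S$ of the $k$-algebra $U$ with $S\circ t_L=s_L$ and, in $U\otimes_{A_L}U$ for all $u\in U$, $S(u_{(1)})_{(1)}u_{(2)}\otimes S(u_{(1)})_{(2)}=1_U\otimes S(u)$ and $S(u_{(2)})_{(1)}\otimes S(u_{(2)})_{(2)}u_{(1)}=S(u)\otimes 1_U$. It is commutative if $U$ and $A$ are commutative rings (then $A_L=A=A_R$). Measuring of algebras: for $k$-algebras $R,R'$ and a $k$-coalgebra $C$ with counit $\epsilon_C$, a linear map $\psi:C\to Vect_k(R,R')$ with $\psi(x)(ab)=\psi(x_{(1)})(a)\psi(x_{(2)})(b)$ and $\psi(x)(1_R)=\epsilon_C(x)1_{R'}$. One writes $x(a)$ for $\psi(x)(a)$. Measuring of Hopf algebroids from $\mathcal U$ to $\mathcal U'$ by a cocommutative $k$-coalgebra $C$: a pair of algebra measurings $\Psi:C\to Vect_k(U,U')$, $\psi:C\to Vect_k(A_L,A'_L)$ such that for all $x\in C$: $\Psi(x)s_L=s_L'\psi(x)$, $\Psi(x)t_L=t'_L\psi(x)$, $\Psi(x)S=S'\Psi(x)$, $\psi(x)\epsilon_L=\epsilon_L'\Psi(x)$, and $\Delta'_L(\Psi(x)(u))=\Psi(x_{(1)})(u_{(1)})\otimes\Psi(x_{(2)})(u_{(2)})$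 in $U'\otimes_{A'_L}U'$ for all $u\in U$. The map $(\Psi,\psi)$ takes values in $V(\mathcal U,\mathcal U'):=\{(F,f)\in Vect_k(U,U')\times Vect_k(A_L,A_L'): Fs_L=s_L'f,\ Ft_L=t_L'f,\ FS=S'F,\ f\epsilon_L=\epsilon_L'F\}$. $HH_\bullet(\mathcal U)=\bigoplus_nHH_n(\mathcal U)$ is the homology of the complex $C_\bullet(\mathcal U)$ with differential $\sum_i(-1)^id_i$, where, with $A_R=A_L^{op}$, $s_R=t_L$, $\epsilon_R=\epsilon_L\circ S$ and $U$ an $(A_R,A_R)$-bimodule via $a\cdot u\cdot b=s_R(a)us_R(b)$, $C_n(\mathcal U)=U\otimes_{A_R}\cdots\otimes_{A_R}U$ ($n$ factors), $C_0(\mathcal U)=A_R$; $d_0(u^1\otimes\dots\otimes u^n)=\epsilon_R(u^1)\cdot u^2\otimes\dots\otimes u^n$, $d_i(u^1\otimes\dots\otimes u^n)=u^1\otimes\dots\otimes u^iu^{i+1}\otimes\dots\otimes u^n$ ($1\le i\le n-1$), $d_n(u^1\otimes\dots\otimes u^n)=u^1\otimes\dots\otimes u^{n-1}\cdot\epsilon_R(S(u^n))$ (for $n=1$: $d_0=\epsilon_R$, $d_1=\epsilon_R\circ S$). The map $\underline\Psi_\bullet^{hoc}(x)$ is induced by the chain map $u^1\otimes\dots\otimes u^n\mapsto x_{(1)}(u^1)\otimes\dots\otimes x_{(n)}(u^n)$ (and $\psi(x)$ in degree $0$). Shuffle product: $sh_{pq}(\mathcal U):C_p(\mathcal U)\otimes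 C_q(\mathcal U)\to C_{p+q}(\mathcal U)$ is, for $p,q\ge1$, $$(u^1\otimes\dots\otimes u^p)\otimes(u^{p+1}\otimes\dots\otimes u^{p+q})\mapsto\sum_{\sigma\in Sh(p,q)}sgn(\sigma)\,u^{\sigma^{-1}(1)}\otimes\dots\otimes u^{\sigma^{-1}(p+q)},$$ $Sh(p,q)=\{\sigma\in S_{p+q}:\sigma(1)<\dots<\sigma(p),\ \sigma(p+1)<\dots<\sigma(p+q)\}$; $sh_{00}$ is the multiplication of $A$; $sh_{p0}((u^1\otimes\dots\otimes u^p)\otimes a)=t_L(a)u^1\otimes\dots\otimes u^p$; $sh_{0q}(a\otimes(u^1\otimes\dots\otimes u^q))=u^1\otimes\dots\otimes u^qt_L(a)$. For commutative $\mathcal U$ it induces a graded algebra structure on $HH_\bullet(\mathcal U)$, denoted $(HH_\bullet(\mathcal U),sh(\mathcal U))$. *)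

theory Defs
  imports
    "HOL-Algebra.Algebraic_Closure_Type"
    "HOL-Library.Poly_Mapping"
    "HOL-Combinatorics.Permutations"
begin

text \<open>
  The field \<open>k\<close> is a type \<open>'k\<close> of class \<open>field\<close>, and the algebras \<open>U\<close>, \<open>A\<close> and the coalgebra \<open>C\<close>
  are whole types carrying an explicit scalar multiplication by \<open>'k\<close>. The sort
  \<open>{ring, monoid_mult}\<close> is used for unital rings, since \<open>ring_1\<close> would exclude the zero ring.
  Tensor products, chain modules and homology are \<open>module\<close> records; where such a record is
  only meant as a vector space, its fields \<open>mult\<close> and \<open>one\<close> are irrelevant.
\<close>

section \<open>Vector spaces and algebras over a field\<close>

definition type_module :: "('k \<Rightarrow> 'v::ab_group_add \<Rightarrow> 'v) \<Rightarrow> ('k, 'v) module" where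
  "type_module sc =
     \<lparr>carrier = UNIV, monoid.mult = undefined, one = undefined, ring.zero = 0, add = (+), module.smult = sc\<rparr>"

definition type_algebra :: "('k \<Rightarrow> 'v::{ring,monoid_mult} \<Rightarrow> 'v) \<Rightarrow> ('k, 'v) module" where
  "type_algebra sc =
     \<lparr>carrier = UNIV, monoid.mult = (*), one = 1, ring.zero = 0, add = (+), module.smult = sc\<rparr>"

definition k_module :: "('k::field, 'v) module \<Rightarrow> bool" where
  "k_module M \<longleftrightarrow> module (ring_of_type_algebra :: 'k ring) M"

text \<open>The library locale \<open>algebra\<close> is for commutative algebras only.\<close>

definition k_algebra :: "('k::field, 'v) module \<Rightarrow> bool" where
  "k_algebra R \<longleftrightarrow> ring R \<and> k_module R \<and>
     (\<forall>c. \<forall>x\<in>carrier R. \<forall>y\<in>carrier R.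
        (c \<odot>\<^bsub>R\<^esub> x) \<otimes>\<^bsub>R\<^esub> y = c \<odot>\<^bsub>R\<^esub> (x \<otimes>\<^bsub>R\<^esub> y) \<and>
        x \<otimes>\<^bsub>R\<^esub> (c \<odot>\<^bsub>R\<^esub> y) = c \<odot>\<^bsub>R\<^esub> (x \<otimes>\<^bsub>R\<^esub> y))"

text \<open>Linear maps; values outside the carrier are ignored.\<close>

definition Vect :: "('k, 'v) module \<Rightarrow> ('k, 'w) module \<Rightarrow> ('v \<Rightarrow> 'w) set" where
  "Vect M N = {f. f \<in> carrier M \<rightarrow> carrier N \<and>
     (\<forall>x\<in>carrier M. \<forall>y\<in>carrier M. f (x \<oplus>\<^bsub>M\<^esub> y) = f x \<oplus>\<^bsub>N\<^esub> f y) \<and>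
     (\<forall>c. \<forall>x\<in>carrier M. f (c \<odot>\<^bsub>M\<^esub> x) = c \<odot>\<^bsub>N\<^esub> f x)}"

definition quot_module :: "('k, 'v) module \<Rightarrow> 'v set \<Rightarrow> ('k, 'v set) module" where
  "quot_module M N =
     \<lparr>carrier = a_rcosets\<^bsub>M\<^esub> N, monoid.mult = undefined, one = undefined,
      ring.zero = N, add = set_add M,
      module.smult = (\<lambda>c T. set_add M N ((\<lambda>x. c \<odot>\<^bsub>M\<^esub> x) ` T))\<rparr>"

text \<open>Transport of structure along a bijection \<open>i\<close> with inverse \<open>p\<close>.\<close>

definition copy_module :: "('v \<Rightarrow> 'w) \<Rightarrow> ('w \<Rightarrow> 'v) \<Rightarrow> ('k, 'v) module \<Rightarrow> ('k, 'w) module" where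
  "copy_module i p M =
     \<lparr>carrier = i ` carrier M, monoid.mult = undefined, one = undefined, ring.zero = i \<zero>\<^bsub>M\<^esub>,
      add = (\<lambda>x y. i (p x \<oplus>\<^bsub>M\<^esub> p y)), module.smult = (\<lambda>c x. i (c \<odot>\<^bsub>M\<^esub> p x))\<rparr>"

section \<open>Tensor powers\<close>

definition fscale :: "'k::field \<Rightarrow> ('g \<Rightarrow>\<^sub>0 'k) \<Rightarrow> ('g \<Rightarrow>\<^sub>0 'k)" where
  "fscale c F = Poly_Mapping.map ((*) c) F"

lemma lookup_fscale: "Poly_Mapping.lookup (fscale c F) g = c * Poly_Mapping.lookup F g"
  by (simp add: fscale_def Poly_Mapping.map.rep_eq when_def)

global_interpretation free: vector_space "fscale :: 'k::field \<Rightarrow> ('g \<Rightarrow>\<^sub>0 'k) \<Rightarrow> ('g \<Rightarrow>\<^sub>0 'k)"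
  by unfold_locales
    (auto intro!: poly_mapping_eqI simp: lookup_fscale lookup_add algebra_simps)

definition free_module :: "'g set \<Rightarrow> ('k::field, 'g \<Rightarrow>\<^sub>0 'k) module" where
  "free_module W = (type_module fscale)\<lparr>carrier := {F. Poly_Mapping.keys F \<subseteq> W}\<rparr>"

abbreviation fsingle :: "'g \<Rightarrow> ('g \<Rightarrow>\<^sub>0 'k::field)" where
  "fsingle g \<equiv> Poly_Mapping.single g 1"

text \<open>
  The \<open>n\<close>-fold tensor power of a \<open>k\<close>-vector space over a ring \<open>A\<close> acting on it from the right
  by \<open>r\<close> and from the left by \<open>l\<close>: the free space on words of length \<open>n\<close>, modulo
  multilinearity over \<open>k\<close> and \<open>\<dots> \<otimes> u\<cdot>a \<otimes> v \<otimes> \<dots> = \<dots> \<otimes> u \<otimes> a\<cdot>v \<otimes> \<dots>\<close>.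
\<close>

definition tensor_rels ::
  "('k::field \<Rightarrow> 'u::ab_group_add \<Rightarrow> 'u) \<Rightarrow> ('a \<Rightarrow> 'u \<Rightarrow> 'u) \<Rightarrow> ('a \<Rightarrow> 'u \<Rightarrow> 'u) \<Rightarrow> nat
     \<Rightarrow> ('u list \<Rightarrow>\<^sub>0 'k) set" where
  "tensor_rels sc r l n =
     {fsingle (xs @ [u + v] @ ys) - fsingle (xs @ [u] @ ys) - fsingle (xs @ [v] @ ys) | xs u v ys.
        length xs + 1 + length ys = n} \<union>
     {fsingle (xs @ [sc c u] @ ys) - fscale c (fsingle (xs @ [u] @ ys)) | xs c u ys.
        length xs + 1 + length ys = n} \<union>
     {fsingle (xs @ [r a u, v] @ ys) - fsingle (xs @ [u, l a v] @ ys) | xs a u v ys.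
        length xs + 2 + length ys = n}"

definition tensor_power ::
  "('k::field \<Rightarrow> 'u::ab_group_add \<Rightarrow> 'u) \<Rightarrow> ('a \<Rightarrow> 'u \<Rightarrow> 'u) \<Rightarrow> ('a \<Rightarrow> 'u \<Rightarrow> 'u) \<Rightarrow> nat
     \<Rightarrow> ('k, ('u list \<Rightarrow>\<^sub>0 'k) set) module" where
  "tensor_power sc r l n =
     quot_module (free_module {us. length us = n}) (free.span (tensor_rels sc r l n))"

text \<open>The pure tensor \<open>u\<^sub>1 \<otimes> \<dots> \<otimes> u\<^sub>n\<close>.\<close>

definition tens ::
  "('k::field \<Rightarrow> 'u::ab_group_add \<Rightarrow> 'u) \<Rightarrow> ('a \<Rightarrow> 'u \<Rightarrow> 'u) \<Rightarrow> ('a \<Rightarrow> 'u \<Rightarrow> 'u)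
     \<Rightarrow> 'u list \<Rightarrow> ('u list \<Rightarrow>\<^sub>0 'k) set" where
  "tens sc r l us =
     free.span (tensor_rels sc r l (length us)) +>\<^bsub>free_module {vs. length vs = length us}\<^esub> fsingle us"

text \<open>
  The value at the tensor \<open>T\<close> of the linear map into \<open>M\<close> sending \<open>u\<^sub>1 \<otimes> \<dots> \<otimes> u\<^sub>n\<close> to
  \<open>f [u\<^sub>1, \<dots>, u\<^sub>n]\<close>: extend \<open>f\<close> linearly and evaluate at any representative of \<open>T\<close>.
  It is meaningful only when \<open>f\<close> respects the tensor relations. Where uses are nested, the
  order is the one in which every stage does so.
\<close>

definition tensor_lift ::
  "('k::field, 'w) module \<Rightarrow> ('u list \<Rightarrow> 'w) \<Rightarrow> ('u list \<Rightarrow>\<^sub>0 'k) set \<Rightarrow> 'w" where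
  "tensor_lift M f T = the_elem ((\<lambda>F.
     \<Oplus>\<^bsub>M\<^esub>us\<in>Poly_Mapping.keys F. Poly_Mapping.lookup F us \<odot>\<^bsub>M\<^esub> f us) ` T)"

text \<open>The Sweedler sum \<open>\<Sum> f x\<^sub>(\<^sub>1\<^sub>) x\<^sub>(\<^sub>2\<^sub>)\<close> in \<open>M\<close>, for \<open>T = \<Delta> x\<close>.\<close>

definition sweedler ::
  "('k::field, 'w) module \<Rightarrow> ('u list \<Rightarrow>\<^sub>0 'k) set \<Rightarrow> ('u \<Rightarrow> 'u \<Rightarrow> 'w) \<Rightarrow> 'w" where
  "sweedler M T f = tensor_lift M (\<lambda>us. f (us ! 0) (us ! 1)) T"

section \<open>Coalgebras and measurings of algebras\<close>

record (overloaded) ('k, 'c) coalg =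
  cscale :: "'k \<Rightarrow> 'c \<Rightarrow> 'c"
  comult :: "'c \<Rightarrow> ('c list \<Rightarrow>\<^sub>0 'k::zero) set"
  counit :: "'c \<Rightarrow> 'k"

definition cpow :: "('k::field, 'c::ab_group_add) coalg \<Rightarrow> nat \<Rightarrow> ('k, ('c list \<Rightarrow>\<^sub>0 'k) set) module" where
  "cpow C = tensor_power (cscale C) (cscale C) (cscale C)"

definition ctens :: "('k::field, 'c::ab_group_add) coalg \<Rightarrow> 'c list \<Rightarrow> ('c list \<Rightarrow>\<^sub>0 'k) set" where
  "ctens C = tens (cscale C) (cscale C) (cscale C)"

definition coalgebra :: "('k::field, 'c::ab_group_add) coalg \<Rightarrow> bool" where
  "coalgebra C \<longleftrightarrow>
     k_module (type_module (cscale C)) \<and>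
     comult C \<in> Vect (type_module (cscale C)) (cpow C 2) \<and>
     counit C \<in> Vect (type_module (cscale C)) (type_algebra (*)) \<and>
     (\<forall>x. sweedler (cpow C 3) (comult C x)
            (\<lambda>y z. sweedler (cpow C 3) (comult C y) (\<lambda>p q. ctens C [p, q, z])) =
          sweedler (cpow C 3) (comult C x)
            (\<lambda>y z. sweedler (cpow C 3) (comult C z) (\<lambda>p q. ctens C [y, p, q]))) \<and>
     (\<forall>x. sweedler (type_module (cscale C)) (comult C x) (\<lambda>y z. cscale C (counit C y) z) = x) \<and>
     (\<forall>x. sweedler (type_module (cscale C)) (comult C x) (\<lambda>y z. cscale C (counit C z) y) = x)"

definition cocommutative :: "('k::field, 'c::ab_group_add) coalg \<Rightarrow> bool" where
  "cocommutative C \<longleftrightarrow>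
     (\<forall>x. sweedler (cpow C 2) (comult C x) (\<lambda>y z. ctens C [z, y]) = comult C x)"

text \<open>\<open>iter_comult C n x = x\<^sub>(\<^sub>1\<^sub>) \<otimes> \<dots> \<otimes> x\<^sub>(\<^sub>n\<^sub>+\<^sub>1\<^sub>)\<close>\<close>

primrec iter_comult ::
  "('k::field, 'c::ab_group_add) coalg \<Rightarrow> nat \<Rightarrow> 'c \<Rightarrow> ('c list \<Rightarrow>\<^sub>0 'k) set" where
  "iter_comult C 0 x = ctens C [x]"
| "iter_comult C (Suc n) x =
     sweedler (cpow C (n + 2)) (comult C x)
       (\<lambda>y z. tensor_lift (cpow C (n + 2)) (\<lambda>zs. ctens C (y # zs)) (iter_comult C n z))"

definition algebra_measuring ::
  "('k::field, 'c::ab_group_add) coalg \<Rightarrow> ('k, 'r) module \<Rightarrow> ('k, 's) module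
     \<Rightarrow> ('c \<Rightarrow> 'r \<Rightarrow> 's) \<Rightarrow> bool" where
  "algebra_measuring C R R' \<psi> \<longleftrightarrow>
     coalgebra C \<and> k_algebra R \<and> k_algebra R' \<and>
     (\<forall>x. \<psi> x \<in> Vect R R') \<and>
     (\<forall>x y. \<forall>a\<in>carrier R. \<psi> (x + y) a = \<psi> x a \<oplus>\<^bsub>R'\<^esub> \<psi> y a) \<and>
     (\<forall>c x. \<forall>a\<in>carrier R. \<psi> (cscale C c x) a = c \<odot>\<^bsub>R'\<^esub> \<psi> x a) \<and>
     (\<forall>x. \<forall>a\<in>carrier R. \<forall>b\<in>carrier R.
        \<psi> x (a \<otimes>\<^bsub>R\<^esub> b) = sweedler R' (comult C x) (\<lambda>y z. \<psi> y a \<otimes>\<^bsub>R'\<^esub> \<psi> z b)) \<and>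
     (\<forall>x. \<psi> x \<one>\<^bsub>R\<^esub> = counit C x \<odot>\<^bsub>R'\<^esub> \<one>\<^bsub>R'\<^esub>)"

section \<open>Hopf algebroids\<close>

record (overloaded) ('k, 'a, 'u) bialg =
  scaleA :: "'k \<Rightarrow> 'a \<Rightarrow> 'a"
  scaleU :: "'k \<Rightarrow> 'u \<Rightarrow> 'u"
  sL :: "'a \<Rightarrow> 'u"
  tL :: "'a \<Rightarrow> 'u"
  DeltaL :: "'u \<Rightarrow> ('u list \<Rightarrow>\<^sub>0 'k::zero) set"
  epsL :: "'u \<Rightarrow> 'a"

record (overloaded) ('k, 'a, 'u) hopf = "('k::zero, 'a, 'u) bialg" +
  antipode :: "'u \<Rightarrow> 'u"

abbreviation algA :: "('k, 'a::{ring,monoid_mult}, 'u, 'z) bialg_scheme \<Rightarrow> ('k::zero, 'a) module" where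
  "algA H \<equiv> type_algebra (scaleA H)"

abbreviation algU :: "('k, 'a, 'u::{ring,monoid_mult}, 'z) bialg_scheme \<Rightarrow> ('k::zero, 'u) module" where
  "algU H \<equiv> type_algebra (scaleU H)"

text \<open>Tensor powers over \<open>A\<^sub>L\<close>, formed with \<open>a\<cdot>u\<cdot>b = s\<^sub>L(a) t\<^sub>L(b) u\<close>.\<close>

definition lpow ::
  "('k::field, 'a, 'u::{ring,monoid_mult}, 'z) bialg_scheme \<Rightarrow> nat
     \<Rightarrow> ('k, ('u list \<Rightarrow>\<^sub>0 'k) set) module" where
  "lpow H = tensor_power (scaleU H) (\<lambda>a u. tL H a * u) (\<lambda>a u. sL H a * u)"

definition ltens ::
  "('k::field, 'a, 'u::{ring,monoid_mult}, 'z) bialg_scheme \<Rightarrow> 'u list \<Rightarrow> ('u list \<Rightarrow>\<^sub>0 'k) set" where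
  "ltens H = tens (scaleU H) (\<lambda>a u. tL H a * u) (\<lambda>a u. sL H a * u)"

text \<open>
  In the multiplicativity of \<open>\<Delta>\<^sub>L\<close> the inner sum runs over \<open>\<Delta>\<^sub>L u\<close>: for fixed
  \<open>v\<^sub>(\<^sub>1\<^sub>), v\<^sub>(\<^sub>2\<^sub>)\<close> it is balanced, and the outer sum is so by the Takeuchi condition.
\<close>

definition left_bialgebroid ::
  "('k::field, 'a::{ring,monoid_mult}, 'u::{ring,monoid_mult}, 'z) bialg_scheme \<Rightarrow> bool" where
  "left_bialgebroid H \<longleftrightarrow>
     k_algebra (algA H) \<and> k_algebra (algU H) \<and>
     \<comment> \<open>source and target\<close>
     sL H \<in> Vect (algA H) (algU H) \<and> sL H 1 = 1 \<and> (\<forall>a b. sL H (a * b) = sL H a * sL H b) \<and>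
     tL H \<in> Vect (algA H) (algU H) \<and> tL H 1 = 1 \<and> (\<forall>a b. tL H (a * b) = tL H b * tL H a) \<and>
     (\<forall>a b. sL H a * tL H b = tL H b * sL H a) \<and>
     \<comment> \<open>coalgebra in bimodules\<close>
     DeltaL H \<in> Vect (algU H) (lpow H 2) \<and>
     (\<forall>a b u. DeltaL H (sL H a * tL H b * u) =
        sweedler (lpow H 2) (DeltaL H u) (\<lambda>p q. ltens H [sL H a * p, tL H b * q])) \<and>
     epsL H \<in> Vect (algU H) (algA H) \<and>
     (\<forall>a b u. epsL H (sL H a * tL H b * u) = a * epsL H u * b) \<and>
     (\<forall>u. sweedler (lpow H 3) (DeltaL H u)
            (\<lambda>v w. sweedler (lpow H 3) (DeltaL H v) (\<lambda>p q. ltens H [p, q, w])) =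
          sweedler (lpow H 3) (DeltaL H u)
            (\<lambda>v w. sweedler (lpow H 3) (DeltaL H w) (\<lambda>p q. ltens H [v, p, q]))) \<and>
     (\<forall>u. sweedler (algU H) (DeltaL H u) (\<lambda>p q. sL H (epsL H p) * q) = u) \<and>
     (\<forall>u. sweedler (algU H) (DeltaL H u) (\<lambda>p q. tL H (epsL H q) * p) = u) \<and>
     \<comment> \<open>Takeuchi condition and multiplicativity\<close>
     (\<forall>u a. sweedler (lpow H 2) (DeltaL H u) (\<lambda>p q. ltens H [p * tL H a, q]) =
            sweedler (lpow H 2) (DeltaL H u) (\<lambda>p q. ltens H [p, q * sL H a])) \<and>
     DeltaL H 1 = ltens H [1, 1] \<and>
     (\<forall>u v. DeltaL H (u * v) =
        sweedler (lpow H 2) (DeltaL H v) (\<lambda>v1 v2.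
          sweedler (lpow H 2) (DeltaL H u) (\<lambda>u1 u2. ltens H [u1 * v1, u2 * v2]))) \<and>
     (\<forall>u v. epsL H (u * sL H (epsL H v)) = epsL H (u * v) \<and>
            epsL H (u * tL H (epsL H v)) = epsL H (u * v))"

definition hopf_algebroid ::
  "('k::field, 'a::{ring,monoid_mult}, 'u::{ring,monoid_mult}) hopf \<Rightarrow> bool" where
  "hopf_algebroid H \<longleftrightarrow>
     left_bialgebroid H \<and>
     antipode H \<in> Vect (algU H) (algU H) \<and> antipode H 1 = 1 \<and>
     (\<forall>u v. antipode H (u * v) = antipode H v * antipode H u) \<and>
     (\<forall>u. antipode H (antipode H u) = u) \<and>
     (\<forall>a. antipode H (tL H a) = sL H a) \<and>
     (\<forall>u. sweedler (lpow H 2) (DeltaL H u)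
            (\<lambda>u1 u2. sweedler (lpow H 2) (DeltaL H (antipode H u1)) (\<lambda>p q. ltens H [p * u2, q])) =
          ltens H [1, antipode H u]) \<and>
     (\<forall>u. sweedler (lpow H 2) (DeltaL H u)
            (\<lambda>u1 u2. sweedler (lpow H 2) (DeltaL H (antipode H u2)) (\<lambda>p q. ltens H [p, q * u1])) =
          ltens H [antipode H u, 1])"

definition commutative_hopf_algebroid ::
  "('k::field, 'a::{ring,monoid_mult}, 'u::{ring,monoid_mult}) hopf \<Rightarrow> bool" where
  "commutative_hopf_algebroid H \<longleftrightarrow>
     hopf_algebroid H \<and> (\<forall>a b :: 'a. a * b = b * a) \<and> (\<forall>u v :: 'u. u * v = v * u)"

text \<open>
  The last conjunct is stated with the sum over \<open>\<Delta> x\<close> inside: for a fixed pair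
  \<open>x\<^sub>(\<^sub>1\<^sub>), x\<^sub>(\<^sub>2\<^sub>)\<close> the expression need not be balanced over \<open>A\<^sub>L\<close>.
\<close>

definition hopf_measuring ::
  "('k::field, 'c::ab_group_add) coalg \<Rightarrow>
   ('k, 'a::{ring,monoid_mult}, 'u::{ring,monoid_mult}) hopf \<Rightarrow>
   ('k, 'b::{ring,monoid_mult}, 'v::{ring,monoid_mult}) hopf \<Rightarrow>
   ('c \<Rightarrow> 'u \<Rightarrow> 'v) \<Rightarrow> ('c \<Rightarrow> 'a \<Rightarrow> 'b) \<Rightarrow> bool" where
  "hopf_measuring C H H' \<Psi> \<psi> \<longleftrightarrow>
     algebra_measuring C (algU H) (algU H') \<Psi> \<and>
     algebra_measuring C (algA H) (algA H') \<psi> \<and>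
     (\<forall>x a. \<Psi> x (sL H a) = sL H' (\<psi> x a)) \<and>
     (\<forall>x a. \<Psi> x (tL H a) = tL H' (\<psi> x a)) \<and>
     (\<forall>x u. \<Psi> x (antipode H u) = antipode H' (\<Psi> x u)) \<and>
     (\<forall>x u. \<psi> x (epsL H u) = epsL H' (\<Psi> x u)) \<and>
     (\<forall>x u. DeltaL H' (\<Psi> x u) =
        sweedler (lpow H' 2) (DeltaL H u) (\<lambda>u1 u2.
          sweedler (lpow H' 2) (comult C x) (\<lambda>x1 x2. ltens H' [\<Psi> x1 u1, \<Psi> x2 u2])))"

section \<open>The Hochschild complex and its homology\<close>

text \<open>
  The right bialgebroid structure: \<open>A\<^sub>R\<close> is the opposite of \<open>A\<^sub>L\<close>, and tensor powers over
  \<open>A\<^sub>R\<close> are formed with \<open>a\<cdot>u\<cdot>b = s\<^sub>R(a) u s\<^sub>R(b)\<close>.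
\<close>

definition sR :: "('k::field, 'a, 'u) hopf \<Rightarrow> 'a \<Rightarrow> 'u" where
  "sR H = tL H"

definition epsR :: "('k::field, 'a, 'u) hopf \<Rightarrow> 'u \<Rightarrow> 'a" where
  "epsR H u = epsL H (antipode H u)"

definition rpow ::
  "('k::field, 'a, 'u::{ring,monoid_mult}) hopf \<Rightarrow> nat \<Rightarrow> ('k, ('u list \<Rightarrow>\<^sub>0 'k) set) module" where
  "rpow H = tensor_power (scaleU H) (\<lambda>a u. u * sR H a) (\<lambda>a u. sR H a * u)"

definition rtens ::
  "('k::field, 'a, 'u::{ring,monoid_mult}) hopf \<Rightarrow> 'u list \<Rightarrow> ('u list \<Rightarrow>\<^sub>0 'k) set" where
  "rtens H = tens (scaleU H) (\<lambda>a u. u * sR H a) (\<lambda>a u. sR H a * u)"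

text \<open>Chains of degree \<open>0\<close> are \<open>Inl a\<close>, those of positive degree are \<open>Inr T\<close> with \<open>T\<close> a tensor.\<close>

type_synonym ('k, 'a, 'u) chain = "'a + ('u list \<Rightarrow>\<^sub>0 'k) set"

definition chains ::
  "('k::field, 'a::{ring,monoid_mult}, 'u::{ring,monoid_mult}) hopf \<Rightarrow> nat
     \<Rightarrow> ('k, ('k, 'a, 'u) chain) module" where
  "chains H n =
     (if n = 0 then copy_module Inl projl (algA H) else copy_module Inr projr (rpow H n))"

definition face ::
  "('k::field, 'a::{ring,monoid_mult}, 'u::{ring,monoid_mult}) hopf \<Rightarrow> nat \<Rightarrow> 'u list
     \<Rightarrow> ('k, 'a, 'u) chain" where
  "face H i us =
     (let n = length us in
      if n = 1 then Inl (if i = 0 then epsR H (us ! 0) else epsR H (antipode H (us ! 0)))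
      else Inr (rtens H
        (if i = 0 then (sR H (epsR H (us ! 0)) * us ! 1) # drop 2 us
         else if i < n then take (i - 1) us @ [us ! (i - 1) * us ! i] @ drop (i + 1) us
         else take (n - 2) us @ [us ! (n - 2) * sR H (epsR H (antipode H (us ! (n - 1))))])))"

text \<open>The differential from degree \<open>n\<close> to degree \<open>n - 1\<close>, for \<open>n > 0\<close>.\<close>

definition diff ::
  "('k::field, 'a::{ring,monoid_mult}, 'u::{ring,monoid_mult}) hopf \<Rightarrow> nat
     \<Rightarrow> ('k, 'a, 'u) chain \<Rightarrow> ('k, 'a, 'u) chain" where
  "diff H n T = tensor_lift (chains H (n - 1))
     (\<lambda>us. \<Oplus>\<^bsub>chains H (n - 1)\<^esub>i\<in>{..n}. (- 1) ^ i \<odot>\<^bsub>chains H (n - 1)\<^esub> face H i us) (projr T)"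

definition cycles ::
  "('k::field, 'a::{ring,monoid_mult}, 'u::{ring,monoid_mult}) hopf \<Rightarrow> nat
     \<Rightarrow> ('k, 'a, 'u) chain set" where
  "cycles H n =
     (if n = 0 then carrier (chains H 0) else a_kernel (chains H n) (chains H (n - 1)) (diff H n))"

definition boundaries ::
  "('k::field, 'a::{ring,monoid_mult}, 'u::{ring,monoid_mult}) hopf \<Rightarrow> nat
     \<Rightarrow> ('k, 'a, 'u) chain set" where
  "boundaries H n = diff H (n + 1) ` carrier (chains H (n + 1))"

definition hclass ::
  "('k::field, 'a::{ring,monoid_mult}, 'u::{ring,monoid_mult}) hopf \<Rightarrow> nat
     \<Rightarrow> ('k, 'a, 'u) chain \<Rightarrow> ('k, 'a, 'u) chain set" where
  "hclass H n z = boundaries H n +>\<^bsub>chains H n\<^esub> z"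

definition HH ::
  "('k::field, 'a::{ring,monoid_mult}, 'u::{ring,monoid_mult}) hopf \<Rightarrow> nat
     \<Rightarrow> ('k, ('k, 'a, 'u) chain set) module" where
  "HH H n = quot_module ((chains H n)\<lparr>carrier := cycles H n\<rparr>) (boundaries H n)"

section \<open>The shuffle product\<close>

text \<open>Permutations are of \<open>{0, \<dots>, p + q - 1}\<close> rather than of \<open>{1, \<dots>, p + q}\<close>.\<close>

definition shuffle_perms :: "nat \<Rightarrow> nat \<Rightarrow> (nat \<Rightarrow> nat) set" where
  "shuffle_perms p q =
     {\<sigma>. \<sigma> permutes {..<p + q} \<and> strict_mono_on {..<p} \<sigma> \<and> strict_mono_on {p..<p + q} \<sigma>}"

definition sh ::
  "('k::field, 'a::{ring,monoid_mult}, 'u::{ring,monoid_mult}) hopf \<Rightarrow> nat \<Rightarrow> nat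
     \<Rightarrow> ('k, 'a, 'u) chain \<Rightarrow> ('k, 'a, 'u) chain \<Rightarrow> ('k, 'a, 'u) chain" where
  "sh H p q T V =
     (case (T, V) of
        (Inl a, Inl b) \<Rightarrow> Inl (a * b)
      | (Inr T', Inl a) \<Rightarrow>
          tensor_lift (chains H p) (\<lambda>us. Inr (rtens H ((tL H a * hd us) # tl us))) T'
      | (Inl a, Inr V') \<Rightarrow>
          tensor_lift (chains H q) (\<lambda>vs. Inr (rtens H (butlast vs @ [last vs * tL H a]))) V'
      | (Inr T', Inr V') \<Rightarrow>
          tensor_lift (chains H (p + q)) (\<lambda>us.
            tensor_lift (chains H (p + q)) (\<lambda>vs.
              \<Oplus>\<^bsub>chains H (p + q)\<^esub>\<sigma>\<in>shuffle_perms p q.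
                of_int (sign \<sigma>) \<odot>\<^bsub>chains H (p + q)\<^esub>
                  Inr (rtens H (map (\<lambda>i. (us @ vs) ! (inv_into UNIV \<sigma> i)) [0..<p + q]))) V') T')"

text \<open>The induced product on homology, computed with any choice of representing cycles.\<close>

definition hsh ::
  "('k::field, 'a::{ring,monoid_mult}, 'u::{ring,monoid_mult}) hopf \<Rightarrow> nat \<Rightarrow> nat
     \<Rightarrow> ('k, 'a, 'u) chain set \<Rightarrow> ('k, 'a, 'u) chain set \<Rightarrow> ('k, 'a, 'u) chain set" where
  "hsh H p q \<alpha> \<beta> = the_elem {hclass H (p + q) (sh H p q z w) | z w. z \<in> \<alpha> \<and> w \<in> \<beta>}"

text \<open>
  The algebra \<open>(HH\<^sub>\<bullet>(\<U>), sh(\<U>))\<close> on the direct sum of the \<open>HH\<^sub>n(\<U>)\<close>.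
\<close>

definition HH_algebra ::
  "('k::field, 'a::{ring,monoid_mult}, 'u::{ring,monoid_mult}) hopf
     \<Rightarrow> ('k, nat \<Rightarrow> ('k, 'a, 'u) chain set) module" where
  "HH_algebra H =
     \<lparr>carrier = {\<alpha>. (\<forall>n. \<alpha> n \<in> carrier (HH H n)) \<and> finite {n. \<alpha> n \<noteq> \<zero>\<^bsub>HH H n\<^esub>}},
      monoid.mult = (\<lambda>\<alpha> \<beta> n. \<Oplus>\<^bsub>HH H n\<^esub>p\<in>{..n}. hsh H p (n - p) (\<alpha> p) (\<beta> (n - p))),
      one = (\<lambda>n. if n = 0 then hclass H 0 (Inl 1) else \<zero>\<^bsub>HH H n\<^esub>),
      ring.zero = (\<lambda>n. \<zero>\<^bsub>HH H n\<^esub>),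
      add = (\<lambda>\<alpha> \<beta> n. \<alpha> n \<oplus>\<^bsub>HH H n\<^esub> \<beta> n),
      module.smult = (\<lambda>c \<alpha> n. c \<odot>\<^bsub>HH H n\<^esub> \<alpha> n)\<rparr>"

section \<open>The map induced by a measuring\<close>

definition hoc_chain ::
  "('k::field, 'c::ab_group_add) coalg \<Rightarrow>
   ('k, 'b::{ring,monoid_mult}, 'v::{ring,monoid_mult}) hopf \<Rightarrow>
   ('c \<Rightarrow> 'u \<Rightarrow> 'v) \<Rightarrow> ('c \<Rightarrow> 'a \<Rightarrow> 'b) \<Rightarrow> 'c \<Rightarrow> nat
     \<Rightarrow> ('k, 'a, 'u) chain \<Rightarrow> ('k, 'b, 'v) chain" where
  "hoc_chain C H' \<Psi> \<psi> x n T =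
     (case T of
        Inl a \<Rightarrow> Inl (\<psi> x a)
      | Inr T' \<Rightarrow>
          tensor_lift (chains H' n) (\<lambda>us.
            tensor_lift (chains H' n) (\<lambda>xs. Inr (rtens H' (map2 \<Psi> xs us)))
              (iter_comult C (n - 1) x)) T')"

definition hoc ::
  "('k::field, 'c::ab_group_add) coalg \<Rightarrow>
   ('k, 'b::{ring,monoid_mult}, 'v::{ring,monoid_mult}) hopf \<Rightarrow>
   ('c \<Rightarrow> 'u \<Rightarrow> 'v) \<Rightarrow> ('c \<Rightarrow> 'a \<Rightarrow> 'b) \<Rightarrow> 'c
     \<Rightarrow> (nat \<Rightarrow> ('k, 'a, 'u) chain set) \<Rightarrow> (nat \<Rightarrow> ('k, 'b, 'v) chain set)" where
  "hoc C H' \<Psi> \<psi> x \<alpha> n = the_elem {hclass H' n (hoc_chain C H' \<Psi> \<psi> x n z) | z. z \<in> \<alpha> n}"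

end

theory Submission
  imports Defs
begin

text \<open>
  The Hochschild complex of a commutative Hopf algebroid is the two-sided bar complex of the
  commutative \<open>A\<close>-algebra \<open>U\<close> (via \<open>t\<^sub>L\<close>) with its two augmentations \<open>\<epsilon>\<^sub>R\<close> and \<open>\<epsilon>\<^sub>R \<circ> S\<close>; the
  comultiplication of \<open>U\<close> plays no role. On formal combinations of words \<open>(a, u\<^sub>1 \<dots> u\<^sub>n)\<close>, which
  stand for \<open>t\<^sub>L(a) u\<^sub>1 \<otimes> \<dots> \<otimes> u\<^sub>n\<close>, the differential and the shuffle product already satisfy
  \<open>d \<circ> d = 0\<close>, the Leibniz rule, associativity and the unit laws on the nose, before passing to
  tensors. Two combinations represent the same chain iff all balanced multilinear functions with
  values in \<open>k\<close> agree on them, so identities that hold only modulo the tensor relations become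
  identities of Sweedler sums in the field \<open>k\<close>. There the action of \<open>x\<close> commutes with the faces by
  coassociativity and the measuring property, and it is compatible with the shuffle product because
  cocommutativity allows to distribute \<open>x\<^sub>(\<^sub>1\<^sub>), x\<^sub>(\<^sub>2\<^sub>), \<dots>\<close> to the letters of the two words in any order.
\<close>

section \<open>Linear extension\<close>

text \<open>The maps in the statement are values of \<open>tensor_lift\<close> and
  \<open>the_elem\<close> on cosets, computed in records that carry no laws of their own, so
  independence of representatives has to be settled at every stage. \<open>presents\<close> handles
  this: a record is the image of a subspace of a vector space, and scalar functionals detect zero.
  Well-definedness then amounts to multilinearity of scalar functions, because over a field a vector
  outside a subspace can be separated from it by a functional. The coefficient \<open>a\<close> of a
  word keeps the augmentations produced by the outer faces, instead of multiplying them into a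
  neighbouring letter; this is what frees d d = 0 and the Leibniz rule from tensor relations. The
  recursions \<open>shE\<close> and \<open>dE\<close> return a value at a test function rather than
  a combination, so the same equations serve for scalars and, with \<open>fsingle\<close> as test
  function, for combinations. A summand with x_1, x_2 fixed need not be balanced over A. Only whole
  Sweedler sums are, so balancedness is shown for the action \<open>hE\<close> as a whole,
  coefficient included.\<close>

definition lext :: "('k::field \<Rightarrow> 'w::ab_group_add \<Rightarrow> 'w) \<Rightarrow> ('g \<Rightarrow> 'w) \<Rightarrow> ('g \<Rightarrow>\<^sub>0 'k) \<Rightarrow> 'w" where
  "lext sc f F = (\<Sum>g\<in>Poly_Mapping.keys F. sc (Poly_Mapping.lookup F g) (f g))"

lemma vector_space_times [simp]: "vector_space ((*) :: 'k::field \<Rightarrow> 'k \<Rightarrow> 'k)"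
  by unfold_locales (auto simp: algebra_simps)

lemma linear_facts:
  assumes "Vector_Spaces.linear sc sc' h"
  shows "h (x + y) = h x + h y" "h (sc c x) = sc' c (h x)" "h 0 = 0" "h (x - y) = h x - h y"
    "h (sum f I) = (\<Sum>i\<in>I. h (f i))"
proof -
  interpret Vector_Spaces.linear sc sc' h by fact
  show "h (x + y) = h x + h y" "h (sc c x) = sc' c (h x)" "h 0 = 0" "h (x - y) = h x - h y"
    "h (sum f I) = (\<Sum>i\<in>I. h (f i))"
    by (simp_all add: add scale zero diff sum)
qed

lemma linearI:
  assumes "vector_space sc" "vector_space sc'" "\<And>x y. h (x + y) = h x + h y"
    "\<And>c x. h (sc c x) = sc' c (h x)"
  shows "Vector_Spaces.linear sc sc' h"
  using assms by (simp add: Vector_Spaces.linear_iff)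

locale vspace = vector_space sc for sc :: "'k::field \<Rightarrow> 'w::ab_group_add \<Rightarrow> 'w"
begin

text \<open>Padding the index set with zero coefficients lets two combinations be summed over one
  common set.\<close>

lemma lext_superset:
  assumes "finite V" "Poly_Mapping.keys F \<subseteq> V"
  shows "lext sc f F = (\<Sum>g\<in>V. sc (Poly_Mapping.lookup F g) (f g))"
  unfolding lext_def using assms
  by (intro sum.mono_neutral_left) (auto simp: in_keys_iff)

lemma lext_add: "lext sc f (F + G) = lext sc f F + lext sc f G"
proof -
  let ?W = "Poly_Mapping.keys F \<union> Poly_Mapping.keys G"
  have "Poly_Mapping.keys (F + G) \<subseteq> ?W" by (rule Poly_Mapping.keys_add)
  then show ?thesis
    by (simp add: lext_superset[of ?W] lookup_add scale_left_distrib sum.distrib)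
qed

lemma lext_fscale: "lext sc f (fscale c F) = sc c (lext sc f F)"
proof -
  have "Poly_Mapping.keys (fscale c F) \<subseteq> Poly_Mapping.keys F"
    by (auto simp: in_keys_iff lookup_fscale)
  then show ?thesis
    by (simp add: lext_superset[of "Poly_Mapping.keys F"] lookup_fscale scale_sum_right)
qed

lemma linear_lext: "Vector_Spaces.linear fscale sc (lext sc f)"
  by (rule linearI) (auto simp: lext_add lext_fscale free.vector_space_axioms vector_space_axioms)

lemmas lext_linear_facts = linear_facts[OF linear_lext]

lemma lext_single: "lext sc f (Poly_Mapping.single g c) = sc c (f g)"
  by (cases "c = 0") (auto simp: lext_def)

lemma lext_fsingle [simp]: "lext sc f (fsingle g) = f g"
  by (simp add: lext_single)

lemma lext_add_fun: "lext sc (\<lambda>g. f g + f' g) F = lext sc f F + lext sc f' F"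
  by (simp add: lext_def scale_right_distrib sum.distrib)

lemma lext_scale_fun: "lext sc (\<lambda>g. sc c (f g)) F = sc c (lext sc f F)"
  by (simp add: lext_def scale_sum_right mult.commute)

lemma lext_mem:
  assumes "subspace S" "\<And>g. g \<in> Poly_Mapping.keys F \<Longrightarrow> f g \<in> S"
  shows "lext sc f F \<in> S"
  unfolding lext_def using assms by (intro subspace_sum subspace_scale) auto

lemma linear_lext_comp:
  assumes "Vector_Spaces.linear sc sc' h"
  shows "h (lext sc f F) = lext sc' (\<lambda>g. h (f g)) F"
  by (simp add: lext_def linear_facts[OF assms])

text \<open>A basis of \<open>N\<close> stays independent when \<open>w\<close> is added, so some
  functional is 1 at \<open>w\<close> and 0 on the basis. Every reduction of an equation in a
  quotient to scalar equations rests on this.\<close>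

lemma separating_functional:
  assumes "subspace N" "w \<notin> N"
  obtains l where "Vector_Spaces.linear sc (*) l" "\<And>x. x \<in> N \<Longrightarrow> l x = 0" "l w \<noteq> 0"
proof -
  interpret vector_space_pair sc "(*) :: 'k \<Rightarrow> _" by (intro vector_space_pair.intro vector_space_axioms) simp
  obtain B where B: "B \<subseteq> N" "independent B" "N \<subseteq> span B"
    using basis_exists[of N] by metis
  have sp: "span B = N" using B assms(1) by (simp add: span_subspace)
  have "independent (insert w B)" using B assms(2) sp by (simp add: independent_insert)
  then obtain l where l: "Vector_Spaces.linear sc (*) l"
      "\<forall>x\<in>insert w B. l x = (if x = w then 1 else 0)"
    using linear_independent_extend[of "insert w B" "\<lambda>x. if x = w then 1 else 0"] by blast
  have "l x = 0" if "x \<in> N" for x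
  proof (rule linear_eq_0_on_span[OF l(1), of B])
    show "x \<in> span B" using that sp by simp
    show "l y = 0" if "y \<in> B" for y using l(2) that B(1) assms(2) by auto
  qed
  then show ?thesis using that l by simp
qed

end

lemma vspace_fscale: "vspace fscale"
  by (simp add: vspace_def free.vector_space_axioms)

lemma lext_cong: "(\<And>g. g \<in> Poly_Mapping.keys F \<Longrightarrow> f g = f' g) \<Longrightarrow> lext sc f F = lext sc f' F"
  by (simp add: lext_def)

lemma lext_swap:
  "lext (*) (\<lambda>g. lext (*) (\<lambda>h. f g h) G) F = lext (*) (\<lambda>h. lext (*) (\<lambda>g. f g h) F) G"
  by (simp add: lext_def sum_distrib_left sum.swap[of _ "Poly_Mapping.keys F"] mult.left_commute)

lemma lext_fsingle_self: "lext fscale fsingle F = F"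
proof -
  have "lext fscale fsingle F = (\<Sum>g\<in>Poly_Mapping.keys F. Poly_Mapping.single g (Poly_Mapping.lookup F g))"
    unfolding lext_def
    by (intro sum.cong refl poly_mapping_eqI) (simp add: lookup_fscale lookup_single when_def)
  also have "\<dots> = F"
    by (intro poly_mapping_eqI)
      (simp add: lookup_sum lookup_single when_def sum.delta in_keys_iff)
  finally show ?thesis .
qed

section \<open>Presentations\<close>

text \<open>
  The functionals in \<open>\<Phi>\<close> only have to detect zero: they need not vanish on the kernel of \<open>h\<close>. So
  arbitrary cochains, not just cocycles, can serve for homology.
\<close>

definition presents ::
  "('k::field \<Rightarrow> 'w::ab_group_add \<Rightarrow> 'w) \<Rightarrow> 'w set \<Rightarrow> ('w \<Rightarrow> 'm) \<Rightarrow> ('k, 'm) module \<Rightarrow> ('w \<Rightarrow> 'k) set \<Rightarrow> bool"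
  where
  "presents sc S h M \<Phi> \<longleftrightarrow>
     vector_space sc \<and> module.subspace sc S \<and> h ` S = carrier M \<and> h 0 = \<zero>\<^bsub>M\<^esub> \<and>
     (\<forall>x\<in>S. \<forall>y\<in>S. h (x + y) = h x \<oplus>\<^bsub>M\<^esub> h y) \<and>
     (\<forall>c. \<forall>x\<in>S. h (sc c x) = c \<odot>\<^bsub>M\<^esub> h x) \<and>
     (\<forall>l\<in>\<Phi>. Vector_Spaces.linear sc (*) l) \<and>
     (\<forall>x\<in>S. (\<forall>l\<in>\<Phi>. l x = 0) \<longrightarrow> h x = \<zero>\<^bsub>M\<^esub>)"

locale presentation = vspace sc
  for sc :: "'k::field \<Rightarrow> 'w::ab_group_add \<Rightarrow> 'w" +
  fixes S :: "'w set" and h :: "'w \<Rightarrow> 'm" and M :: "('k, 'm) module" and \<Phi> :: "('w \<Rightarrow> 'k) set"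
  assumes presents: "presents sc S h M \<Phi>"
begin

lemma subspace_S: "subspace S" and image_S: "h ` S = carrier M" and hom_0: "h 0 = \<zero>\<^bsub>M\<^esub>"
  and hom_add: "\<And>x y. x \<in> S \<Longrightarrow> y \<in> S \<Longrightarrow> h (x + y) = h x \<oplus>\<^bsub>M\<^esub> h y"
  and hom_scale: "\<And>c x. x \<in> S \<Longrightarrow> h (sc c x) = c \<odot>\<^bsub>M\<^esub> h x"
  and linear_functional: "\<And>l. l \<in> \<Phi> \<Longrightarrow> Vector_Spaces.linear sc (*) l"
  and separation: "\<And>x. x \<in> S \<Longrightarrow> (\<And>l. l \<in> \<Phi> \<Longrightarrow> l x = 0) \<Longrightarrow> h x = \<zero>\<^bsub>M\<^esub>"
  using presents unfolding presents_def by auto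

lemma mem_0: "0 \<in> S" and mem_add: "x \<in> S \<Longrightarrow> y \<in> S \<Longrightarrow> x + y \<in> S"
  and mem_scale: "x \<in> S \<Longrightarrow> sc c x \<in> S" and mem_uminus: "x \<in> S \<Longrightarrow> - x \<in> S"
  and mem_diff: "x \<in> S \<Longrightarrow> y \<in> S \<Longrightarrow> x - y \<in> S"
  using subspace_S by (auto simp: subspace_0 subspace_add subspace_scale subspace_neg subspace_diff)

lemma hom_closed: "x \<in> S \<Longrightarrow> h x \<in> carrier M"
  using image_S by auto

text \<open>Since \<open>h\<close> is onto the carrier, each law is inherited from the vector
  space.\<close>

lemma abelian_group: "abelian_group M"
proof (rule abelian_groupI)
  show "\<zero>\<^bsub>M\<^esub> \<in> carrier M" using hom_0 mem_0 hom_closed by metis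
  show "\<exists>y\<in>carrier M. y \<oplus>\<^bsub>M\<^esub> x = \<zero>\<^bsub>M\<^esub>" if x: "x \<in> carrier M" for x
  proof -
    obtain w where w: "w \<in> S" "x = h w" using image_S x by auto
    have "h (- w + w) = h (- w) \<oplus>\<^bsub>M\<^esub> h w" using w by (intro hom_add mem_uminus)
    then have "h (- w) \<oplus>\<^bsub>M\<^esub> x = \<zero>\<^bsub>M\<^esub>" using w by (simp add: hom_0)
    then show ?thesis using w by (auto intro: mem_uminus hom_closed)
  qed
  show "x \<oplus>\<^bsub>M\<^esub> y \<in> carrier M" if "x \<in> carrier M" "y \<in> carrier M" for x y
    using that unfolding image_S[symmetric] by (auto simp flip: hom_add simp: mem_add)
  show "x \<oplus>\<^bsub>M\<^esub> y = y \<oplus>\<^bsub>M\<^esub> x" if "x \<in> carrier M" "y \<in> carrier M" for x y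
    using that unfolding image_S[symmetric] by (auto simp flip: hom_add simp: add.commute)
  show "(x \<oplus>\<^bsub>M\<^esub> y) \<oplus>\<^bsub>M\<^esub> z = x \<oplus>\<^bsub>M\<^esub> (y \<oplus>\<^bsub>M\<^esub> z)"
    if "x \<in> carrier M" "y \<in> carrier M" "z \<in> carrier M" for x y z
    using that unfolding image_S[symmetric] by (auto simp flip: hom_add simp: mem_add add.assoc)
  show "\<zero>\<^bsub>M\<^esub> \<oplus>\<^bsub>M\<^esub> x = x" if "x \<in> carrier M" for x
    using that unfolding image_S[symmetric] by (auto simp flip: hom_add hom_0 simp: mem_0)
qed

lemma k_module: "k_module M"
proof -
  interpret R: cring "ring_of_type_algebra :: 'k ring" by (rule cring_from_type_algebra)
  show ?thesis unfolding k_module_def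
    by (rule moduleI[OF R.cring_axioms abelian_group])
      (auto simp: ring_of_type_algebra_def simp flip: image_S hom_0 hom_add hom_scale
        simp: mem_add mem_scale scale_left_distrib scale_right_distrib)
qed

lemma hom_sum:
  assumes "finite I" "\<And>i. i \<in> I \<Longrightarrow> g i \<in> S"
  shows "(\<Oplus>\<^bsub>M\<^esub>i\<in>I. h (g i)) = h (\<Sum>i\<in>I. g i)"
proof -
  interpret abelian_group M by (rule abelian_group)
  show ?thesis using assms
  proof (induction I)
    case (insert i I)
    then show ?case
      by (subst finsum_insert) (auto simp: hom_closed hom_add subspace_S subspace_sum)
  qed (simp add: hom_0)
qed

lemma hom_eqI:
  assumes "x \<in> S" "y \<in> S" "\<And>l. l \<in> \<Phi> \<Longrightarrow> l x = l y"
  shows "h x = h y"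
proof -
  interpret abelian_group M by (rule abelian_group)
  have "h (x - y) = \<zero>\<^bsub>M\<^esub>"
    using assms by (intro separation mem_diff) (auto simp: linear_facts[OF linear_functional])
  then have "h x = h (x - y) \<oplus>\<^bsub>M\<^esub> h y \<and> h (x - y) \<oplus>\<^bsub>M\<^esub> h y = h y"
    using assms hom_add[of "x - y" y] by (simp add: mem_diff hom_closed)
  then show ?thesis by simp
qed

lemma hom_diff_eq_zero_iff:
  assumes "x \<in> S" "y \<in> S"
  shows "h (x - y) = \<zero>\<^bsub>M\<^esub> \<longleftrightarrow> h x = h y"
proof -
  interpret abelian_group M by (rule abelian_group)
  have "h x = h (x - y) \<oplus>\<^bsub>M\<^esub> h y" using assms hom_add[of "x - y" y] by (simp add: mem_diff)
  then show ?thesis using assms add.r_cancel[of "h (x - y)" "\<zero>\<^bsub>M\<^esub>" "h y"]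
    by (auto simp: hom_closed mem_diff)
qed

text \<open>The sum on the left is the one by which \<open>tensor_lift\<close> evaluates a
  representative; the lemma moves it into the vector space.\<close>

lemma hom_lext:
  assumes "\<And>g. g \<in> Poly_Mapping.keys F \<Longrightarrow> f g \<in> S"
  shows "(\<Oplus>\<^bsub>M\<^esub>g\<in>Poly_Mapping.keys F. Poly_Mapping.lookup F g \<odot>\<^bsub>M\<^esub> h (f g)) = h (lext sc f F)"
proof -
  interpret abelian_group M by (rule abelian_group)
  have "(\<Oplus>\<^bsub>M\<^esub>g\<in>Poly_Mapping.keys F. Poly_Mapping.lookup F g \<odot>\<^bsub>M\<^esub> h (f g)) =
    (\<Oplus>\<^bsub>M\<^esub>g\<in>Poly_Mapping.keys F. h (sc (Poly_Mapping.lookup F g) (f g)))"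
    using assms by (intro finsum_cong') (auto simp: hom_scale hom_closed mem_scale simp flip: hom_scale)
  also have "\<dots> = h (lext sc f F)" unfolding lext_def using assms by (intro hom_sum) (auto simp: mem_scale)
  finally show ?thesis .
qed

lemma coset_eq_image:
  assumes "B \<subseteq> S" "x \<in> S"
  shows "h ` B +>\<^bsub>M\<^esub> h x = h ` ((\<lambda>b. b + x) ` B)"
  using assms unfolding a_r_coset_def r_coset_def by (auto simp: hom_add subset_eq) (metis hom_add image_eqI)

lemma mem_coset_iff:
  assumes "B \<subseteq> S" "x \<in> S"
  shows "y \<in> h ` B +>\<^bsub>M\<^esub> h x \<longleftrightarrow> (\<exists>b\<in>B. y = h (b + x))"
  by (auto simp: coset_eq_image[OF assms])

text \<open>Up to the kernel of \<open>h\<close>, x and y differ by b, so translation by b and by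
  its negative carries each coset into the other.\<close>

lemma coset_eqI:
  assumes B: "subspace B" "B \<subseteq> S" and x: "x \<in> S" and y: "y \<in> S" and b: "b \<in> B" "h (x - y) = h b"
  shows "h ` B +>\<^bsub>M\<^esub> h x = h ` B +>\<^bsub>M\<^esub> h y"
proof -
  have "h (b' + x) = h ((b' + b) + y)" "h (b' + y) = h ((b' - b) + x)" if "b' \<in> B" for b'
  proof -
    have m: "b' \<in> S" "b \<in> S" using that b B by auto
    have "h (x - y - b) = \<zero>\<^bsub>M\<^esub>" using b m x y by (simp add: hom_diff_eq_zero_iff mem_diff)
    then have "h ((b' + x) - ((b' + b) + y)) = \<zero>\<^bsub>M\<^esub>" by (simp add: algebra_simps)
    then show "h (b' + x) = h ((b' + b) + y)" using m x y by (subst (asm) hom_diff_eq_zero_iff) (auto intro: mem_add)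
    have "h (b - (x - y)) = \<zero>\<^bsub>M\<^esub>" using b m x y by (simp add: hom_diff_eq_zero_iff mem_diff)
    then have "h ((b' + y) - ((b' - b) + x)) = \<zero>\<^bsub>M\<^esub>" by (simp add: algebra_simps)
    then show "h (b' + y) = h ((b' - b) + x)" using m x y
      by (subst (asm) hom_diff_eq_zero_iff) (auto intro: mem_add mem_diff)
  qed
  then show ?thesis using B b x y
    by (auto simp: set_eq_iff mem_coset_iff) (metis subspace_add subspace_diff)+
qed

text \<open>Serves both for tensor powers, with \<open>B\<close> the span of the relations, and for
  homology, with \<open>B\<close> the boundaries. The new functionals need not vanish on
  \<open>B\<close>; a vector killed by all of them only has to have its image in that of
  \<open>B\<close>.\<close>

lemma presents_quot:
  assumes B: "subspace B" "B \<subseteq> S"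
    and \<Phi>': "\<And>l. l \<in> \<Phi>' \<Longrightarrow> Vector_Spaces.linear sc (*) l"
      "\<And>x. x \<in> S \<Longrightarrow> (\<And>l. l \<in> \<Phi>' \<Longrightarrow> l x = 0) \<Longrightarrow> \<exists>b\<in>B. h x = h b"
  shows "presents sc S (\<lambda>x. h ` B +>\<^bsub>M\<^esub> h x) (quot_module M (h ` B)) \<Phi>'"
proof -
  let ?h = "\<lambda>x. h ` B +>\<^bsub>M\<^esub> h x"
  have zero: "?h 0 = h ` B" using B by (subst coset_eq_image) (auto simp: mem_0)
  have BB: "\<And>x y. x \<in> B \<Longrightarrow> y \<in> B \<Longrightarrow> x + y \<in> B" and B0: "0 \<in> B"
    and Bs: "\<And>x c. x \<in> B \<Longrightarrow> sc c x \<in> B"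
    using B by (auto simp: subspace_add subspace_0 subspace_scale)
  have BS: "\<And>x. x \<in> B \<Longrightarrow> x \<in> S" using B by auto
  have sa: "set_add M (h ` V) (h ` Y) = h ` {x + y | x y. x \<in> V \<and> y \<in> Y}" if "V \<subseteq> S" "Y \<subseteq> S" for V Y
    unfolding set_add_def set_mult_def using that by (force simp: hom_add subset_eq)
  have add: "?h (x + y) = set_add M (?h x) (?h y)" if "x \<in> S" "y \<in> S" for x y
  proof -
    have "{x' + y' | x' y'. x' \<in> (\<lambda>b. b + x) ` B \<and> y' \<in> (\<lambda>b. b + y) ` B} = (\<lambda>b. b + (x + y)) ` B"
      (is "?L = ?R")
    proof (intro equalityI subsetI)
      fix z assume "z \<in> ?R"
      then obtain b where "b \<in> B" "z = (b + x) + (0 + y)" by (auto simp: algebra_simps)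
      then show "z \<in> ?L" using B0 by blast
    next
      fix z assume "z \<in> ?L"
      then obtain b b' where "b \<in> B" "b' \<in> B" "z = (b + b') + (x + y)" by (auto simp: algebra_simps)
      then show "z \<in> ?R" using BB by blast
    qed
    then show ?thesis using that BS B
      by (simp add: coset_eq_image mem_add) (subst sa, auto simp: mem_add)
  qed
  \<comment> \<open>Adding the image of \<open>B\<close> once more matters for c = 0, where the
    scaled coset shrinks to a single element.\<close>
  have scale: "?h (sc c x) = set_add M (h ` B) ((\<lambda>z. c \<odot>\<^bsub>M\<^esub> z) ` ?h x)" if "x \<in> S" for c x
  proof -
    have "(\<lambda>z. c \<odot>\<^bsub>M\<^esub> z) ` ?h x = h ` ((\<lambda>b. sc c (b + x)) ` B)"
      using that BS B by (simp add: coset_eq_image image_image)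
        (intro image_cong refl, auto simp: hom_scale mem_add)
    moreover have "{x' + y' | x' y'. x' \<in> B \<and> y' \<in> (\<lambda>b. sc c (b + x)) ` B} = (\<lambda>b. b + sc c x) ` B"
      (is "?L = ?R")
    proof (intro equalityI subsetI)
      fix z assume "z \<in> ?R"
      then obtain b where "b \<in> B" "z = b + sc c (0 + x)" by auto
      then show "z \<in> ?L" using B0 by blast
    next
      fix z assume "z \<in> ?L"
      then obtain b b' where "b \<in> B" "b' \<in> B" "z = (b + sc c b') + sc c x"
        by (auto simp: scale_right_distrib algebra_simps)
      then show "z \<in> ?R" using BB Bs by blast
    qed
    ultimately show ?thesis using that BS B
      by (simp add: coset_eq_image mem_scale) (subst sa, auto simp: mem_add mem_scale)
  qed
  have sep: "?h x = h ` B" if x: "x \<in> S" "\<And>l. l \<in> \<Phi>' \<Longrightarrow> l x = 0" for x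
  proof -
    have "\<exists>b\<in>B. h x = h b" using x by (rule \<Phi>'(2))
    then obtain b where "b \<in> B" "h x = h b" by blast
    then have "?h x = ?h 0" using coset_eqI[OF B x(1) mem_0, of b] by simp
    then show ?thesis using zero by simp
  qed
  have "?h ` S = a_rcosets\<^bsub>M\<^esub> (h ` B)"
    unfolding A_RCOSETS_def RCOSETS_def by (simp add: a_r_coset_def r_coset_def flip: image_S) blast
  then show ?thesis using add scale sep zero \<Phi>'(1) vector_space_axioms subspace_S
    unfolding presents_def quot_module_def by auto
qed

lemma presents_restrict:
  assumes "subspace S'" "S' \<subseteq> S"
  shows "presents sc S' h (M\<lparr>carrier := h ` S'\<rparr>) \<Phi>"
proof -
  have "x \<in> S" if "x \<in> S'" for x using assms(2) that by blast
  then show ?thesis using assms(1) unfolding presents_def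
    by (simp add: vector_space_axioms hom_0 hom_add hom_scale linear_functional separation)
qed

text \<open>Allows finer representatives: words with a coefficient in place of plain words, and in
  degree 0 in place of elements of A.\<close>

lemma presents_comp:
  assumes "vector_space sc'" "Vector_Spaces.linear sc' sc g" "module.subspace sc' S'" "g ` S' = S"
    and "\<And>l. l \<in> \<Phi>' \<Longrightarrow> Vector_Spaces.linear sc' (*) l"
      "\<And>x. x \<in> S' \<Longrightarrow> (\<And>l. l \<in> \<Phi>' \<Longrightarrow> l x = 0) \<Longrightarrow> h (g x) = \<zero>\<^bsub>M\<^esub>"
  shows "presents sc' S' (\<lambda>x. h (g x)) M \<Phi>'"
proof -
  have "(\<lambda>x. h (g x)) ` S' = carrier M" using image_S assms(4) by auto
  moreover have "g x \<in> S" if "x \<in> S'" for x using assms(4) that by auto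
  ultimately show ?thesis unfolding presents_def using assms
    by (auto simp: linear_facts[OF assms(2)] hom_0 hom_add hom_scale)
qed

lemma presents_copy:
  assumes "\<And>x. p (i x) = x"
  shows "presents sc S (\<lambda>x. i (h x)) (copy_module i p M) \<Phi>"
  unfolding presents_def copy_module_def using presents
  by (auto simp: assms presents_def simp flip: image_S)

end

lemma presentationI: "presents sc S h M \<Phi> \<Longrightarrow> presentation sc S h M \<Phi>"
  by (simp add: presentation_def vspace_def presentation_axioms_def presents_def)

lemma zero_if_functionals_vanish:
  assumes "vector_space sc" "\<And>l. Vector_Spaces.linear sc (*) l \<Longrightarrow> l x = 0"
  shows "x = 0"
proof -
  interpret vspace sc using assms by (simp add: vspace_def)
  show ?thesis using separating_functional[of "{0}" x] assms(2) by auto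
qed

lemma presents_type_module:
  assumes "vector_space sc"
  shows "presents sc UNIV (\<lambda>x. x) (type_module sc) {l. Vector_Spaces.linear sc (*) l}"
proof -
  interpret vspace sc using assms by (simp add: vspace_def)
  show ?thesis using zero_if_functionals_vanish[OF assms]
    by (auto simp: presents_def type_module_def vector_space_axioms)
qed

lemma presents_type_algebra:
  assumes "vector_space sc"
  shows "presents sc UNIV (\<lambda>x. x) (type_algebra sc) {l. Vector_Spaces.linear sc (*) l}"
proof -
  interpret vspace sc using assms by (simp add: vspace_def)
  show ?thesis using zero_if_functionals_vanish[OF assms]
    by (auto simp: presents_def type_algebra_def vector_space_axioms)
qed

lemma vector_space_if_k_module:
  assumes "k_module M" "carrier M = UNIV" "add M = (+)" "module.smult M = sc"
  shows "vector_space sc"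
proof -
  interpret module "ring_of_type_algebra" M using assms(1) by (simp add: k_module_def)
  show ?thesis
    by unfold_locales
      (use smult_l_distr smult_r_distr smult_assoc1 smult_one assms(2-) in
        \<open>auto simp: ring_of_type_algebra_def\<close>)
qed

section \<open>Tensor powers\<close>

text \<open>These are the linear forms on the tensor power, seen as functions on words of length
  \<open>n\<close>; their values on other words are unconstrained.\<close>

definition multilinear ::
  "('k::field \<Rightarrow> 'u::ab_group_add \<Rightarrow> 'u) \<Rightarrow> ('a \<Rightarrow> 'u \<Rightarrow> 'u) \<Rightarrow> ('a \<Rightarrow> 'u \<Rightarrow> 'u) \<Rightarrow> nat
     \<Rightarrow> ('u list \<Rightarrow> 'k) \<Rightarrow> bool" where
  "multilinear sc r l n \<phi> \<longleftrightarrow>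
     (\<forall>xs u v ys. length xs + 1 + length ys = n \<longrightarrow>
        \<phi> (xs @ (u + v) # ys) = \<phi> (xs @ u # ys) + \<phi> (xs @ v # ys)) \<and>
     (\<forall>xs c u ys. length xs + 1 + length ys = n \<longrightarrow> \<phi> (xs @ sc c u # ys) = c * \<phi> (xs @ u # ys)) \<and>
     (\<forall>xs a u v ys. length xs + 2 + length ys = n \<longrightarrow>
        \<phi> (xs @ r a u # v # ys) = \<phi> (xs @ u # l a v # ys))"

definition words :: "nat \<Rightarrow> ('u list \<Rightarrow>\<^sub>0 'k::field) set" where
  "words n = {F. Poly_Mapping.keys F \<subseteq> {us. length us = n}}"

text \<open>The canonical projection from combinations of words onto the tensor power, of which
  \<open>tens\<close> is the value at a single word.\<close>

definition tcoset ::
  "('k::field \<Rightarrow> 'u::ab_group_add \<Rightarrow> 'u) \<Rightarrow> ('a \<Rightarrow> 'u \<Rightarrow> 'u) \<Rightarrow> ('a \<Rightarrow> 'u \<Rightarrow> 'u) \<Rightarrow> nat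
     \<Rightarrow> ('u list \<Rightarrow>\<^sub>0 'k) \<Rightarrow> ('u list \<Rightarrow>\<^sub>0 'k) set" where
  "tcoset sc r l n F = free.span (tensor_rels sc r l n) +>\<^bsub>free_module {us. length us = n}\<^esub> F"

lemma tens_eq_tcoset: "tens sc r l us = tcoset sc r l (length us) (fsingle us)"
  by (simp add: tens_def tcoset_def)

lemma subspace_keys: "free.subspace {F :: 'g \<Rightarrow>\<^sub>0 'k::field. Poly_Mapping.keys F \<subseteq> W}"
proof (rule free.subspaceI)
  fix x y :: "'g \<Rightarrow>\<^sub>0 'k"
  assume "x \<in> {F. Poly_Mapping.keys F \<subseteq> W}" "y \<in> {F. Poly_Mapping.keys F \<subseteq> W}"
  then show "x + y \<in> {F. Poly_Mapping.keys F \<subseteq> W}" using Poly_Mapping.keys_add[of x y] by auto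
qed (auto simp: in_keys_iff lookup_fscale)

lemma subspace_words: "free.subspace (words n)"
  unfolding words_def by (rule subspace_keys)

lemma fsingle_words [simp]: "fsingle us \<in> words n \<longleftrightarrow> length us = n"
  by (simp add: words_def)

lemma tensor_rels_words: "tensor_rels sc r l n \<subseteq> words n"
proof -
  note m = free.subspace_diff[OF subspace_words] free.subspace_scale[OF subspace_words]
  show ?thesis unfolding tensor_rels_def by (auto intro!: m)
qed

lemma lext_eq_0_on_span_tensor_rels:
  fixes sc :: "'k::field \<Rightarrow> 'u::ab_group_add \<Rightarrow> 'u"
  assumes "multilinear sc r l n \<phi>" "F \<in> free.span (tensor_rels sc r l n)"
  shows "lext (*) \<phi> F = 0"
proof -
  interpret K: vspace "(*) :: 'k \<Rightarrow> _" by (simp add: vspace_def)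
  interpret vector_space_pair fscale "(*) :: 'k \<Rightarrow> _"
    by (intro vector_space_pair.intro) (simp_all add: free.vector_space_axioms)
  show ?thesis
  proof (rule linear_eq_0_on_span[OF K.linear_lext _ assms(2)])
    fix x assume "x \<in> tensor_rels sc r l n"
    then show "lext (*) \<phi> x = 0"
      using assms(1) unfolding tensor_rels_def multilinear_def
      by (auto simp: K.lext_linear_facts)
  qed
qed

text \<open>If F were outside the span, a functional vanishing on the span but not at F would exist.
  Restricted to single words it is multilinear, since each family of relations is one clause of
  \<open>multilinear\<close>, and this contradicts the hypothesis.\<close>

lemma mem_span_tensor_relsI:
  fixes sc :: "'k::field \<Rightarrow> 'u::ab_group_add \<Rightarrow> 'u"
  assumes "F \<in> words n" "\<And>\<phi>. multilinear sc r l n \<phi> \<Longrightarrow> lext (*) \<phi> F = 0"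
  shows "F \<in> free.span (tensor_rels sc r l n)"
proof (rule ccontr)
  interpret K: vspace "(*) :: 'k \<Rightarrow> _" by (simp add: vspace_def)
  assume "F \<notin> free.span (tensor_rels sc r l n)"
  then obtain f where f: "Vector_Spaces.linear fscale (*) f"
    "\<And>x. x \<in> free.span (tensor_rels sc r l n) \<Longrightarrow> f x = 0" "f F \<noteq> 0"
    using vspace.separating_functional[OF vspace_fscale free.subspace_span] by metis
  have 0: "f x = 0" if "x \<in> tensor_rels sc r l n" for x
    using f(2) free.span_base that by metis
  have "multilinear sc r l n (\<lambda>us. f (fsingle us))"
    unfolding multilinear_def
  proof (intro conjI allI impI)
    fix xs ys :: "'u list" and u v
    assume "length xs + 1 + length ys = n"
    then have "f (fsingle (xs @ [u + v] @ ys) - fsingle (xs @ [u] @ ys) - fsingle (xs @ [v] @ ys)) = 0"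
      by (intro 0) (unfold tensor_rels_def, blast)
    then show "f (fsingle (xs @ (u + v) # ys)) = f (fsingle (xs @ u # ys)) + f (fsingle (xs @ v # ys))"
      by (simp add: linear_facts[OF f(1)] algebra_simps)
  next
    fix xs ys :: "'u list" and c u
    assume "length xs + 1 + length ys = n"
    then have "f (fsingle (xs @ [sc c u] @ ys) - fscale c (fsingle (xs @ [u] @ ys))) = 0"
      by (intro 0) (unfold tensor_rels_def, blast)
    then show "f (fsingle (xs @ sc c u # ys)) = c * f (fsingle (xs @ u # ys))"
      by (simp add: linear_facts[OF f(1)])
  next
    fix xs ys :: "'u list" and a u v
    assume "length xs + 2 + length ys = n"
    then have "f (fsingle (xs @ [r a u, v] @ ys) - fsingle (xs @ [u, l a v] @ ys)) = 0"
      by (intro 0) (unfold tensor_rels_def, blast)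
    then show "f (fsingle (xs @ r a u # v # ys)) = f (fsingle (xs @ u # l a v # ys))"
      by (simp add: linear_facts[OF f(1)])
  qed
  then have "lext (*) (\<lambda>us. f (fsingle us)) F = 0" by (rule assms(2))
  moreover have "f F = lext (*) (\<lambda>us. f (fsingle us)) F"
    using vspace.linear_lext_comp[OF vspace_fscale f(1), of fsingle F] by (simp add: lext_fsingle_self)
  ultimately show False using f(3) by simp
qed

lemma presents_free_module:
  "presents fscale {F. Poly_Mapping.keys F \<subseteq> W} (\<lambda>x. x) (free_module W :: ('k::field, 'g \<Rightarrow>\<^sub>0 'k) module)
     {l. Vector_Spaces.linear fscale (*) l}"
proof -
  interpret presentation fscale UNIV "\<lambda>x. x" "type_module fscale :: ('k, 'g \<Rightarrow>\<^sub>0 'k) module"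
    "{l. Vector_Spaces.linear fscale (*) l}"
    by (rule presentationI[OF presents_type_module[OF free.vector_space_axioms]])
  show ?thesis using presents_restrict[OF subspace_keys[of W]] by (simp add: free_module_def)
qed

lemma free_module_presentation:
  "presentation fscale (words n) (\<lambda>x. x) (free_module {us. length us = n}) {l. Vector_Spaces.linear fscale (*) l}"
  unfolding words_def by (intro presentationI presents_free_module)

lemma presents_tensor_power:
  fixes sc :: "'k::field \<Rightarrow> 'u::ab_group_add \<Rightarrow> 'u"
  shows "presents fscale (words n) (tcoset sc r l n) (tensor_power sc r l n) {lext (*) \<phi> | \<phi>. multilinear sc r l n \<phi>}"
proof -
  interpret K: vspace "(*) :: 'k \<Rightarrow> _" by (simp add: vspace_def)
  interpret presentation fscale "words n" "\<lambda>x. x" "free_module {us. length us = n}"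
     "{l. Vector_Spaces.linear fscale (*) l}" by (rule free_module_presentation)
  have "free.span (tensor_rels sc r l n) \<subseteq> words n"
    by (rule free.span_minimal[OF tensor_rels_words subspace_words])
  then have "presents fscale (words n)
     (\<lambda>x. (\<lambda>x. x) ` free.span (tensor_rels sc r l n) +>\<^bsub>free_module {us. length us = n}\<^esub> x)
     (quot_module (free_module {us. length us = n}) ((\<lambda>x. x) ` free.span (tensor_rels sc r l n)))
     {lext (*) \<phi> | \<phi>. multilinear sc r l n \<phi>}"
  proof (intro presents_quot[OF free.subspace_span])
    fix x assume "x \<in> words n" "\<And>m. m \<in> {lext (*) \<phi> | \<phi>. multilinear sc r l n \<phi>} \<Longrightarrow> m x = 0"
    then have "x \<in> free.span (tensor_rels sc r l n)" by (intro mem_span_tensor_relsI) auto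
    then show "\<exists>b\<in>free.span (tensor_rels sc r l n). x = b" by blast
  qed (auto simp: K.linear_lext)
  then show ?thesis by (simp add: tcoset_def[abs_def] tensor_power_def)
qed

text \<open>\<open>presents\<close> only asks that functionals detect zero. The converse, that
  multilinear forms vanish on the zero tensor, is what turns given equations between tensors, such
  as coassociativity, into scalar equations.\<close>

lemma tcoset_zero_iff:
  fixes sc :: "'k::field \<Rightarrow> 'u::ab_group_add \<Rightarrow> 'u"
  assumes "F \<in> words n"
  shows "tcoset sc r l n F = \<zero>\<^bsub>tensor_power sc r l n\<^esub> \<longleftrightarrow>
    (\<forall>\<phi>. multilinear sc r l n \<phi> \<longrightarrow> lext (*) \<phi> F = 0)"
proof
  interpret P: presentation fscale "words n" "\<lambda>x. x" "free_module {us. length us = n}"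
     "{l. Vector_Spaces.linear fscale (*) l}" by (rule free_module_presentation)
  interpret T: presentation fscale "words n" "tcoset sc r l n" "tensor_power sc r l n"
    "{lext (*) \<phi> | \<phi>. multilinear sc r l n \<phi>}" by (intro presentationI presents_tensor_power)
  have sub: "free.span (tensor_rels sc r l n) \<subseteq> words n"
    by (rule free.span_minimal[OF tensor_rels_words subspace_words])
  show "tcoset sc r l n F = \<zero>\<^bsub>tensor_power sc r l n\<^esub>"
    if "\<forall>\<phi>. multilinear sc r l n \<phi> \<longrightarrow> lext (*) \<phi> F = 0"
    using that assms by (intro T.separation) auto
  assume "tcoset sc r l n F = \<zero>\<^bsub>tensor_power sc r l n\<^esub>"
  then have "F \<in> free.span (tensor_rels sc r l n)"
    using P.mem_coset_iff[OF sub assms, of F] free.span_zero[of "tensor_rels sc r l n"]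
    by (force simp: tcoset_def tensor_power_def quot_module_def)
  then show "\<forall>\<phi>. multilinear sc r l n \<phi> \<longrightarrow> lext (*) \<phi> F = 0"
    by (auto intro: lext_eq_0_on_span_tensor_rels)
qed

lemma tcoset_eq_iff:
  fixes sc :: "'k::field \<Rightarrow> 'u::ab_group_add \<Rightarrow> 'u"
  assumes "F \<in> words n" "G \<in> words n"
  shows "tcoset sc r l n F = tcoset sc r l n G \<longleftrightarrow>
    (\<forall>\<phi>. multilinear sc r l n \<phi> \<longrightarrow> lext (*) \<phi> F = lext (*) \<phi> G)"
proof -
  interpret K: vspace "(*) :: 'k \<Rightarrow> _" by (simp add: vspace_def)
  interpret T: presentation fscale "words n" "tcoset sc r l n" "tensor_power sc r l n"
    "{lext (*) \<phi> | \<phi>. multilinear sc r l n \<phi>}" by (intro presentationI presents_tensor_power)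
  show ?thesis
    using T.hom_diff_eq_zero_iff[OF assms] tcoset_zero_iff[of "F - G" n sc r l] T.mem_diff[OF assms]
    by (simp add: K.lext_linear_facts)
qed

context presentation
begin

text \<open>Two representatives differ by an element b of the span of the relations. The functionals
  of the target composed with \<open>g\<close> are multilinear, hence kill b, so all representatives
  yield the same value.\<close>

lemma tensor_lift_tcoset:
  assumes F: "F \<in> words n" and f: "\<And>us. length us = n \<Longrightarrow> f us = h (g us)"
    and g: "\<And>us. length us = n \<Longrightarrow> g us \<in> S"
    and ml: "\<And>\<phi>. \<phi> \<in> \<Phi> \<Longrightarrow> multilinear sc' r l n (\<lambda>us. \<phi> (g us))"
  shows "tensor_lift M f (tcoset sc' r l n F) = h (lext sc g F)"
proof -
  interpret P: presentation fscale "words n" "\<lambda>x. x" "free_module {us. length us = n}"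
     "{l. Vector_Spaces.linear fscale (*) l}" by (rule free_module_presentation)
  have sub: "free.span (tensor_rels sc' r l n) \<subseteq> words n"
    by (rule free.span_minimal[OF tensor_rels_words subspace_words])
  have *: "(\<Oplus>\<^bsub>M\<^esub>us\<in>Poly_Mapping.keys G. Poly_Mapping.lookup G us \<odot>\<^bsub>M\<^esub> f us) = h (lext sc g F)"
    if G: "G \<in> tcoset sc' r l n F" for G
  proof -
    obtain b where b: "b \<in> free.span (tensor_rels sc' r l n)" "G = b + F"
      using P.mem_coset_iff[OF sub F, of G] G by (auto simp: tcoset_def)
    then have Gw: "G \<in> words n" using sub F P.mem_add by auto
    interpret abelian_group M by (rule abelian_group)
    have "(\<Oplus>\<^bsub>M\<^esub>us\<in>Poly_Mapping.keys G. Poly_Mapping.lookup G us \<odot>\<^bsub>M\<^esub> f us) =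
      (\<Oplus>\<^bsub>M\<^esub>us\<in>Poly_Mapping.keys G. Poly_Mapping.lookup G us \<odot>\<^bsub>M\<^esub> h (g us))"
      using Gw by (intro finsum_cong') (auto simp: words_def f g hom_closed mem_scale subset_eq simp flip: hom_scale)
    also have "\<dots> = h (lext sc g G)" using Gw by (intro hom_lext g) (auto simp: words_def)
    also have "\<dots> = h (lext sc g F)"
    proof (rule hom_eqI)
      show "lext sc g G \<in> S" "lext sc g F \<in> S"
        using Gw F by (auto simp: words_def intro!: lext_mem subspace_S g)
      fix \<phi> assume \<phi>: "\<phi> \<in> \<Phi>"
      interpret K: vspace "(*) :: 'k \<Rightarrow> _" by (simp add: vspace_def)
      show "\<phi> (lext sc g G) = \<phi> (lext sc g F)"
        using lext_eq_0_on_span_tensor_rels[OF ml[OF \<phi>] b(1)]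
        by (simp add: b(2) linear_lext_comp[OF linear_functional[OF \<phi>]] K.lext_linear_facts)
    qed
    finally show ?thesis .
  qed
  \<comment> \<open>The coset is nonempty, so the set of values is a singleton and
    \<open>the_elem\<close> returns its element.\<close>
  have "F \<in> tcoset sc' r l n F"
    using P.mem_coset_iff[OF sub F, of F] free.span_zero[of "tensor_rels sc' r l n"] by (force simp: tcoset_def)
  then have "(\<lambda>G. \<Oplus>\<^bsub>M\<^esub>us\<in>Poly_Mapping.keys G. Poly_Mapping.lookup G us \<odot>\<^bsub>M\<^esub> f us) ` tcoset sc' r l n F =
    {h (lext sc g F)}" using * by (auto intro: rev_image_eqI)
  then show ?thesis by (simp add: tensor_lift_def)
qed

end

section \<open>The shuffle product on words\<close>

text \<open>Signs that need no scalars, so that \<open>shE\<close> and \<open>dE\<close> can take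
  values in any abelian group: in the field as well as in formal combinations.\<close>

definition alt :: "nat \<Rightarrow> 'm::ab_group_add \<Rightarrow> 'm" where
  "alt n x = (if even n then x else - x)"

lemma alt_simps [simp]:
  "alt 0 x = x" "alt (Suc n) x = - alt n x" "alt n 0 = 0" "alt n (- x) = - alt n x"
  "alt n (alt n x) = x" "alt n (x + y) = alt n x + alt n y" "alt n (x - y) = alt n x - alt n y"
  by (auto simp: alt_def)

lemma alt_add_exp: "alt (m + n) x = alt m (alt n x)"
  by (auto simp: alt_def)

lemma alt_left_commute: "alt m (alt n x) = alt n (alt m x)"
  by (auto simp: alt_def)

lemma additive_facts:
  fixes h :: "'m::ab_group_add \<Rightarrow> 'n::ab_group_add"
  assumes "\<And>x y. h (x + y) = h x + h y"
  shows "h 0 = 0" "h (- x) = - h x" "h (x - y) = h x - h y" "h (alt n x) = alt n (h x)"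
proof -
  show 0: "h 0 = 0" using assms[of 0 0] by simp
  show m: "h (- x) = - h x" for x using assms[of x "- x"] 0 by (simp add: eq_neg_iff_add_eq_0 add.commute)
  show "h (x - y) = h x - h y" using assms[of x "- y"] m by simp
  show "h (alt n x) = alt n (h x)" using m by (simp add: alt_def)
qed

text \<open>
  A combination of words is given by its value \<open>\<Sum> c\<^sub>w \<phi>(w)\<close> at an arbitrary function \<open>\<phi>\<close>.
\<close>

fun shE :: "'u list \<Rightarrow> 'u list \<Rightarrow> ('u list \<Rightarrow> 'm::ab_group_add) \<Rightarrow> 'm" where
  "shE [] vs \<phi> = \<phi> vs"
| "shE (u # us) [] \<phi> = \<phi> (u # us)"
| "shE (u # us) (v # vs) \<phi> =
     shE us (v # vs) (\<lambda>w. \<phi> (u # w)) + alt (Suc (length us)) (shE (u # us) vs (\<lambda>w. \<phi> (v # w)))"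

lemma shE_Nil2 [simp]: "shE us [] \<phi> = \<phi> us"
  by (cases us) auto

lemma shE_hom:
  assumes "\<And>x y. h (x + y) = h x + h y"
  shows "h (shE us vs \<phi>) = shE us vs (\<lambda>w. h (\<phi> w))"
  by (induction us vs \<phi> rule: shE.induct) (simp_all add: assms additive_facts[of h, OF assms])

lemma shE_add: "shE us vs (\<lambda>w. \<phi> w + \<phi>' w) = shE us vs \<phi> + shE us vs \<phi>'"
  by (induction us vs \<phi> arbitrary: \<phi>' rule: shE.induct) simp_all

lemma shE_uminus: "shE us vs (\<lambda>w. - \<phi> w) = - shE us vs \<phi>"
  by (induction us vs \<phi> rule: shE.induct) (simp_all add: algebra_simps)

lemma shE_diff: "shE us vs (\<lambda>w. \<phi> w - \<phi>' w) = shE us vs \<phi> - shE us vs \<phi>'"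
  using shE_add[of us vs \<phi> "\<lambda>w. - \<phi>' w"] by (simp add: shE_uminus)

lemma shE_0 [simp]: "shE us vs (\<lambda>w. 0) = 0"
  using shE_diff[of us vs "\<lambda>w. 0" "\<lambda>w. 0"] by simp

lemma shE_alt: "shE us vs (\<lambda>w. alt n (\<phi> w)) = alt n (shE us vs \<phi>)"
  by (simp add: alt_def shE_uminus)

text \<open>Shuffling only rearranges letters, so the test function is evaluated at words of the
  total length only.\<close>

lemma shE_cong:
  "(\<And>w. length w = length us + length vs \<Longrightarrow> \<phi> w = \<phi>' w) \<Longrightarrow> shE us vs \<phi> = shE us vs \<phi>'"
proof (induction us vs \<phi> arbitrary: \<phi>' rule: shE.induct)
  case (3 u us v vs \<phi>)
  have "shE us (v # vs) (\<lambda>w. \<phi> (u # w)) = shE us (v # vs) (\<lambda>w. \<phi>' (u # w))"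
    "shE (u # us) vs (\<lambda>w. \<phi> (v # w)) = shE (u # us) vs (\<lambda>w. \<phi>' (v # w))"
    using 3 by auto
  then show ?case by simp
qed auto

lemma shE_alt_length:
  "shE us vs (\<lambda>w. alt (length w) (\<phi> w)) = alt (length us + length vs) (shE us vs \<phi>)"
proof -
  have "shE us vs (\<lambda>w. alt (length w) (\<phi> w)) = shE us vs (\<lambda>w. alt (length us + length vs) (\<phi> w))"
    by (rule shE_cong) simp
  then show ?thesis by (simp add: shE_alt)
qed

text \<open>Both sides split according to which of the three words supplies the first letter. The
  sign is 1 for \<open>us\<close>, that of \<open>length us\<close> for \<open>vs\<close> and that
  of \<open>length us + length vs\<close> for \<open>ws\<close>; the remaining words are covered by
  induction on the total length.\<close>

lemma shE_assoc: "shE us vs (\<lambda>w. shE w ws \<phi>) = shE vs ws (\<lambda>w. shE us w \<phi>)"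
proof (induction "length us + length vs + length ws" arbitrary: us vs ws \<phi> rule: less_induct)
  case less
  show ?case
  proof (cases "us = [] \<or> vs = [] \<or> ws = []")
    case True
    then show ?thesis by auto
  next
    case False
    then obtain u us' v vs' x ws' where eq: "us = u # us'" "vs = v # vs'" "ws = x # ws'"
      by (meson neq_Nil_conv)
    have 1: "shE us' vs (\<lambda>w. shE w ws (\<lambda>z. \<phi> (u # z))) = shE vs ws (\<lambda>w. shE us' w (\<lambda>z. \<phi> (u # z)))"
      and 2: "shE us vs' (\<lambda>w. shE w ws (\<lambda>z. \<phi> (v # z))) = shE vs' ws (\<lambda>w. shE us w (\<lambda>z. \<phi> (v # z)))"
      and 3: "shE us vs (\<lambda>w. shE w ws' (\<lambda>z. \<phi> (x # z))) = shE vs ws' (\<lambda>w. shE us w (\<lambda>z. \<phi> (x # z)))"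
      by (rule less, simp add: eq)+
    have "shE us vs (\<lambda>w. shE w ws \<phi>) =
        shE us' vs (\<lambda>w. shE w ws (\<lambda>z. \<phi> (u # z))) +
        alt (length us) (shE us vs' (\<lambda>w. shE w ws (\<lambda>z. \<phi> (v # z)))) +
        alt (length us + length vs) (shE us vs (\<lambda>w. shE w ws' (\<lambda>z. \<phi> (x # z))))"
      by (simp add: eq shE_add shE_diff shE_uminus shE_alt_length alt_add_exp alt_left_commute algebra_simps)
    also have "\<dots> = shE vs ws (\<lambda>w. shE us w \<phi>)"
      unfolding 1 2 3
      by (simp add: eq shE_add shE_diff shE_uminus shE_alt alt_add_exp alt_left_commute algebra_simps)
    finally show ?thesis .
  qed
qed

text \<open>The letter occurs exactly once in every shuffle, so a law in one letter is inherited.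
  With three test functions a single statement covers additivity, homogeneity and the passage of a
  ring element into the coefficient; in the latter two the second summand is zero.\<close>

lemma shE_combine_left:
  assumes "\<And>xs ys. \<phi> (xs @ x # ys) = \<phi>' (xs @ y # ys) + \<phi>'' (xs @ z # ys)"
  shows "shE (xs @ x # ys) vs \<phi> = shE (xs @ y # ys) vs \<phi>' + shE (xs @ z # ys) vs \<phi>''"
  using assms
proof (induction "length xs + length vs" arbitrary: xs vs \<phi> \<phi>' \<phi>'' rule: less_induct)
  case less
  note cons = less.prems[of "_ # _", simplified]
  show ?case
  proof (cases vs)
    case Nil
    then show ?thesis using less.prems by simp
  next
    case (Cons v vs')
    have 1: "shE (xs @ x # ys) vs' (\<lambda>w. \<phi> (v # w)) =
        shE (xs @ y # ys) vs' (\<lambda>w. \<phi>' (v # w)) + shE (xs @ z # ys) vs' (\<lambda>w. \<phi>'' (v # w))"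
      using Cons cons by (intro less.hyps) auto
    show ?thesis
    proof (cases xs)
      case Nil
      have "shE ys (v # vs') (\<lambda>w. \<phi> (x # w)) =
          shE ys (v # vs') (\<lambda>w. \<phi>' (y # w)) + shE ys (v # vs') (\<lambda>w. \<phi>'' (z # w))"
        using less.prems[of "[]"] by (simp add: shE_add)
      then show ?thesis using 1 by (simp add: Nil Cons)
    next
      case (Cons a xs')
      have "shE (xs' @ x # ys) vs (\<lambda>w. \<phi> (a # w)) =
          shE (xs' @ y # ys) vs (\<lambda>w. \<phi>' (a # w)) + shE (xs' @ z # ys) vs (\<lambda>w. \<phi>'' (a # w))"
        using Cons cons by (intro less.hyps) auto
      then show ?thesis using 1 by (simp add: \<open>vs = v # vs'\<close> Cons)
    qed
  qed
qed

lemma shE_combine_right: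
  assumes "\<And>xs ys. \<phi> (xs @ x # ys) = \<phi>' (xs @ y # ys) + \<phi>'' (xs @ z # ys)"
  shows "shE us (xs @ x # ys) \<phi> = shE us (xs @ y # ys) \<phi>' + shE us (xs @ z # ys) \<phi>''"
  using assms
proof (induction "length us + length xs" arbitrary: us xs \<phi> \<phi>' \<phi>'' rule: less_induct)
  case less
  note cons = less.prems[of "_ # _", simplified]
  show ?case
  proof (cases us)
    case Nil
    then show ?thesis using less.prems by simp
  next
    case (Cons u us')
    have 1: "shE us' (xs @ x # ys) (\<lambda>w. \<phi> (u # w)) =
        shE us' (xs @ y # ys) (\<lambda>w. \<phi>' (u # w)) + shE us' (xs @ z # ys) (\<lambda>w. \<phi>'' (u # w))"
      using Cons cons by (intro less.hyps) auto
    show ?thesis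
    proof (cases xs)
      case Nil
      have "shE us ys (\<lambda>w. \<phi> (x # w)) = shE us ys (\<lambda>w. \<phi>' (y # w)) + shE us ys (\<lambda>w. \<phi>'' (z # w))"
        using less.prems[of "[]"] by (simp add: shE_add)
      then show ?thesis using 1 by (simp add: Nil Cons)
    next
      case (Cons a xs')
      have "shE us (xs' @ x # ys) (\<lambda>w. \<phi> (a # w)) =
          shE us (xs' @ y # ys) (\<lambda>w. \<phi>' (a # w)) + shE us (xs' @ z # ys) (\<lambda>w. \<phi>'' (a # w))"
        using Cons cons by (intro less.hyps) auto
      then show ?thesis using 1 by (simp add: \<open>us = u # us'\<close> Cons)
    qed
  qed
qed

section \<open>The bar differential on words\<close>

text \<open>
  \<open>U\<close> is an algebra over \<open>A\<close> via \<open>t\<close> with two augmentations \<open>e1, e2\<close>; the complex is the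
  two-sided bar complex of \<open>U\<close> with coefficients \<open>A\<close>. Augmentations need not be unital here:
  the axioms of a Hopf algebroid do not force \<open>\<epsilon> 1 = 1\<close>.
\<close>

locale bar =
  fixes scA :: "'k::field \<Rightarrow> 'a::{ring,monoid_mult} \<Rightarrow> 'a"
    and scU :: "'k \<Rightarrow> 'u::{ring,monoid_mult} \<Rightarrow> 'u"
    and t :: "'a \<Rightarrow> 'u" and e1 e2 :: "'u \<Rightarrow> 'a"
  assumes vsA: "vector_space scA" and vsU: "vector_space scU"
    and scA_mult: "\<And>c a b. scA c a * b = scA c (a * b)"
    and scU_mult: "\<And>c u v. scU c u * v = scU c (u * v)"
    and comm_A: "\<And>a b :: 'a. a * b = b * a" and comm_U: "\<And>u v :: 'u. u * v = v * u"
    and t_linear: "Vector_Spaces.linear scA scU t" and t_1: "t 1 = 1"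
    and t_mult: "\<And>a b. t (a * b) = t a * t b"
    and e1_linear: "Vector_Spaces.linear scU scA e1" and e2_linear: "Vector_Spaces.linear scU scA e2"
    and e1_mult: "\<And>u v. e1 (u * v) = e1 u * e1 v" and e2_mult: "\<And>u v. e2 (u * v) = e2 u * e2 v"
    and e1_t: "\<And>a u. e1 (t a * u) = a * e1 u" and e2_t: "\<And>a u. e2 (t a * u) = a * e2 u"
begin

lemma left_comm_A: "a * (b * c) = b * (a * c)" for a b c :: 'a
  by (metis comm_A mult.assoc)

lemma left_comm_U: "u * (v * w) = v * (u * w)" for u v w :: 'u
  by (metis comm_U mult.assoc)

lemma scA_mult_right: "a * scA c b = scA c (a * b)"
  by (metis comm_A scA_mult)

lemma scU_mult_right: "u * scU c v = scU c (u * v)"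
  by (metis comm_U scU_mult)

text \<open>The face to the right of the letter \<open>u\<close>: it multiplies \<open>u\<close>
  with its right neighbour, or applies the second augmentation if \<open>u\<close> is the last
  letter. With the end of the word treated like a neighbour, all faces but the first follow one
  recursion.\<close>

fun ME :: "'u \<Rightarrow> 'u list \<Rightarrow> ('a \<Rightarrow> 'u list \<Rightarrow> 'm::ab_group_add) \<Rightarrow> 'm" where
  "ME u [] \<phi> = \<phi> (e2 u) []"
| "ME u (v # w) \<phi> = \<phi> 1 (u * v # w)"

primrec JE :: "'u list \<Rightarrow> ('a \<Rightarrow> 'u list \<Rightarrow> 'm::ab_group_add) \<Rightarrow> 'm" where
  "JE [] \<phi> = 0"
| "JE (u # w) \<phi> = ME u w \<phi> - JE w (\<lambda>b ws. \<phi> b (u # ws))"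

fun LE :: "'u list \<Rightarrow> ('a \<Rightarrow> 'u list \<Rightarrow> 'm::ab_group_add) \<Rightarrow> 'm" where
  "LE [] \<phi> = 0"
| "LE (u # w) \<phi> = \<phi> (e1 u) w"

text \<open>\<open>LE\<close> is the first face and \<open>JE\<close> the alternating sum of the others, with signs \<open>+, -, \<dots>\<close>\<close>

definition dE :: "'a \<Rightarrow> 'u list \<Rightarrow> ('a \<Rightarrow> 'u list \<Rightarrow> 'm::ab_group_add) \<Rightarrow> 'm" where
  "dE a us \<phi> = LE us (\<lambda>b. \<phi> (a * b)) - JE us (\<lambda>b. \<phi> (a * b))"

lemma ME_add: "ME u us (\<lambda>b ws. \<phi> b ws + \<phi>' b ws) = ME u us \<phi> + ME u us \<phi>'"
  by (cases us) simp_all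

lemma LE_add: "LE us (\<lambda>b ws. \<phi> b ws + \<phi>' b ws) = LE us \<phi> + LE us \<phi>'"
  by (cases us) simp_all

lemma JE_add: "JE us (\<lambda>b ws. \<phi> b ws + \<phi>' b ws) = JE us \<phi> + JE us \<phi>'"
  by (induction us arbitrary: \<phi> \<phi>') (simp_all add: ME_add)

lemma dE_add: "dE a us (\<lambda>b ws. \<phi> b ws + \<phi>' b ws) = dE a us \<phi> + dE a us \<phi>'"
  by (simp add: dE_def LE_add JE_add)

lemma hom_dE:
  assumes "\<And>x y. h (x + y) = h x + h y"
  shows "h (ME u us \<phi>) = ME u us (\<lambda>b ws. h (\<phi> b ws))"
    "h (LE us \<phi>) = LE us (\<lambda>b ws. h (\<phi> b ws))"
    "h (JE us \<phi>) = JE us (\<lambda>b ws. h (\<phi> b ws))"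
    "h (dE a us \<phi>) = dE a us (\<lambda>b ws. h (\<phi> b ws))"
proof -
  show M: "h (ME u us \<phi>) = ME u us (\<lambda>b ws. h (\<phi> b ws))" for u us \<phi> by (cases us) simp_all
  show L: "h (LE us \<phi>) = LE us (\<lambda>b ws. h (\<phi> b ws))" for us \<phi>
    by (cases us) (simp_all add: additive_facts[of h, OF assms])
  show J: "h (JE us \<phi>) = JE us (\<lambda>b ws. h (\<phi> b ws))" for us \<phi>
    by (induction us arbitrary: \<phi>) (simp_all add: additive_facts[of h, OF assms] M)
  show "h (dE a us \<phi>) = dE a us (\<lambda>b ws. h (\<phi> b ws))"
    by (simp add: dE_def additive_facts[of h, OF assms] L J)
qed

lemma ME_cong:
  "(\<And>b ws. length ws = length us \<Longrightarrow> \<phi> b ws = \<phi>' b ws) \<Longrightarrow> ME u us \<phi> = ME u us \<phi>'"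
  by (cases us) simp_all

lemma JE_cong:
  "(\<And>b ws. length us = Suc (length ws) \<Longrightarrow> \<phi> b ws = \<phi>' b ws) \<Longrightarrow> JE us \<phi> = JE us \<phi>'"
proof (induction us arbitrary: \<phi> \<phi>')
  case (Cons u us)
  have "ME u us \<phi> = ME u us \<phi>'" using Cons.prems by (intro ME_cong) auto
  moreover have "JE us (\<lambda>b ws. \<phi> b (u # ws)) = JE us (\<lambda>b ws. \<phi>' b (u # ws))"
    using Cons.prems by (intro Cons.IH) auto
  ultimately show ?case by simp
qed simp

lemma dE_cong:
  "(\<And>b ws. length us = Suc (length ws) \<Longrightarrow> \<phi> b ws = \<phi>' b ws) \<Longrightarrow> dE a us \<phi> = dE a us \<phi>'"
  unfolding dE_def by (intro arg_cong2[of _ _ _ _ "(-)"] JE_cong) (cases us; simp)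

lemma JE_uminus: "JE us (\<lambda>b ws. - \<phi> b ws) = - JE us \<phi>"
  by (rule hom_dE(3)[of uminus, OF minus_add_distrib, symmetric])

lemma LE_uminus: "LE us (\<lambda>b ws. - \<phi> b ws) = - LE us \<phi>"
  by (rule hom_dE(2)[of uminus, OF minus_add_distrib, symmetric])

lemma JE_diff: "JE us (\<lambda>b ws. \<phi> b ws - \<phi>' b ws) = JE us \<phi> - JE us \<phi>'"
  using JE_add[of us \<phi> "\<lambda>b ws. - \<phi>' b ws"] by (simp add: JE_uminus)

lemma LE_diff: "LE us (\<lambda>b ws. \<phi> b ws - \<phi>' b ws) = LE us \<phi> - LE us \<phi>'"
  using LE_add[of us \<phi> "\<lambda>b ws. - \<phi>' b ws"] by (simp add: LE_uminus)

lemma JE_alt: "JE us (\<lambda>b ws. alt n (\<phi> b ws)) = alt n (JE us \<phi>)"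
  by (rule hom_dE(3)[of "alt n", OF alt_simps(6), symmetric])

lemma JE_0 [simp]: "JE us (\<lambda>b ws. 0) = 0"
  using JE_diff[of us "\<lambda>b ws. 0" "\<lambda>b ws. 0"] by simp

text \<open>If both faces avoid the first letter \<open>u\<close>, the terms vanish by induction.
  The terms with one face at \<open>u\<close> and the other one further on cancel because the two
  faces can be taken in either order.\<close>

lemma JE_JE: "JE us (\<lambda>b ws. JE ws (\<lambda>c. \<phi> (b * c))) = 0"
proof (induction us arbitrary: \<phi>)
  case (Cons u us)
  have "ME u us (\<lambda>b ws. JE ws (\<lambda>c. \<phi> (b * c))) =
      JE us (\<lambda>b ws. ME u ws (\<lambda>c. \<phi> (b * c)))"
    (is "?l us = ?r us")
  proof (cases us)
    case (Cons v w)
    \<comment> \<open>The two faces meet at the letter \<open>v\<close>: the equation is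
      associativity of the product, or multiplicativity of \<open>e2\<close> if \<open>v\<close> is
      the last letter.\<close>
    have "ME (u * v) w \<phi> = ME v w (\<lambda>b ws. ME u ws (\<lambda>c. \<phi> (b * c)))"
      by (cases w) (simp_all add: e2_mult comm_A mult.assoc)
    then show ?thesis by (simp add: Cons)
  qed simp
  then show ?case using Cons.IH[of "\<lambda>b ws. \<phi> b (u # ws)"] by (simp add: JE_diff)
qed simp

text \<open>Removing the first two letters one after the other agrees with merging and then removing
  them, as \<open>e1\<close> is multiplicative. All other faces commute with the first one and occur
  on the right with opposite signs.\<close>

lemma LE_LE_JE:
  "LE us (\<lambda>b ws. LE ws (\<lambda>c. \<phi> (b * c))) =
    LE us (\<lambda>b ws. JE ws (\<lambda>c. \<phi> (b * c))) + JE us (\<lambda>b ws. LE ws (\<lambda>c. \<phi> (b * c)))"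
proof (cases us)
  case (Cons u w)
  have "LE w (\<lambda>c. \<phi> (e1 u * c)) = ME u w (\<lambda>b ws. LE ws (\<lambda>c. \<phi> (b * c)))"
    by (cases w) (simp_all add: e1_mult)
  then show ?thesis by (simp add: Cons comm_A)
qed simp

lemma dE_dE: "dE a us (\<lambda>b ws. dE b ws \<phi>) = 0"
proof -
  have "dE a us (\<lambda>b ws. dE b ws \<phi>) =
    LE us (\<lambda>b ws. LE ws (\<lambda>c. \<phi> (a * (b * c)))) - LE us (\<lambda>b ws. JE ws (\<lambda>c. \<phi> (a * (b * c))))
    - (JE us (\<lambda>b ws. LE ws (\<lambda>c. \<phi> (a * (b * c)))) - JE us (\<lambda>b ws. JE ws (\<lambda>c. \<phi> (a * (b * c)))))"
    by (simp add: dE_def LE_diff JE_diff mult.assoc)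
  then show ?thesis using LE_LE_JE[of us "\<lambda>b. \<phi> (a * b)"] JE_JE[of us "\<lambda>b. \<phi> (a * b)"] by simp
qed

text \<open>The first letter of a shuffle is the first letter of one of the two words.\<close>

lemma LE_shE:
  "shE us vs (\<lambda>w. LE w \<phi>) =
    LE us (\<lambda>b ws. shE ws vs (\<phi> b)) + alt (length us) (LE vs (\<lambda>b ws. shE us ws (\<phi> b)))"
  by (cases "(us, vs, \<lambda>w. LE w \<phi>)" rule: shE.cases) simp_all

text \<open>Products of two neighbours from different factors cancel in pairs since \<open>U\<close> is commutative.\<close>

lemma ME_shE:
  "shE us (v # vs) (\<lambda>w. ME u w \<phi>) + alt (Suc (length us)) (shE (u # us) vs (\<lambda>w. ME v w \<phi>))
     + alt (Suc (length us)) (ME v vs (\<lambda>b z. shE us z (\<lambda>w. \<phi> b (u # w))))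
     - alt (Suc (length us)) (ME u us (\<lambda>b z. shE z vs (\<lambda>w. \<phi> b (v # w)))) =
   ME u us (\<lambda>b z. shE z (v # vs) (\<phi> b)) + alt (Suc (length us)) (ME v vs (\<lambda>b z. shE (u # us) z (\<phi> b)))"
  by (cases us; cases vs) (simp_all add: comm_U[of u v] algebra_simps)

text \<open>Splitting off the first letter of the shuffle leaves the face at that letter and the
  faces behind it. The latter are covered by induction on the total length, the former by
  \<open>ME_shE\<close>, whose correction terms match those in which the induction hypotheses differ
  from the claim.\<close>

lemma JE_shE:
  "shE us vs (\<lambda>w. JE w \<phi>) =
    JE us (\<lambda>b ws. shE ws vs (\<phi> b)) + alt (length us) (JE vs (\<lambda>b ws. shE us ws (\<phi> b)))"
proof (induction "length us + length vs" arbitrary: us vs \<phi> rule: less_induct)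
  case less
  show ?case
  proof (cases "us = [] \<or> vs = []")
    case True
    then show ?thesis by auto
  next
    case False
    then obtain u us' v vs' where eq: "us = u # us'" "vs = v # vs'"
      by (meson neq_Nil_conv)
    let ?u = "\<lambda>b w. \<phi> b (u # w)" and ?v = "\<lambda>b w. \<phi> b (v # w)"
    have 1: "shE us' vs (\<lambda>w. JE w ?u) = JE us' (\<lambda>b ws. shE ws vs (?u b)) +
        alt (length us') (JE vs (\<lambda>b ws. shE us' ws (?u b)))"
      and 2: "shE us vs' (\<lambda>w. JE w ?v) = JE us (\<lambda>b ws. shE ws vs' (?v b)) +
        alt (length us) (JE vs' (\<lambda>b ws. shE us ws (?v b)))"
      by (rule less, simp add: eq)+
    \<comment> \<open>Faces behind \<open>u\<close> leave it in front of the first word, so the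
      remaining shuffle has to be split again by its own first letter, \<open>u\<close> or
      \<open>v\<close>. The sign is that of \<open>length us'\<close>, since \<open>ws\<close> is
      shorter than \<open>us'\<close> by one.\<close>
    have 3: "JE us' (\<lambda>b ws. shE (u # ws) vs (\<phi> b)) = JE us' (\<lambda>b ws. shE ws vs (?u b)) +
       alt (length us') (JE us' (\<lambda>b ws. shE (u # ws) vs' (?v b)))"
    proof -
      have "JE us' (\<lambda>b ws. shE (u # ws) vs (\<phi> b)) =
        JE us' (\<lambda>b ws. shE ws vs (?u b) + alt (length us') (shE (u # ws) vs' (?v b)))"
        by (rule JE_cong) (simp add: eq)
      then show ?thesis by (simp add: JE_add JE_alt)
    qed
    have "shE us vs (\<lambda>w. JE w \<phi>) =
      shE us' (v # vs') (\<lambda>w. ME u w \<phi>) - shE us' vs (\<lambda>w. JE w ?u) +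
      alt (length us) (shE (u # us') vs' (\<lambda>w. ME v w \<phi>) - shE us vs' (\<lambda>w. JE w ?v))"
      by (simp add: eq shE_diff)
    also have "\<dots> = JE us (\<lambda>b ws. shE ws vs (\<phi> b)) + alt (length us) (JE vs (\<lambda>b ws. shE us ws (\<phi> b)))"
      unfolding 1 2 using 3 ME_shE[of us' v vs' u \<phi>]
      by (simp add: eq JE_diff JE_alt algebra_simps)
    finally show ?thesis .
  qed
qed

text \<open>The Leibniz rule, combined from those for the first face and for the other faces; the
  coefficients are brought into place by commutativity of A.\<close>

lemma dE_shE:
  "shE us vs (\<lambda>w. dE (a * b) w \<phi>) =
    dE a us (\<lambda>c ws. shE ws vs (\<phi> (c * b))) + alt (length us) (dE b vs (\<lambda>c ws. shE us ws (\<phi> (a * c))))"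
  unfolding dE_def
  by (simp add: shE_diff JE_shE LE_shE mult.assoc comm_A[of _ b] left_comm_A[of _ b] algebra_simps)

section \<open>Balanced cochains\<close>

text \<open>Linearity over k in the coefficient and in every letter, and a factor \<open>t b\<close>
  of any letter may pass into the coefficient. Such a function is a cochain of all degrees at once,
  since nothing relates its values at words of different lengths.\<close>

definition balanced :: "('a \<Rightarrow> 'u list \<Rightarrow> 'k) \<Rightarrow> bool" where
  "balanced \<phi> \<longleftrightarrow>
     (\<forall>a b us. \<phi> (a + b) us = \<phi> a us + \<phi> b us) \<and> (\<forall>c a us. \<phi> (scA c a) us = c * \<phi> a us) \<and>
     (\<forall>a xs u v ys. \<phi> a (xs @ (u + v) # ys) = \<phi> a (xs @ u # ys) + \<phi> a (xs @ v # ys)) \<and>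
     (\<forall>a c xs u ys. \<phi> a (xs @ scU c u # ys) = c * \<phi> a (xs @ u # ys)) \<and>
     (\<forall>a b xs u ys. \<phi> a (xs @ (t b * u) # ys) = \<phi> (a * b) (xs @ u # ys))"

lemma balancedD:
  assumes "balanced \<phi>"
  shows "\<phi> (a + b) us = \<phi> a us + \<phi> b us" "\<phi> (scA c a) us = c * \<phi> a us"
    "\<phi> a (xs @ (u + v) # ys) = \<phi> a (xs @ u # ys) + \<phi> a (xs @ v # ys)"
    "\<phi> a (xs @ scU c u # ys) = c * \<phi> a (xs @ u # ys)"
    "\<phi> a (xs @ (t b * u) # ys) = \<phi> (a * b) (xs @ u # ys)"
  using assms by (simp_all add: balanced_def)

text \<open>Stated between functions of the word, for rewriting below \<open>shE\<close> and
  \<open>JE\<close>, where the cochain is applied to its coefficient only.\<close>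

lemma balanced_fun:
  assumes "balanced \<phi>"
  shows "\<phi> (a + b) = (\<lambda>us. \<phi> a us + \<phi> b us)" "\<phi> (scA c a) = (\<lambda>us. c * \<phi> a us)"
  using balancedD[OF assms] by auto

lemma balanced_hd:
  assumes "balanced \<phi>"
  shows "\<phi> a ((u + v) # ys) = \<phi> a (u # ys) + \<phi> a (v # ys)"
    "\<phi> a (scU c u # ys) = c * \<phi> a (u # ys)" "\<phi> a ((t b * u) # ys) = \<phi> (a * b) (u # ys)"
  using balancedD(3-5)[OF assms, where xs = "[]"] by simp_all

lemma balanced_Cons: "balanced \<phi> \<Longrightarrow> balanced (\<lambda>a us. \<phi> a (u # us))"
  by (simp add: balanced_def flip: append_Cons)

lemma balanced_mult:
  assumes "balanced \<phi>"
  shows "balanced (\<lambda>a us. \<phi> (b * a) us)"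
  unfolding balanced_def
  by (simp add: balancedD[OF assms] distrib_left scA_mult_right mult.assoc)

lemma ME_balanced:
  assumes "balanced \<phi>"
  shows "ME (u + v) ys \<phi> = ME u ys \<phi> + ME v ys \<phi>" "ME (scU c u) ys \<phi> = c * ME u ys \<phi>"
    "ME (t b * u) ys \<phi> = ME u ys (\<lambda>a. \<phi> (b * a))"
    "ME x (xs @ (u + v) # ys) \<phi> = ME x (xs @ u # ys) \<phi> + ME x (xs @ v # ys) \<phi>"
    "ME x (xs @ scU c u # ys) \<phi> = c * ME x (xs @ u # ys) \<phi>"
    "ME x (xs @ (t b * u) # ys) \<phi> = ME x (xs @ u # ys) (\<lambda>a. \<phi> (b * a))"
proof -
  note simps = balancedD(1,2)[OF assms] balanced_hd[OF assms] linear_facts[OF e2_linear] scU_mult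
    scU_mult_right distrib_right distrib_left e2_t mult.assoc left_comm_U[of _ "t b"]
    balancedD(3-5)[OF assms, where xs = "_ # _", simplified]
  show "ME (u + v) ys \<phi> = ME u ys \<phi> + ME v ys \<phi>" "ME (scU c u) ys \<phi> = c * ME u ys \<phi>"
    "ME (t b * u) ys \<phi> = ME u ys (\<lambda>a. \<phi> (b * a))"
    by (cases ys; simp add: simps)+
  show "ME x (xs @ (u + v) # ys) \<phi> = ME x (xs @ u # ys) \<phi> + ME x (xs @ v # ys) \<phi>"
    "ME x (xs @ scU c u # ys) \<phi> = c * ME x (xs @ u # ys) \<phi>"
    "ME x (xs @ (t b * u) # ys) \<phi> = ME x (xs @ u # ys) (\<lambda>a. \<phi> (b * a))"
    by (cases xs; simp add: simps)+
qed

lemma JE_balanced: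
  assumes "balanced \<phi>"
  shows "JE (xs @ (u + v) # ys) \<phi> = JE (xs @ u # ys) \<phi> + JE (xs @ v # ys) \<phi>"
    "JE (xs @ scU c u # ys) \<phi> = c * JE (xs @ u # ys) \<phi>"
    "JE (xs @ (t b * u) # ys) \<phi> = JE (xs @ u # ys) (\<lambda>a. \<phi> (b * a))"
proof -
  note J_times = hom_dE(3)[of "(*) c", OF distrib_left, symmetric]
  show "JE (xs @ (u + v) # ys) \<phi> = JE (xs @ u # ys) \<phi> + JE (xs @ v # ys) \<phi>" using assms
  proof (induction xs arbitrary: \<phi>)
    case Nil
    then show ?case by (simp add: ME_balanced balanced_hd JE_add)
  next
    case (Cons x xs)
    then show ?case using Cons.IH[OF balanced_Cons[OF Cons.prems, of x]] by (simp add: ME_balanced)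
  qed
  show "JE (xs @ scU c u # ys) \<phi> = c * JE (xs @ u # ys) \<phi>" using assms
  proof (induction xs arbitrary: \<phi>)
    case Nil
    then show ?case by (simp add: ME_balanced balanced_hd J_times right_diff_distrib)
  next
    case (Cons x xs)
    then show ?case using Cons.IH[OF balanced_Cons[OF Cons.prems, of x]]
      by (simp add: ME_balanced right_diff_distrib)
  qed
  show "JE (xs @ (t b * u) # ys) \<phi> = JE (xs @ u # ys) (\<lambda>a. \<phi> (b * a))" using assms
  proof (induction xs arbitrary: \<phi>)
    case Nil
    then show ?case by (simp add: ME_balanced balanced_hd comm_A[of _ b])
  next
    case (Cons x xs)
    then show ?case using Cons.IH[OF balanced_Cons[OF Cons.prems, of x]] by (simp add: ME_balanced)
  qed
qed

lemma LE_balanced: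
  assumes "balanced \<phi>"
  shows "LE (xs @ (u + v) # ys) \<phi> = LE (xs @ u # ys) \<phi> + LE (xs @ v # ys) \<phi>"
    "LE (xs @ scU c u # ys) \<phi> = c * LE (xs @ u # ys) \<phi>"
    "LE (xs @ (t b * u) # ys) \<phi> = LE (xs @ u # ys) (\<lambda>a. \<phi> (b * a))"
  by (cases xs; simp add: balancedD[OF assms] linear_facts[OF e1_linear] e1_t comm_A[of _ b])+

text \<open>The transpose of the differential preserves balanced cochains; this is what makes the
  differential well defined on tensors.\<close>

lemma balanced_dE:
  assumes "balanced \<phi>"
  shows "balanced (\<lambda>a us. dE a us \<phi>)"
  unfolding balanced_def dE_def
proof (intro conjI allI)
  fix c a b us
  show "LE us (\<lambda>c. \<phi> ((a + b) * c)) - JE us (\<lambda>c. \<phi> ((a + b) * c)) =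
      LE us (\<lambda>c. \<phi> (a * c)) - JE us (\<lambda>c. \<phi> (a * c)) + (LE us (\<lambda>c. \<phi> (b * c)) - JE us (\<lambda>c. \<phi> (b * c)))"
    by (simp add: balanced_fun[OF assms] distrib_right LE_add JE_add)
next
  fix c a us
  show "LE us (\<lambda>b. \<phi> (scA c a * b)) - JE us (\<lambda>b. \<phi> (scA c a * b)) =
      c * (LE us (\<lambda>b. \<phi> (a * b)) - JE us (\<lambda>b. \<phi> (a * b)))"
    by (simp add: balanced_fun[OF assms] scA_mult right_diff_distrib hom_dE(2,3)[of "(*) c", OF distrib_left])
next
  fix a xs u v ys
  note b = balanced_mult[OF assms, of a]
  show "LE (xs @ (u + v) # ys) (\<lambda>b. \<phi> (a * b)) - JE (xs @ (u + v) # ys) (\<lambda>b. \<phi> (a * b)) =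
     LE (xs @ u # ys) (\<lambda>b. \<phi> (a * b)) - JE (xs @ u # ys) (\<lambda>b. \<phi> (a * b)) +
     (LE (xs @ v # ys) (\<lambda>b. \<phi> (a * b)) - JE (xs @ v # ys) (\<lambda>b. \<phi> (a * b)))"
    by (simp add: JE_balanced(1)[OF b] LE_balanced(1)[OF b])
next
  fix a c xs u ys
  note b = balanced_mult[OF assms, of a]
  show "LE (xs @ scU c u # ys) (\<lambda>b. \<phi> (a * b)) - JE (xs @ scU c u # ys) (\<lambda>b. \<phi> (a * b)) =
     c * (LE (xs @ u # ys) (\<lambda>b. \<phi> (a * b)) - JE (xs @ u # ys) (\<lambda>b. \<phi> (a * b)))"
    by (simp add: JE_balanced(2)[OF b] LE_balanced(2)[OF b] right_diff_distrib)
next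
  fix a b xs u ys
  note b = balanced_mult[OF assms, of a]
  show "LE (xs @ (t b * u) # ys) (\<lambda>c. \<phi> (a * c)) - JE (xs @ (t b * u) # ys) (\<lambda>c. \<phi> (a * c)) =
     LE (xs @ u # ys) (\<lambda>c. \<phi> (a * b * c)) - JE (xs @ u # ys) (\<lambda>c. \<phi> (a * b * c))"
    by (simp add: JE_balanced(3)[OF b] LE_balanced(3)[OF b] mult.assoc)
qed

lemma balanced_combine:
  assumes "balanced \<phi>"
  shows "\<phi> a (xs @ (u + v) # ys) = \<phi> a (xs @ u # ys) + \<phi> a (xs @ v # ys)"
    "\<phi> a (xs @ scU c u # ys) = c * \<phi> a (xs @ u # ys) + 0"
    "\<phi> a (xs @ (t b * u) # ys) = \<phi> (a * b) (xs @ u # ys) + 0"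
  using balancedD[OF assms] by simp_all

text \<open>With one factor fixed, the shuffle product is a balanced function of the other. Each
  clause about a letter is an instance of \<open>shE_combine_left\<close>, with the scalar or the
  element of A already absorbed in the second test function.\<close>

lemma balanced_shE_left:
  assumes "balanced \<phi>"
  shows "balanced (\<lambda>a us. shE us vs (\<lambda>w. \<phi> (a * b) w))"
proof -
  have s: "shE us vs (\<lambda>w. c * \<psi> w) = c * shE us vs \<psi>" for us c and \<psi> :: "'u list \<Rightarrow> 'k"
    by (rule shE_hom[of "(*) c", OF distrib_left, symmetric])
  show ?thesis unfolding balanced_def
  proof (intro conjI allI)
    fix a a' xs u v ys c
    note b = balanced_combine[OF assms, where a = "a * b"]
    show "shE (xs @ (u + v) # ys) vs (\<phi> (a * b)) = shE (xs @ u # ys) vs (\<phi> (a * b)) + shE (xs @ v # ys) vs (\<phi> (a * b))"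
      by (rule shE_combine_left) (rule b)
    show "shE (xs @ scU c u # ys) vs (\<phi> (a * b)) = c * shE (xs @ u # ys) vs (\<phi> (a * b))"
    proof -
      have "shE (xs @ scU c u # ys) vs (\<phi> (a * b)) =
          shE (xs @ u # ys) vs (\<lambda>w. c * \<phi> (a * b) w) + shE (xs @ u # ys) vs (\<lambda>w. 0)"
        by (rule shE_combine_left) (rule b)
      then show ?thesis by (simp add: s)
    qed
    show "shE (xs @ (t a' * u) # ys) vs (\<phi> (a * b)) = shE (xs @ u # ys) vs (\<phi> (a * a' * b))"
    proof -
      have "shE (xs @ (t a' * u) # ys) vs (\<phi> (a * b)) =
          shE (xs @ u # ys) vs (\<phi> (a * b * a')) + shE (xs @ u # ys) vs (\<lambda>w. 0)"
        by (rule shE_combine_left) (rule b)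
      then show ?thesis by (simp add: mult.assoc comm_A[of b])
    qed
  qed (simp_all add: balanced_fun[OF assms] distrib_right scA_mult shE_add s)
qed

lemma balanced_shE_right:
  assumes "balanced \<phi>"
  shows "balanced (\<lambda>b vs. shE us vs (\<lambda>w. \<phi> (a * b) w))"
proof -
  have s: "shE us vs (\<lambda>w. c * \<psi> w) = c * shE us vs \<psi>" for vs c and \<psi> :: "'u list \<Rightarrow> 'k"
    by (rule shE_hom[of "(*) c", OF distrib_left, symmetric])
  show ?thesis unfolding balanced_def
  proof (intro conjI allI)
    fix b a' xs u v ys c
    note b = balanced_combine[OF assms, where a = "a * b"]
    show "shE us (xs @ (u + v) # ys) (\<phi> (a * b)) = shE us (xs @ u # ys) (\<phi> (a * b)) + shE us (xs @ v # ys) (\<phi> (a * b))"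
      by (rule shE_combine_right) (rule b)
    show "shE us (xs @ scU c u # ys) (\<phi> (a * b)) = c * shE us (xs @ u # ys) (\<phi> (a * b))"
    proof -
      have "shE us (xs @ scU c u # ys) (\<phi> (a * b)) =
          shE us (xs @ u # ys) (\<lambda>w. c * \<phi> (a * b) w) + shE us (xs @ u # ys) (\<lambda>w. 0)"
        by (rule shE_combine_right) (rule b)
      then show ?thesis by (simp add: s)
    qed
    show "shE us (xs @ (t a' * u) # ys) (\<phi> (a * b)) = shE us (xs @ u # ys) (\<phi> (a * (b * a')))"
    proof -
      have "shE us (xs @ (t a' * u) # ys) (\<phi> (a * b)) =
          shE us (xs @ u # ys) (\<phi> (a * b * a')) + shE us (xs @ u # ys) (\<lambda>w. 0)"
        by (rule shE_combine_right) (rule b)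
      then show ?thesis by (simp add: mult.assoc)
    qed
  qed (simp_all add: balanced_fun[OF assms] distrib_left scA_mult_right shE_add s)
qed

end

section \<open>Shuffle permutations\<close>

text \<open>The permutation that keeps position 0 and acts as \<open>\<tau>\<close> on the later
  positions. It describes the shuffles that begin with the first letter of the first word.\<close>

definition lift_perm :: "(nat \<Rightarrow> nat) \<Rightarrow> nat \<Rightarrow> nat" where
  "lift_perm \<tau> i = (case i of 0 \<Rightarrow> 0 | Suc j \<Rightarrow> Suc (\<tau> j))"

text \<open>The cycle that brings position \<open>m\<close> to the front. With \<open>m\<close> the
  length of the first word, it moves the first letter of the second word there, and its sign is the
  one in the recursion of \<open>shE\<close>.\<close>

definition cyc :: "nat \<Rightarrow> nat \<Rightarrow> nat" where
  "cyc m i = (if i < m then Suc i else if i = m then 0 else i)"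

definition cyc_inv :: "nat \<Rightarrow> nat \<Rightarrow> nat" where
  "cyc_inv m i = (case i of 0 \<Rightarrow> m | Suc j \<Rightarrow> if j < m then j else Suc j)"

lemma lift_perm_simps [simp]: "lift_perm \<tau> 0 = 0" "lift_perm \<tau> (Suc j) = Suc (\<tau> j)"
  by (simp_all add: lift_perm_def)

lemma cyc_inv_simps [simp]: "cyc_inv m 0 = m" "cyc_inv m (Suc j) = (if j < m then j else Suc j)"
  by (simp_all add: cyc_inv_def)

lemma cyc_cyc_inv [simp]: "cyc m (cyc_inv m i) = i"
  by (cases i) (auto simp: cyc_def)

lemma cyc_inv_cyc [simp]: "cyc_inv m (cyc m i) = i"
  by (cases i) (auto simp: cyc_def)

lemma permutes_cyc: "m < n \<Longrightarrow> cyc m permutes {..<n}"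
  unfolding permutes_def by (auto simp: cyc_def[of m n] intro!: ex1I[of _ "cyc_inv m _"])
    (auto simp: cyc_def)

lemma inj_lift_perm: "inj lift_perm"
proof (rule injI, rule ext)
  fix \<sigma> \<tau> i assume "lift_perm \<sigma> = lift_perm \<tau>"
  then have "lift_perm \<sigma> (Suc i) = lift_perm \<tau> (Suc i)" by simp
  then show "\<sigma> i = \<tau> i" by simp
qed

lemma lift_perm_comp: "lift_perm \<sigma> \<circ> lift_perm \<tau> = lift_perm (\<sigma> \<circ> \<tau>)"
  by (auto simp: fun_eq_iff lift_perm_def split: nat.split)

lemma lift_perm_id: "lift_perm id = id"
  by (auto simp: fun_eq_iff lift_perm_def split: nat.split)

lemma inv_lift_perm:
  assumes "\<tau> permutes {..<n}"
  shows "inv_into UNIV (lift_perm \<tau>) = lift_perm (inv_into UNIV \<tau>)"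
  using permutes_inv_o[OF assms] by (intro inv_unique_comp) (simp_all add: lift_perm_comp lift_perm_id)

lemma inv_lift_perm_cyc:
  assumes "\<tau> permutes {..<n}"
  shows "inv_into UNIV (lift_perm \<tau> \<circ> cyc m) = cyc_inv m \<circ> lift_perm (inv_into UNIV \<tau>)"
proof (rule inv_unique_comp)
  have 1: "lift_perm \<tau> (lift_perm (inv_into UNIV \<tau>) i) = i" "lift_perm (inv_into UNIV \<tau>) (lift_perm \<tau> i) = i" for i
    using permutes_inverses[OF assms] by (cases i; simp)+
  show "lift_perm \<tau> \<circ> cyc m \<circ> (cyc_inv m \<circ> lift_perm (inv_into UNIV \<tau>)) = id"
    "cyc_inv m \<circ> lift_perm (inv_into UNIV \<tau>) \<circ> (lift_perm \<tau> \<circ> cyc m) = id"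
    by (auto simp: fun_eq_iff 1)
qed

text \<open>Identifies \<open>lift_perm\<close> with the transport of a permutation along
  \<open>Suc\<close>, from which its support and its sign are obtained.\<close>

lemma map_permutation_Suc:
  assumes "\<tau> permutes {..<n}"
  shows "map_permutation {..<n} Suc \<tau> = lift_perm \<tau>"
proof
  fix i show "map_permutation {..<n} Suc \<tau> i = lift_perm \<tau> i"
    using permutes_not_in[OF assms]
    by (cases i) (auto simp: map_permutation_def restrict_id_def inv_into_f_f image_iff)
qed

lemma permutes_lift_perm:
  assumes "\<tau> permutes {..<n}"
  shows "lift_perm \<tau> permutes {..<Suc n}"
proof -
  have "map_permutation {..<n} Suc \<tau> permutes Suc ` {..<n}"
    using assms by (intro map_permutation_permutes) (auto simp: bij_betw_def)
  moreover have "Suc ` {..<n} \<subseteq> {..<Suc n}" by auto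
  ultimately show ?thesis using permutes_subset map_permutation_Suc[OF assms] by metis
qed

lemma sign_lift_perm:
  assumes "\<tau> permutes {..<n}"
  shows "sign (lift_perm \<tau>) = sign \<tau>"
  using sign_map_permutation[of Suc "{..<n}" \<tau>] assms by (simp add: map_permutation_Suc)

text \<open>The cycle is a product of \<open>m\<close> adjacent transpositions.\<close>

lemma sign_cyc: "sign (cyc m) = (- 1) ^ m"
proof (induction m)
  case 0
  have "cyc 0 = id" by (auto simp: fun_eq_iff cyc_def)
  then show ?case by simp
next
  case (Suc m)
  have "cyc (Suc m) = cyc m \<circ> transpose m (Suc m)"
    by (auto simp: fun_eq_iff cyc_def transpose_def)
  moreover have "permutation (cyc m)"
    using permutes_cyc[of m "Suc m"] by (auto simp: permutation_permutes)
  ultimately show ?case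
    using sign_compose[of "cyc m" "transpose m (Suc m)"]
    by (simp only: permutation_swap_id sign_swap_id Suc) simp
qed

lemma lift_perm_cases:
  assumes "\<sigma> permutes {..<Suc n}" "\<sigma> 0 = 0"
  obtains \<tau> where "\<tau> permutes {..<n}" "\<sigma> = lift_perm \<tau>"
proof
  define \<tau> where "\<tau> i = \<sigma> (Suc i) - 1" for i
  have nz: "\<sigma> (Suc i) \<noteq> 0" for i
    using permutes_inj[OF assms(1)] assms(2) by (metis injD nat.distinct(1))
  then have S: "Suc (\<tau> i) = \<sigma> (Suc i)" for i by (simp add: \<tau>_def)
  show "\<sigma> = lift_perm \<tau>" using assms(2) by (auto simp: fun_eq_iff lift_perm_def S split: nat.split)
  show "\<tau> permutes {..<n}"
    unfolding permutes_def
  proof (intro conjI allI impI)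
    fix x assume "x \<notin> {..<n}"
    then show "\<tau> x = x" using permutes_not_in[OF assms(1), of "Suc x"] by (simp add: \<tau>_def)
  next
    fix y
    obtain x where x: "\<sigma> x = Suc y" using permutes_surj[OF assms(1)] by (metis surjD)
    then obtain x' where "x = Suc x'" using assms(2) by (cases x) auto
    then show "\<exists>!x. \<tau> x = y"
      using x S permutes_inj[OF assms(1)] by (metis Suc_inject injD)
  qed
qed

lemma finite_shuffle_perms: "finite (shuffle_perms p q)"
  by (rule finite_subset[OF _ finite_permutations[of "{..<p + q}"]]) (auto simp: shuffle_perms_def)

text \<open>A strictly increasing map dominates the identity, and a permutation that does so is the
  identity. This settles shuffles with an empty word.\<close>

lemma strict_mono_on_permutes_id:
  fixes \<sigma> :: "nat \<Rightarrow> nat"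
  assumes "\<sigma> permutes {..<n}" "strict_mono_on {..<n} \<sigma>"
  shows "\<sigma> = id"
proof (rule permutes_natset_ge[OF assms(1)])
  have "i < n \<longrightarrow> i \<le> \<sigma> i" for i
  proof (induction i)
    case (Suc i)
    then show ?case using strict_mono_onD[OF assms(2), of i "Suc i"] by auto
  qed simp
  then show "\<forall>i\<in>{..<n}. i \<le> \<sigma> i" by auto
qed

lemma shuffle_perms_0 [simp]: "shuffle_perms 0 q = {id}" "shuffle_perms p 0 = {id}"
  using strict_mono_on_permutes_id
  by (auto simp: shuffle_perms_def permutes_id strict_mono_on_def lessThan_atLeast0)

lemma lift_perm_shuffle_iff:
  assumes "\<tau> permutes {..<p + q}"
  shows "lift_perm \<tau> \<in> shuffle_perms (Suc p) q \<longleftrightarrow> \<tau> \<in> shuffle_perms p q"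
proof -
  have "strict_mono_on {..<Suc p} (lift_perm \<tau>) \<longleftrightarrow> strict_mono_on {..<p} \<tau>"
    unfolding strict_mono_on_def
    by (auto simp: lift_perm_def less_Suc_eq_0_disj split: nat.splits)
  moreover have "strict_mono_on {Suc p..<Suc p + q} (lift_perm \<tau>) \<longleftrightarrow> strict_mono_on {p..<p + q} \<tau>"
    unfolding strict_mono_on_def
    by (auto simp: lift_perm_def Suc_le_eq split: nat.splits)
  ultimately show ?thesis
    using assms permutes_lift_perm[OF assms] by (simp add: shuffle_perms_def)
qed

text \<open>The composite sends i < p to \<open>Suc (\<tau> i)\<close>, the position p to 0, and
  \<open>Suc i\<close> with i at least p to \<open>Suc (\<tau> i)\<close>. On both blocks it is
  therefore increasing exactly when \<open>\<tau>\<close> is.\<close>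

lemma lift_perm_cyc_shuffle_iff:
  assumes "\<tau> permutes {..<p + q}"
  shows "lift_perm \<tau> \<circ> cyc p \<in> shuffle_perms p (Suc q) \<longleftrightarrow> \<tau> \<in> shuffle_perms p q"
proof -
  have "strict_mono_on {..<p} (lift_perm \<tau> \<circ> cyc p) \<longleftrightarrow> strict_mono_on {..<p} \<tau>"
    unfolding strict_mono_on_def by (auto simp: cyc_def)
  moreover have "strict_mono_on {p..<p + Suc q} (lift_perm \<tau> \<circ> cyc p) \<longleftrightarrow> strict_mono_on {p..<p + q} \<tau>"
  proof
    assume l: "strict_mono_on {p..<p + Suc q} (lift_perm \<tau> \<circ> cyc p)"
    show "strict_mono_on {p..<p + q} \<tau>"
    proof (rule strict_mono_onI)
      fix i j assume "i \<in> {p..<p + q}" "j \<in> {p..<p + q}" "i < j"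
      then show "\<tau> i < \<tau> j" using strict_mono_onD[OF l, of "Suc i" "Suc j"] by (simp add: cyc_def)
    qed
  next
    assume r: "strict_mono_on {p..<p + q} \<tau>"
    show "strict_mono_on {p..<p + Suc q} (lift_perm \<tau> \<circ> cyc p)"
    proof (rule strict_mono_onI)
      fix i j assume ij: "i \<in> {p..<p + Suc q}" "j \<in> {p..<p + Suc q}" "i < j"
      then obtain j' where j': "j = Suc j'" by (cases j) auto
      show "(lift_perm \<tau> \<circ> cyc p) i < (lift_perm \<tau> \<circ> cyc p) j"
      proof (cases "i = p")
        case True
        then show ?thesis using ij j' by (simp add: cyc_def)
      next
        case False
        then obtain i' where i': "i = Suc i'" using ij by (cases i) auto
        then show ?thesis using ij j' False strict_mono_onD[OF r, of i' j'] by (simp add: cyc_def)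
      qed
    qed
  qed
  moreover have "lift_perm \<tau> \<circ> cyc p permutes {..<p + Suc q}"
    using permutes_compose[OF permutes_cyc permutes_lift_perm[OF assms], of p] by simp
  ultimately show ?thesis using assms by (simp add: shuffle_perms_def)
qed

text \<open>A shuffle has the first letter of the first word or of the second word in front.\<close>

lemma shuffle_perms_Suc:
  "shuffle_perms (Suc p) (Suc q) =
     lift_perm ` shuffle_perms p (Suc q) \<union> (\<lambda>\<tau>. lift_perm \<tau> \<circ> cyc (Suc p)) ` shuffle_perms (Suc p) q"
proof (intro equalityI subsetI)
  fix \<sigma> assume \<sigma>: "\<sigma> \<in> shuffle_perms (Suc p) (Suc q)"
  then have perm: "\<sigma> permutes {..<Suc (p + Suc q)}"
    and mono: "strict_mono_on {..<Suc p} \<sigma>" "strict_mono_on {Suc p..<Suc p + Suc q} \<sigma>"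
    by (auto simp: shuffle_perms_def)
  obtain j where j: "\<sigma> j = 0" using permutes_surj[OF perm] by (metis surjD)
  have jn: "j < Suc (p + Suc q)" using permutes_not_in[OF perm, of j] j by (cases "j < Suc (p + Suc q)") auto
  \<comment> \<open>The value 0 can only be taken at the beginning of one of the two increasing
    blocks.\<close>
  have "j = 0 \<or> j = Suc p"
  proof (rule ccontr)
    assume "\<not> (j = 0 \<or> j = Suc p)"
    then consider "0 < j" "j < Suc p" | "Suc p < j" by linarith
    then show False
      using strict_mono_onD[OF mono(1), of 0 j] strict_mono_onD[OF mono(2), of "Suc p" j] j jn
      by cases auto
  qed
  then show "\<sigma> \<in> lift_perm ` shuffle_perms p (Suc q) \<union> (\<lambda>\<tau>. lift_perm \<tau> \<circ> cyc (Suc p)) ` shuffle_perms (Suc p) q"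
  proof
    assume "j = 0"
    then obtain \<tau> where "\<tau> permutes {..<p + Suc q}" "\<sigma> = lift_perm \<tau>"
      using lift_perm_cases[OF perm] j by metis
    then show ?thesis using \<sigma> lift_perm_shuffle_iff by auto
  next
    assume "j = Suc p"
    have c: "cyc_inv (Suc p) = inv_into UNIV (cyc (Suc p))"
      by (rule inv_unique_comp[symmetric]) (auto simp: fun_eq_iff)
    have "\<sigma> \<circ> cyc_inv (Suc p) permutes {..<Suc (Suc p + q)}"
      unfolding c using permutes_compose[OF permutes_inv[OF permutes_cyc] perm, of "Suc p"] by simp
    moreover have "(\<sigma> \<circ> cyc_inv (Suc p)) 0 = 0" using j \<open>j = Suc p\<close> by simp
    ultimately obtain \<tau> where \<tau>: "\<tau> permutes {..<Suc p + q}" "\<sigma> \<circ> cyc_inv (Suc p) = lift_perm \<tau>"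
      using lift_perm_cases by metis
    then have "\<sigma> = lift_perm \<tau> \<circ> cyc (Suc p)" by (auto simp: fun_eq_iff simp flip: \<tau>(2))
    then show ?thesis using \<sigma> \<tau>(1) lift_perm_cyc_shuffle_iff by auto
  qed
next
  fix \<sigma> assume "\<sigma> \<in> lift_perm ` shuffle_perms p (Suc q) \<union> (\<lambda>\<tau>. lift_perm \<tau> \<circ> cyc (Suc p)) ` shuffle_perms (Suc p) q"
  then show "\<sigma> \<in> shuffle_perms (Suc p) (Suc q)"
    using lift_perm_shuffle_iff[of _ p "Suc q"] lift_perm_cyc_shuffle_iff[of _ "Suc p" q]
    by (auto simp: shuffle_perms_def)
qed

lemma alt_eq_mult: "alt n x = (- 1) ^ n * (x :: 'k::field)"
  by (simp add: alt_def)

text \<open>The index is that of \<open>cyc_inv\<close> behind the front position: the letter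
  \<open>v\<close> at position \<open>m\<close>, now moved to the front, is skipped.\<close>

lemma nth_skip:
  assumes "m = length xs"
  shows "(xs @ v # vs) ! (if k < m then k else Suc k) = (xs @ vs) ! k"
  using assms by (auto simp: nth_append Suc_diff_le)

text \<open>Connects the sum over permutations in \<open>sh\<close> with the recursive shuffle. Both
  split by the first letter of the shuffled word: \<open>lift_perm\<close> keeps the sign, and the
  cycle contributes one sign for each letter of the first word.\<close>

lemma sum_shuffle_perms_eq_shE:
  fixes \<phi> :: "'u list \<Rightarrow> 'k::field"
  assumes "length us = p" "length vs = q"
  shows "(\<Sum>\<sigma>\<in>shuffle_perms p q. of_int (sign \<sigma>) * \<phi> (map (\<lambda>i. (us @ vs) ! inv_into UNIV \<sigma> i) [0..<p + q])) = shE us vs \<phi>"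
  using assms
proof (induction us vs \<phi> arbitrary: p q rule: shE.induct)
  case (1 vs \<phi>)
  then show ?case using map_nth[of vs] by auto
next
  case (2 u us \<phi>)
  then show ?case using map_nth[of "u # us"] by simp
next
  case (3 u us v vs \<phi>)
  obtain p' q' where pq: "p = Suc p'" "q = Suc q'" using 3 by auto
  have len: "length us = p'" "length vs = q'" "length (v # vs) = Suc q'" "length (u # us) = Suc p'"
    using 3 pq by auto
  let ?w = "\<lambda>us vs \<sigma>. map (\<lambda>i. (us @ vs) ! inv_into UNIV \<sigma> i) [0..<length us + length vs]"
  let ?f = "\<lambda>\<sigma>. of_int (sign \<sigma>) * \<phi> (?w (u # us) (v # vs) \<sigma>)"
  have upt: "[0..<Suc n] = 0 # map Suc [0..<n]" for n
    by (metis map_Suc_upt upt_conv_Cons zero_less_Suc)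
  have first: "?f (lift_perm \<tau>) = of_int (sign \<tau>) * \<phi> (u # ?w us (v # vs) \<tau>)"
    if "\<tau> \<in> shuffle_perms p' (Suc q')" for \<tau>
  proof -
    have p: "\<tau> permutes {..<p' + Suc q'}" using that by (simp add: shuffle_perms_def)
    have "?w (u # us) (v # vs) (lift_perm \<tau>) = u # ?w us (v # vs) \<tau>"
      unfolding inv_lift_perm[OF p] by (simp add: upt del: upt_Suc)
    then show ?thesis by (simp only: sign_lift_perm[OF p])
  qed
  have second: "?f (lift_perm \<tau> \<circ> cyc (Suc p')) =
      (- 1) ^ Suc p' * (of_int (sign \<tau>) * \<phi> (v # ?w (u # us) vs \<tau>))"
    if "\<tau> \<in> shuffle_perms (Suc p') q'" for \<tau>
  proof -
    have p: "\<tau> permutes {..<Suc p' + q'}" using that by (simp add: shuffle_perms_def)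
    have l: "[0..<length (u # us) + length (v # vs)] = 0 # map Suc [0..<length (u # us) + length vs]"
      using upt[of "length (u # us) + length vs"] by (simp only: length_Cons add_Suc_right)
    have w: "?w (u # us) (v # vs) (lift_perm \<tau> \<circ> cyc (Suc p')) = v # ?w (u # us) vs \<tau>"
      unfolding inv_lift_perm_cyc[OF p] l
      using nth_skip[of "Suc p'" "u # us" v vs] nth_append_length[of "u # us" v vs] len
      by (simp del: upt_Suc append_Cons nth_Cons_Suc)
    have "permutation (lift_perm \<tau>)" "permutation (cyc (Suc p'))"
      using permutes_lift_perm[OF p] permutes_cyc[of "Suc p'" "Suc (Suc p')"]
      by (auto simp: permutation_permutes)
    then have "of_int (sign (lift_perm \<tau> \<circ> cyc (Suc p'))) = (- 1) ^ Suc p' * (of_int (sign \<tau>) :: 'k)"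
      by (simp only: sign_compose sign_cyc sign_lift_perm[OF p]) simp
    then show ?thesis by (simp only: w mult.assoc)
  qed
  \<comment> \<open>The two kinds of shuffles differ at position 0, which goes to 0 in the first
    kind and to a successor in the second.\<close>
  have disj: "lift_perm ` shuffle_perms p' (Suc q') \<inter> (\<lambda>\<tau>. lift_perm \<tau> \<circ> cyc (Suc p')) ` shuffle_perms (Suc p') q' = {}"
  proof -
    have "lift_perm \<sigma> \<noteq> lift_perm \<tau> \<circ> cyc (Suc p')" for \<sigma> \<tau>
      by (auto simp: fun_eq_iff cyc_def intro!: exI[of _ 0])
    then show ?thesis by blast
  qed
  have inj1: "inj_on lift_perm (shuffle_perms p' (Suc q'))" using inj_lift_perm by (rule inj_on_subset) simp
  have inj2: "inj_on (\<lambda>\<tau>. lift_perm \<tau> \<circ> cyc (Suc p')) (shuffle_perms (Suc p') q')"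
  proof (rule inj_onI)
    fix \<sigma> \<tau> assume "lift_perm \<sigma> \<circ> cyc (Suc p') = lift_perm \<tau> \<circ> cyc (Suc p')"
    then have "lift_perm \<sigma> i = lift_perm \<tau> i" for i
      by (metis comp_apply cyc_cyc_inv)
    then show "\<sigma> = \<tau>" using inj_lift_perm by (metis ext injD)
  qed
  have "(\<Sum>\<sigma>\<in>shuffle_perms p q. of_int (sign \<sigma>) * \<phi> (map (\<lambda>i. ((u # us) @ v # vs) ! inv_into UNIV \<sigma> i) [0..<p + q])) =
      (\<Sum>\<sigma>\<in>shuffle_perms (Suc p') (Suc q'). ?f \<sigma>)"
    using 3 by (simp add: pq del: upt_Suc)
  also have "\<dots> = (\<Sum>\<tau>\<in>shuffle_perms p' (Suc q'). ?f (lift_perm \<tau>)) +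
      (\<Sum>\<tau>\<in>shuffle_perms (Suc p') q'. ?f (lift_perm \<tau> \<circ> cyc (Suc p')))"
    unfolding shuffle_perms_Suc
    by (subst sum.union_disjoint) (use disj in \<open>auto simp: finite_shuffle_perms sum.reindex[OF inj1] sum.reindex[OF inj2]\<close>)
  also have "\<dots> = (\<Sum>\<tau>\<in>shuffle_perms p' (Suc q'). of_int (sign \<tau>) * \<phi> (u # ?w us (v # vs) \<tau>)) +
      (\<Sum>\<tau>\<in>shuffle_perms (Suc p') q'. (- 1) ^ Suc p' * (of_int (sign \<tau>) * \<phi> (v # ?w (u # us) vs \<tau>)))"
    by (intro arg_cong2[of _ _ _ _ "(+)"] sum.cong refl first second)
  also have "\<dots> = shE us (v # vs) (\<lambda>w. \<phi> (u # w)) + alt (Suc p') (shE (u # us) vs (\<lambda>w. \<phi> (v # w)))"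
    using 3(1)[OF len(1,3)] 3(2)[OF len(4,2)] len
    by (simp only: alt_eq_mult flip: sum_distrib_left)
  finally show ?case using len by simp
qed

section \<open>Pairing chains with cochains\<close>

global_interpretation field_vs: vspace "(*) :: 'k::field \<Rightarrow> 'k \<Rightarrow> 'k"
  by (simp add: vspace_def)

global_interpretation free_vs: vspace "fscale :: 'k::field \<Rightarrow> ('g \<Rightarrow>\<^sub>0 'k) \<Rightarrow> ('g \<Rightarrow>\<^sub>0 'k)"
  by (rule vspace_fscale)

definition pair :: "('a \<times> 'u \<Rightarrow>\<^sub>0 'k::field) \<Rightarrow> ('a \<Rightarrow> 'u \<Rightarrow> 'k) \<Rightarrow> 'k" where
  "pair F \<phi> = lext (*) (\<lambda>g. \<phi> (fst g) (snd g)) F"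

lemma linear_pair: "Vector_Spaces.linear fscale (*) (\<lambda>F. pair F \<phi>)"
  unfolding pair_def by (rule field_vs.linear_lext)

lemmas pair_linear = linear_facts[OF linear_pair]

lemma pair_fsingle [simp]: "pair (fsingle (a, us)) \<phi> = \<phi> a us"
  by (simp add: pair_def)

lemma pair_lext: "pair (lext fscale f F) \<phi> = lext (*) (\<lambda>g. pair (f g) \<phi>) F"
  by (rule free_vs.linear_lext_comp[OF linear_pair])

lemma pair_lext_pair: "pair (lext fscale (\<lambda>g. f (fst g) (snd g)) F) \<phi> = pair F (\<lambda>a us. pair (f a us) \<phi>)"
  by (simp add: pair_lext) (simp add: pair_def)

lemma pair_cong:
  "(\<And>a us. (a, us) \<in> Poly_Mapping.keys F \<Longrightarrow> \<phi> a us = \<psi> a us) \<Longrightarrow> pair F \<phi> = pair F \<psi>"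
  unfolding pair_def by (rule lext_cong) auto

lemma pair_add_fun: "pair F (\<lambda>a us. \<phi> a us + \<psi> a us) = pair F \<phi> + pair F \<psi>"
  by (simp add: pair_def field_vs.lext_add_fun)

lemma pair_times_fun: "pair F (\<lambda>a us. c * \<phi> a us) = c * pair F \<phi>"
  by (simp add: pair_def field_vs.lext_scale_fun)

lemma pair_0_fun [simp]: "pair F (\<lambda>a us. 0) = 0"
  using pair_times_fun[of F 0 "\<lambda>_ _. 0"] by simp

lemma pair_sum_fun: "pair F (\<lambda>a us. \<Sum>i\<in>I. \<phi> i a us) = (\<Sum>i\<in>I. pair F (\<phi> i))"
  by (induction I rule: infinite_finite_induct) (simp_all add: pair_add_fun)

lemma pair_uminus_fun: "pair F (\<lambda>a us. - \<phi> a us) = - pair F \<phi>"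
  using pair_times_fun[of F "- 1" \<phi>] by simp

lemma pair_diff_fun: "pair F (\<lambda>a us. \<phi> a us - \<psi> a us) = pair F \<phi> - pair F \<psi>"
  using pair_add_fun[of F \<phi> "\<lambda>a us. - \<psi> a us"] by (simp add: pair_uminus_fun)

lemma pair_alt_fun: "pair F (\<lambda>a us. alt n (\<phi> a us)) = alt n (pair F \<phi>)"
  by (simp add: alt_def pair_uminus_fun)

lemma pair_swap: "pair F (\<lambda>a us. pair G (\<lambda>b vs. \<phi> a us b vs)) = pair G (\<lambda>b vs. pair F (\<lambda>a us. \<phi> a us b vs))"
  unfolding pair_def by (rule lext_swap)

text \<open>Here arbitrary test functions are allowed, and indicator functions read off the
  coefficients. Equality of combinations on the nose is thus evaluation at all functions, equality
  of chains evaluation at balanced ones only.\<close>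

lemma pair_eqI:
  assumes "\<And>\<phi>. pair F \<phi> = pair G \<phi>"
  shows "F = G"
proof (rule poly_mapping_eqI)
  fix g :: "'a \<times> 'b"
  have "pair F' (\<lambda>a us. if (a, us) = g then 1 else 0) = Poly_Mapping.lookup F' g" for F'
  proof -
    have "pair F' (\<lambda>a us. if (a, us) = g then 1 else 0) =
      (\<Sum>h\<in>Poly_Mapping.keys F'. if h = g then Poly_Mapping.lookup F' h else 0)"
      unfolding pair_def lext_def by (intro sum.cong) auto
    then show ?thesis by (simp add: in_keys_iff)
  qed
  then show "Poly_Mapping.lookup F g = Poly_Mapping.lookup G g" using assms by metis
qed

lemma shE_pair_swap:
  "shE us vs (\<lambda>w. pair E (\<lambda>d zs. \<chi> w d zs)) = pair E (\<lambda>d zs. shE us vs (\<lambda>w. \<chi> w d zs))"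
proof (induction "length us + length vs" arbitrary: us vs \<chi> rule: less_induct)
  case less
  show ?case
    by (cases us; cases vs) (simp_all add: less.hyps pair_add_fun pair_diff_fun pair_alt_fun)
qed

definition homog :: "nat \<Rightarrow> ('a \<times> 'u list \<Rightarrow>\<^sub>0 'k::field) set" where
  "homog n = {F. Poly_Mapping.keys F \<subseteq> {g. length (snd g) = n}}"

lemma subspace_homog: "free.subspace (homog n)"
  unfolding homog_def by (rule subspace_keys)

lemmas homog_closed = free.subspace_0[OF subspace_homog] free.subspace_add[OF subspace_homog]
  free.subspace_diff[OF subspace_homog] free.subspace_scale[OF subspace_homog]
  free.subspace_sum[OF subspace_homog] free.subspace_neg[OF subspace_homog]

lemma fsingle_homog [simp]: "fsingle (a, us) \<in> homog n \<longleftrightarrow> length us = n"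
  by (simp add: homog_def)

lemma homog_keys: "F \<in> homog n \<Longrightarrow> (a, us) \<in> Poly_Mapping.keys F \<Longrightarrow> length us = n"
  by (auto simp: homog_def)

lemma lext_homog:
  assumes "\<And>a us. (a, us) \<in> Poly_Mapping.keys F \<Longrightarrow> f a us \<in> homog n"
  shows "lext fscale (\<lambda>g. f (fst g) (snd g)) F \<in> homog n"
  using assms by (intro free_vs.lext_mem[OF subspace_homog]) auto

lemma pair_homog_cong:
  "F \<in> homog n \<Longrightarrow> (\<And>a us. length us = n \<Longrightarrow> \<phi> a us = \<psi> a us) \<Longrightarrow> pair F \<phi> = pair F \<psi>"
  by (rule pair_cong) (auto dest: homog_keys)

lemma alt_mem: "free.subspace S \<Longrightarrow> x \<in> S \<Longrightarrow> alt n x \<in> S"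
  by (simp add: alt_def free.subspace_neg)

lemma shE_mem:
  assumes "free.subspace S" "\<And>w. length w = length us + length vs \<Longrightarrow> \<phi> w \<in> S"
  shows "shE us vs \<phi> \<in> S"
  using assms(2)
proof (induction us vs \<phi> rule: shE.induct)
  case (3 u us v vs \<phi>)
  have "shE us (v # vs) (\<lambda>w. \<phi> (u # w)) \<in> S" "shE (u # us) vs (\<lambda>w. \<phi> (v # w)) \<in> S"
    using 3 by auto
  then show ?case
    using assms(1) by (simp add: alt_mem free.subspace_diff)
qed auto

section \<open>The chain complex\<close>

context bar
begin

lemma ME_mem:
  assumes "\<And>b ws. length ws = length us \<Longrightarrow> \<phi> b ws \<in> S"
  shows "ME u us \<phi> \<in> S"
  using assms by (cases us) auto

lemma JE_mem:
  assumes "free.subspace S" "\<And>b ws. length us = Suc (length ws) \<Longrightarrow> \<phi> b ws \<in> S"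
  shows "JE us \<phi> \<in> S"
  using assms(2)
proof (induction us arbitrary: \<phi>)
  case (Cons u us)
  have "ME u us \<phi> \<in> S" "JE us (\<lambda>b ws. \<phi> b (u # ws)) \<in> S"
    using Cons by (auto intro!: ME_mem)
  then show ?case using assms(1) by (simp add: free.subspace_diff)
qed (use assms(1) in \<open>simp add: free.subspace_0\<close>)

lemma dE_mem:
  assumes "free.subspace S" "\<And>b ws. length us = Suc (length ws) \<Longrightarrow> \<phi> b ws \<in> S"
  shows "dE a us \<phi> \<in> S"
proof -
  have "LE us (\<lambda>b. \<phi> (a * b)) \<in> S"
    using assms by (cases us) (auto simp: free.subspace_0)
  moreover have "JE us (\<lambda>b. \<phi> (a * b)) \<in> S" using assms by (intro JE_mem) auto
  ultimately show ?thesis using assms(1) by (simp add: dE_def free.subspace_diff)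
qed

text \<open>Taking \<open>fsingle\<close> as the test function of \<open>dE\<close> turns the
  evaluation back into a combination of words; \<open>shuffle\<close> arises from \<open>shE\<close>
  in the same way.\<close>

definition D :: "('a \<times> 'u list \<Rightarrow>\<^sub>0 'k) \<Rightarrow> ('a \<times> 'u list \<Rightarrow>\<^sub>0 'k)" where
  "D F = lext fscale (\<lambda>g. dE (fst g) (snd g) (\<lambda>b ws. fsingle (b, ws))) F"

definition shuffle :: "('a \<times> 'u list \<Rightarrow>\<^sub>0 'k) \<Rightarrow> ('a \<times> 'u list \<Rightarrow>\<^sub>0 'k) \<Rightarrow> ('a \<times> 'u list \<Rightarrow>\<^sub>0 'k)" where
  "shuffle F G = lext fscale (\<lambda>g. lext fscale (\<lambda>h.
     shE (snd g) (snd h) (\<lambda>w. fsingle (fst g * fst h, w))) G) F"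

lemma linear_D: "Vector_Spaces.linear fscale fscale D"
  unfolding D_def[abs_def] by (rule free_vs.linear_lext)

lemmas D_linear = linear_facts[OF linear_D]

lemma pair_D: "pair (D F) \<phi> = pair F (\<lambda>a us. dE a us \<phi>)"
  unfolding D_def pair_lext_pair[where f = "\<lambda>a us. dE a us (\<lambda>b ws. fsingle (b, ws))"]
  by (simp add: hom_dE(4)[of "\<lambda>F. pair F \<phi>", OF pair_linear(1)])

lemma D_homog: "F \<in> homog (Suc n) \<Longrightarrow> D F \<in> homog n"
  unfolding D_def by (rule lext_homog[where f = "\<lambda>a us. dE a us (\<lambda>b ws. fsingle (b, ws))"])
    (auto dest: homog_keys intro!: dE_mem subspace_homog)

lemma D_homog_0: "F \<in> homog 0 \<Longrightarrow> D F = 0"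
  by (rule pair_eqI)
    (auto simp: pair_D pair_linear dE_def intro!: pair_homog_cong[of F 0 _ "\<lambda>_ _. 0", simplified])

lemma D_D: "D (D F) = 0"
  by (rule pair_eqI) (simp add: pair_D pair_linear dE_dE)

lemma pair_shuffle: "pair (shuffle F G) \<phi> = pair F (\<lambda>a us. pair G (\<lambda>b vs. shE us vs (\<phi> (a * b))))"
  unfolding shuffle_def
  by (simp add: pair_lext shE_hom[of "\<lambda>F. pair F \<phi>", OF pair_linear(1)]) (simp add: pair_def)

lemma shuffle_homog: "F \<in> homog p \<Longrightarrow> G \<in> homog q \<Longrightarrow> shuffle F G \<in> homog (p + q)"
  unfolding shuffle_def
  by (intro free_vs.lext_mem[OF subspace_homog] shE_mem subspace_homog)
    (auto simp: fsingle_homog dest!: homog_keys[OF _ surjective_pairing[THEN subst, where P = "\<lambda>x. x \<in> _"]])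

lemma shuffle_linear:
  "shuffle (F + F') G = shuffle F G + shuffle F' G" "shuffle F (G + G') = shuffle F G + shuffle F G'"
  "shuffle (fscale c F) G = fscale c (shuffle F G)" "shuffle F (fscale c G) = fscale c (shuffle F G)"
  by (rule pair_eqI, simp add: pair_shuffle pair_linear pair_add_fun pair_times_fun)+

lemma shuffle_assoc: "shuffle (shuffle F G) E = shuffle F (shuffle G E)"
  by (rule pair_eqI) (simp add: pair_shuffle mult.assoc shE_pair_swap shE_assoc)

lemma shuffle_one: "shuffle (fsingle (1, [])) F = F" "shuffle F (fsingle (1, [])) = F"
  by (rule pair_eqI, simp add: pair_shuffle)+

text \<open>The Leibniz rule for combinations. The sign stays inside the pairing with F, since the
  words of F may have different lengths.\<close>

lemma pair_D_shuffle:
  "pair (D (shuffle F G)) \<phi> =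
     pair G (\<lambda>b vs. pair (D F) (\<lambda>c ws. shE ws vs (\<phi> (c * b)))) +
     pair F (\<lambda>a us. alt (length us) (pair (D G) (\<lambda>c ws. shE us ws (\<phi> (a * c)))))"
proof -
  have "pair (D (shuffle F G)) \<phi> =
    pair F (\<lambda>a us. pair G (\<lambda>b vs. dE a us (\<lambda>c ws. shE ws vs (\<phi> (c * b))))) +
    pair F (\<lambda>a us. alt (length us) (pair G (\<lambda>b vs. dE b vs (\<lambda>c ws. shE us ws (\<phi> (a * c))))))"
    by (simp add: pair_D pair_shuffle dE_shE pair_add_fun pair_alt_fun)
  also have "pair F (\<lambda>a us. pair G (\<lambda>b vs. dE a us (\<lambda>c ws. shE ws vs (\<phi> (c * b))))) =
    pair G (\<lambda>b vs. pair (D F) (\<lambda>c ws. shE ws vs (\<phi> (c * b))))"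
    unfolding pair_D by (rule pair_swap)
  finally show ?thesis by (simp add: pair_D)
qed

text \<open>Cycles of all degrees together. The boundary need not vanish as a combination of words,
  only modulo the tensor relations, which is what pairing with balanced cochains expresses.\<close>

definition Z :: "('a \<times> 'u list \<Rightarrow>\<^sub>0 'k) set" where
  "Z = {F. \<forall>\<phi>. balanced \<phi> \<longrightarrow> pair (D F) \<phi> = 0}"

lemma ZD: "F \<in> Z \<Longrightarrow> balanced \<phi> \<Longrightarrow> pair (D F) \<phi> = 0"
  by (simp add: Z_def)

lemma subspace_Z: "free.subspace Z"
  by (rule free.subspaceI) (auto simp: Z_def D_linear pair_linear)

lemma homog_0_Z: "F \<in> homog 0 \<Longrightarrow> F \<in> Z"
  by (simp add: Z_def D_homog_0 pair_linear)

lemma D_Z: "D F \<in> Z"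
  by (simp add: Z_def D_D pair_linear)

text \<open>In each term of the Leibniz rule, the boundary of one factor is paired with a cochain
  that is balanced once the word of the other factor is fixed.\<close>

lemma shuffle_Z:
  assumes "F \<in> Z" "G \<in> Z"
  shows "shuffle F G \<in> Z"
  using ZD[OF assms(1) balanced_shE_left] ZD[OF assms(2) balanced_shE_right]
  by (simp add: Z_def pair_D_shuffle)

text \<open>A boundary times a cycle is a boundary: in the Leibniz rule the term with the boundary
  of G disappears.\<close>

lemma pair_shuffle_D_left:
  assumes "G \<in> Z" "balanced \<phi>"
  shows "pair (shuffle (D F) G) \<phi> = pair (D (shuffle F G)) \<phi>"
  using ZD[OF assms(1) balanced_shE_right[OF assms(2)]]
  by (simp add: pair_D_shuffle pair_shuffle) (rule pair_swap)

text \<open>For homogeneous F the sign of the Leibniz rule is constant and can be moved into the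
  chain that is bounded.\<close>

lemma pair_shuffle_D_right:
  assumes "F \<in> Z" "F \<in> homog p" "balanced \<phi>"
  shows "pair (shuffle F (D G)) \<phi> = pair (D (alt p (shuffle F G))) \<phi>"
proof -
  have "pair (D (shuffle F G)) \<phi> = pair F (\<lambda>a us. alt p (pair (D G) (\<lambda>c ws. shE us ws (\<phi> (a * c)))))"
    using ZD[OF assms(1) balanced_shE_left[OF assms(3)]]
    by (simp add: pair_D_shuffle) (rule pair_homog_cong[OF assms(2)], simp)
  moreover have "D (alt p E) = alt p (D E)" "pair (alt p E) \<phi> = alt p (pair E \<phi>)" for E
    by (rule additive_facts(4), simp add: D_linear pair_linear)+
  ultimately show ?thesis by (simp add: pair_shuffle pair_alt_fun)
qed

section \<open>Families of cochains and decomposition by word length\<close>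

lemma balanced_lext:
  assumes "\<And>g. balanced (\<phi> g)"
  shows "balanced (\<lambda>a us. lext (*) (\<lambda>g. \<phi> g a us) G)"
  unfolding balanced_def
  by (simp add: balancedD[OF assms] field_vs.lext_add_fun field_vs.lext_scale_fun)

lemma balanced_pair:
  assumes "\<And>a us. balanced (\<phi> a us)"
  shows "balanced (\<lambda>b vs. pair G (\<lambda>a us. \<phi> a us b vs))"
  unfolding pair_def by (intro balanced_lext assms)

text \<open>The balancing laws only relate words of equal length, so a cochain may be replaced by
  zero on all words of unwanted lengths.\<close>

lemma balanced_truncate:
  assumes "balanced \<phi>"
  shows "balanced (\<lambda>a us. if P (length us) then \<phi> a us else 0)"
  unfolding balanced_def by (simp add: balancedD[OF assms])

definition comp :: "nat \<Rightarrow> ('a \<times> 'u list \<Rightarrow>\<^sub>0 'k) \<Rightarrow> ('a \<times> 'u list \<Rightarrow>\<^sub>0 'k)" where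
  "comp n F = lext fscale (\<lambda>g. if length (snd g) = n then fsingle g else 0) F"

lemma linear_comp: "Vector_Spaces.linear fscale fscale (comp n)"
  unfolding comp_def[abs_def] by (rule free_vs.linear_lext)

lemmas comp_linear = linear_facts[OF linear_comp]

lemma pair_comp: "pair (comp n F) \<phi> = pair F (\<lambda>a us. if length us = n then \<phi> a us else 0)"
  unfolding comp_def pair_lext unfolding pair_def by (rule lext_cong) (simp add: field_vs.lext_linear_facts)

lemma comp_homog [simp]: "comp n F \<in> homog n"
  unfolding comp_def
  by (intro free_vs.lext_mem[OF subspace_homog]) (auto simp: homog_closed(1) homog_def)

lemma comp_of_homog:
  assumes "F \<in> homog m"
  shows "comp n F = (if n = m then F else 0)"
  by (rule pair_eqI) (auto simp: pair_comp pair_linear intro!: pair_homog_cong[OF assms]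
      pair_homog_cong[OF assms, where \<psi> = "\<lambda>_ _. 0", simplified])

text \<open>Pairing the boundary of a component with a cochain is pairing the whole boundary with
  the cochain truncated to words shorter by one.\<close>

lemma comp_Z:
  assumes "F \<in> Z"
  shows "comp n F \<in> Z"
proof -
  have "pair (D (comp n F)) \<phi> = 0" if "balanced \<phi>" for \<phi>
  proof -
    \<comment> \<open>The condition \<open>Suc (length ws) = n\<close> makes the truncated cochain
      zero for n = 0, where \<open>n - 1\<close> would select the words of length 0.\<close>
    have "(if length us = n then dE a us \<phi> else 0) =
      dE a us (\<lambda>b ws. if Suc (length ws) = n then \<phi> b ws else 0)" for a us
    proof (cases "length us = n")
      case True
      then show ?thesis by (auto intro!: dE_cong)
    next
      case False
      then have "dE a us (\<lambda>b ws. if Suc (length ws) = n then \<phi> b ws else 0) = dE a us (\<lambda>b ws. 0)"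
        by (intro dE_cong) auto
      also have "\<dots> = 0" using dE_add[of a us "\<lambda>_ _. 0" "\<lambda>_ _. 0"] by simp
      finally show ?thesis using False by simp
    qed
    then have "pair (D (comp n F)) \<phi> = pair (D F) (\<lambda>b ws. if Suc (length ws) = n then \<phi> b ws else 0)"
      by (simp add: pair_D pair_comp)
    then show ?thesis using ZD[OF assms balanced_truncate[OF that, of "\<lambda>m. Suc m = n"]] by simp
  qed
  then show ?thesis by (simp add: Z_def)
qed

lemma comp_shuffle:
  "comp n (shuffle F G) = (\<Sum>p\<le>n. shuffle (comp p F) (comp (n - p) G))"
proof (rule pair_eqI)
  fix \<phi>
  have "(\<Sum>p\<le>n. pair (shuffle (comp p F) (comp (n - p) G)) \<phi>) =
    pair F (\<lambda>a us. pair G (\<lambda>b vs. \<Sum>p\<le>n.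
      if length us = p then if length vs = n - p then shE us vs (\<phi> (a * b)) else 0 else 0))"
    unfolding pair_sum_fun pair_shuffle pair_comp by (intro sum.cong refl pair_cong) simp
  also have "\<dots> = pair (comp n (shuffle F G)) \<phi>"
    unfolding pair_comp pair_shuffle
  proof (intro pair_cong)
    fix a us b vs
    have "shE us vs (\<lambda>w. if length w = n then \<phi> (a * b) w else 0) =
      shE us vs (\<lambda>w. if length us + length vs = n then \<phi> (a * b) w else 0)"
      by (rule shE_cong) simp
    then show "(\<Sum>p\<le>n. if length us = p then if length vs = n - p then shE us vs (\<phi> (a * b)) else 0 else 0) =
      shE us vs (\<lambda>w. if length w = n then \<phi> (a * b) w else 0)"
      by (cases "length us + length vs = n") auto
  qed
  finally show "pair (comp n (shuffle F G)) \<phi> = pair (\<Sum>p\<le>n. shuffle (comp p F) (comp (n - p) G)) \<phi>"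
    by (simp add: pair_linear)
qed

end

section \<open>Chains of a commutative Hopf algebroid\<close>

lemma linear_if_Vect:
  assumes "f \<in> Vect (type_algebra s) (type_algebra s')" "vector_space s" "vector_space s'"
  shows "Vector_Spaces.linear s s' f"
  using assms by (intro linearI) (auto simp: Vect_def type_algebra_def)

lemma k_algebra_type_algebraD:
  assumes "k_algebra (type_algebra s)"
  shows "vector_space s" "s c x * y = s c (x * y)"
proof -
  show "vector_space s"
    by (rule vector_space_if_k_module[of "type_algebra s"])
      (use assms in \<open>simp_all add: k_algebra_def type_algebra_def\<close>)
  have "(c \<odot>\<^bsub>type_algebra s\<^esub> x) \<otimes>\<^bsub>type_algebra s\<^esub> y = c \<odot>\<^bsub>type_algebra s\<^esub> (x \<otimes>\<^bsub>type_algebra s\<^esub> y)"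
    using assms unfolding k_algebra_def by (simp add: type_algebra_def)
  then show "s c x * y = s c (x * y)" by (simp add: type_algebra_def)
qed

locale comm_hopf =
  fixes H :: "('k::field, 'a::{ring,monoid_mult}, 'u::{ring,monoid_mult}) hopf"
  assumes comm_hopf: "commutative_hopf_algebroid H"
begin

lemma hopf_facts:
  "k_algebra (algA H)" "k_algebra (algU H)" "tL H \<in> Vect (algA H) (algU H)" "tL H 1 = 1"
  "tL H (a * b) = tL H b * tL H a" "sL H 1 = 1"
  "epsL H \<in> Vect (algU H) (algA H)" "epsL H (sL H a * tL H b * u) = a * epsL H u * b"
  "epsL H (u * sL H (epsL H v)) = epsL H (u * v)"
  "antipode H \<in> Vect (algU H) (algU H)" "antipode H (u * v) = antipode H v * antipode H u"
  "antipode H (antipode H u) = u" "antipode H (tL H a) = sL H a"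
  "a * b = b * a" "u * v = v * u"
proof -
  note c = comm_hopf[unfolded commutative_hopf_algebroid_def hopf_algebroid_def left_bialgebroid_def]
  have "\<forall>a b. tL H (a * b) = tL H b * tL H a" by (insert c, elim conjE, assumption)
  then show "tL H (a * b) = tL H b * tL H a" by blast
  have "\<forall>a b u. epsL H (sL H a * tL H b * u) = a * epsL H u * b" by (insert c, elim conjE, assumption)
  then show "epsL H (sL H a * tL H b * u) = a * epsL H u * b" by blast
  have "\<forall>u v. epsL H (u * sL H (epsL H v)) = epsL H (u * v) \<and> epsL H (u * tL H (epsL H v)) = epsL H (u * v)"
    by (insert c, elim conjE, assumption)
  then show "epsL H (u * sL H (epsL H v)) = epsL H (u * v)" by blast
  have "\<forall>u v. antipode H (u * v) = antipode H v * antipode H u" by (insert c, elim conjE, assumption)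
  then show "antipode H (u * v) = antipode H v * antipode H u" by blast
  have "\<forall>u. antipode H (antipode H u) = u" by (insert c, elim conjE, assumption)
  then show "antipode H (antipode H u) = u" by blast
  have "\<forall>a. antipode H (tL H a) = sL H a" by (insert c, elim conjE, assumption)
  then show "antipode H (tL H a) = sL H a" by blast
  have "\<forall>a b :: 'a. a * b = b * a" "\<forall>u v :: 'u. u * v = v * u" by (insert c, elim conjE, assumption)+
  then show "a * b = b * a" "u * v = v * u" by blast+
  show "k_algebra (algA H)" "k_algebra (algU H)" "tL H \<in> Vect (algA H) (algU H)" "tL H 1 = 1"
    "sL H 1 = 1" "epsL H \<in> Vect (algU H) (algA H)" "antipode H \<in> Vect (algU H) (algU H)"
    by (insert c, elim conjE, assumption)+
qed

text \<open>The first augmentation is the counit composed with S, the second the counit composed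
  with S twice, which is the counit itself. Linearity over A of the first comes from that over the
  source map, as S exchanges target and source.\<close>

sublocale bar "scaleA H" "scaleU H" "tL H" "epsR H" "\<lambda>u. epsR H (antipode H u)"
proof (rule bar.intro)
  note A = k_algebra_type_algebraD[OF hopf_facts(1)] and U = k_algebra_type_algebraD[OF hopf_facts(2)]
  show "vector_space (scaleA H)" "vector_space (scaleU H)" by (rule A U)+
  show "scaleA H c a * b = scaleA H c (a * b)" for c a b by (rule A)
  show "scaleU H c a * b = scaleU H c (a * b)" for c a b by (rule U)
  show cA: "a * b = b * a" for a b :: 'a by (rule hopf_facts)
  show cU: "u * v = v * u" for u v :: 'u by (rule hopf_facts)
  show "Vector_Spaces.linear (scaleA H) (scaleU H) (tL H)"
    by (intro linear_if_Vect hopf_facts A U)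
  show "tL H 1 = 1" by (rule hopf_facts)
  show "tL H (a * b) = tL H a * tL H b" for a b by (simp add: hopf_facts(5) cU)
  have S: "Vector_Spaces.linear (scaleU H) (scaleU H) (antipode H)"
    and E: "Vector_Spaces.linear (scaleU H) (scaleA H) (epsL H)"
    by (intro linear_if_Vect hopf_facts A U)+
  show "Vector_Spaces.linear (scaleU H) (scaleA H) (epsR H)"
    by (rule linearI) (simp_all add: A U epsR_def linear_facts[OF S] linear_facts[OF E])
  show "Vector_Spaces.linear (scaleU H) (scaleA H) (\<lambda>u. epsR H (antipode H u))"
    by (rule linearI) (simp_all add: A U epsR_def linear_facts[OF S] linear_facts[OF E])
  have eps_s: "epsL H (sL H a * u) = a * epsL H u" for a u
    using hopf_facts(8)[of a 1 u] by (simp add: hopf_facts(4))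
  have eps_t: "epsL H (tL H a * u) = a * epsL H u" for a u
    using hopf_facts(8)[of 1 a u] by (simp add: hopf_facts(6) cA)
  \<comment> \<open>Replacing v by the source of its counit does not change the left side, and
    linearity over the source map then extracts that factor.\<close>
  have eps_mult: "epsL H (u * v) = epsL H u * epsL H v" for u v
    using eps_s[of "epsL H v" u] hopf_facts(9)[of u v] by (simp add: cU[of u] cA)
  show "epsR H (u * v) = epsR H u * epsR H v" for u v
    by (simp add: epsR_def hopf_facts(11) eps_mult cA)
  show "epsR H (antipode H (u * v)) = epsR H (antipode H u) * epsR H (antipode H v)" for u v
    by (simp add: epsR_def hopf_facts(12) eps_mult)
  show "epsR H (tL H a * u) = a * epsR H u" for a u
    by (simp add: epsR_def hopf_facts(11,13) cU[of _ "sL H a"] eps_s)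
  show "epsR H (antipode H (tL H a * u)) = a * epsR H (antipode H u)" for a u
    by (simp add: epsR_def hopf_facts(12) eps_t)
qed

section \<open>From words with a coefficient to tensors over A\<close>

abbreviation multilinear_r :: "nat \<Rightarrow> ('u list \<Rightarrow> 'k) \<Rightarrow> bool" where
  "multilinear_r \<equiv> multilinear (scaleU H) (\<lambda>a u. u * sR H a) (\<lambda>a u. sR H a * u)"

abbreviation rcoset :: "nat \<Rightarrow> ('u list \<Rightarrow>\<^sub>0 'k) \<Rightarrow> ('u list \<Rightarrow>\<^sub>0 'k) set" where
  "rcoset \<equiv> tcoset (scaleU H) (\<lambda>a u. u * sR H a) (\<lambda>a u. sR H a * u)"

text \<open>Meaningful only for nonempty words, as the head of the empty list is
  unspecified.\<close>

definition absorb :: "'a \<Rightarrow> 'u list \<Rightarrow> 'u list" where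
  "absorb a us = (tL H a * hd us) # tl us"

definition rho :: "('a \<times> 'u list \<Rightarrow>\<^sub>0 'k) \<Rightarrow> ('u list \<Rightarrow>\<^sub>0 'k)" where
  "rho F = lext fscale (\<lambda>g. fsingle (absorb (fst g) (snd g))) F"

text \<open>
  The word \<open>(a, us)\<close> stands for \<open>t(a) u\<^sub>1 \<otimes> \<dots> \<otimes> u\<^sub>n\<close> and for \<open>a\<close> if \<open>n = 0\<close>; this treats the
  chains of degree \<open>0\<close> like the others.
\<close>

definition chain_of :: "nat \<Rightarrow> ('a \<times> 'u list \<Rightarrow>\<^sub>0 'k) \<Rightarrow> ('k, 'a, 'u) chain" where
  "chain_of n F = (if n = 0 then Inl (lext (scaleA H) fst F) else Inr (rcoset n (rho F)))"

lemma absorb_1: "us \<noteq> [] \<Longrightarrow> absorb 1 us = us"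
  by (simp add: absorb_def t_1)

lemma balanced_absorb:
  assumes "balanced \<phi>" "us \<noteq> []"
  shows "\<phi> b (absorb a us) = \<phi> (b * a) us"
  using assms(2) by (cases us) (simp_all add: absorb_def balanced_hd(3)[OF assms(1)])

text \<open>A factor \<open>tL H b\<close> passes from either of two neighbours into the same
  coefficient, so it may be exchanged between them.\<close>

lemma balanced_multilinear:
  assumes "balanced \<phi>"
  shows "multilinear_r n (\<phi> a)"
  unfolding multilinear_def sR_def
proof (intro conjI allI impI)
  fix xs b u v ys
  show "\<phi> a (xs @ u * tL H b # v # ys) = \<phi> a (xs @ u # tL H b * v # ys)"
    using balancedD(5)[OF assms, of a xs b u "v # ys"] balancedD(5)[OF assms, of a "xs @ [u]" b v ys]
    by (simp add: comm_U)
qed (rule balancedD[OF assms])+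

lemma rho_fsingle: "rho (fsingle (a, us)) = fsingle (absorb a us)"
  by (simp add: rho_def)

lemma linear_rho: "Vector_Spaces.linear fscale fscale rho"
  unfolding rho_def[abs_def] by (rule free_vs.linear_lext)

lemma rho_words: "F \<in> homog n \<Longrightarrow> n > 0 \<Longrightarrow> rho F \<in> words n"
  unfolding rho_def
  by (intro free_vs.lext_mem[OF subspace_words])
    (auto simp: absorb_def dest!: homog_keys)

lemma lext_rho:
  assumes "F \<in> homog n" "n > 0" "balanced \<phi>"
  shows "lext (*) (\<phi> b) (rho F) = pair F (\<lambda>a. \<phi> (b * a))"
proof -
  have "lext (*) (\<phi> b) (rho F) = pair F (\<lambda>a us. \<phi> b (absorb a us))"
    unfolding rho_def pair_def by (subst free_vs.linear_lext_comp[OF field_vs.linear_lext]) simp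
  also have "\<dots> = pair F (\<lambda>a. \<phi> (b * a))"
    using assms by (intro pair_homog_cong[OF assms(1)] balanced_absorb) auto
  finally show ?thesis .
qed

text \<open>The tensor relations move a ring element between neighbours only; it is carried to a
  distant letter on the left through all letters in between.\<close>

lemma multilinear_move:
  assumes "multilinear_r n \<phi>" "length ws + length xs + length ys + 2 = n"
  shows "\<phi> (ws @ x # xs @ (tL H b * u) # ys) = \<phi> (ws @ (tL H b * x) # xs @ u # ys)"
proof -
  have step: "\<phi> (xs @ (tL H b * u) # v # ys) = \<phi> (xs @ u # (tL H b * v) # ys)"
    if "length xs + 2 + length ys = n" for xs ys u v
    using assms(1) that by (simp add: multilinear_def sR_def comm_U)
  show ?thesis using assms(2)
  proof (induction xs arbitrary: ws x)
    case Nil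
    then show ?case using step[of ws ys x u] by simp
  next
    case (Cons y xs)
    then show ?case using step[of ws "xs @ u # ys" x y] Cons.IH[of "ws @ [x]" y] by simp
  qed
qed

text \<open>A linear form on the tensors of one positive degree becomes a cochain by zero in the
  other degrees. The first letter absorbs the coefficient, and an element of A at any other letter
  is carried to it by \<open>multilinear_move\<close>.\<close>

lemma balanced_if_multilinear:
  assumes \<phi>: "multilinear_r n \<phi>" and n: "n > 0"
  shows "balanced (\<lambda>a us. if length us = n then \<phi> (absorb a us) else 0)"
proof -
  have add: "\<phi> (xs @ (u + v) # ys) = \<phi> (xs @ u # ys) + \<phi> (xs @ v # ys)"
    if "length xs + 1 + length ys = n" for xs u v ys
    using \<phi> that unfolding multilinear_def by blast
  have scale: "\<phi> (xs @ scaleU H c u # ys) = c * \<phi> (xs @ u # ys)"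
    if "length xs + 1 + length ys = n" for xs c u ys
    using \<phi> that unfolding multilinear_def by blast
  note hd = add[of "[]", simplified] scale[of "[]", simplified] and
    tl = add[of "_ # _", simplified] scale[of "_ # _", simplified] and
    move = multilinear_move[OF \<phi>, of "[]", simplified]
  show ?thesis unfolding balanced_def
  proof (intro conjI allI)
    fix a b us
    show "(if length us = n then \<phi> (absorb (a + b) us) else 0) =
      (if length us = n then \<phi> (absorb a us) else 0) + (if length us = n then \<phi> (absorb b us) else 0)"
      using n by (cases us) (auto simp: absorb_def linear_facts[OF t_linear] distrib_right hd)
  next
    fix c a us
    show "(if length us = n then \<phi> (absorb (scaleA H c a) us) else 0) =
      c * (if length us = n then \<phi> (absorb a us) else 0)"
      using n by (cases us) (auto simp: absorb_def linear_facts[OF t_linear] scU_mult hd)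
  next
    fix a xs u v ys
    show "(if length (xs @ (u + v) # ys) = n then \<phi> (absorb a (xs @ (u + v) # ys)) else 0) =
      (if length (xs @ u # ys) = n then \<phi> (absorb a (xs @ u # ys)) else 0) +
      (if length (xs @ v # ys) = n then \<phi> (absorb a (xs @ v # ys)) else 0)"
      by (cases xs) (auto simp: absorb_def distrib_left hd tl)
  next
    fix a c xs u ys
    show "(if length (xs @ scaleU H c u # ys) = n then \<phi> (absorb a (xs @ scaleU H c u # ys)) else 0) =
      c * (if length (xs @ u # ys) = n then \<phi> (absorb a (xs @ u # ys)) else 0)"
      by (cases xs) (auto simp: absorb_def scU_mult_right hd tl)
  next
    fix a b xs u ys
    show "(if length (xs @ (tL H b * u) # ys) = n then \<phi> (absorb a (xs @ (tL H b * u) # ys)) else 0) =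
      (if length (xs @ u # ys) = n then \<phi> (absorb (a * b) (xs @ u # ys)) else 0)"
      by (cases xs) (auto simp: absorb_def t_mult mult.assoc move left_comm_U)
  qed
qed

text \<open>The counterpart in degree 0: a linear form on A, extended by zero to nonempty
  words.\<close>

lemma balanced_if_linear:
  assumes "Vector_Spaces.linear (scaleA H) (*) l"
  shows "balanced (\<lambda>a us. if us = [] then l a else 0)"
  unfolding balanced_def by (simp add: linear_facts[OF assms])

abbreviation cochains :: "(('a \<times> 'u list \<Rightarrow>\<^sub>0 'k) \<Rightarrow> 'k) set" where
  "cochains \<equiv> {\<lambda>F. pair F \<phi> | \<phi>. balanced \<phi>}"

lemma vspace_A: "vspace (scaleA H)" and vspace_U: "vspace (scaleU H)"
  using vsA vsU by (simp_all add: vspace_def)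

lemma linear_of_homog_0:
  assumes "F \<in> homog 0" "Vector_Spaces.linear (scaleA H) (*) l"
  shows "l (lext (scaleA H) fst F) = pair F (\<lambda>a us. l a)"
  using vspace.linear_lext_comp[OF vspace_A assms(2), of fst F] by (simp add: pair_def)

lemma rpow_presentation:
  "presentation fscale (words n) (rcoset n) (rpow H n) {lext (*) \<phi> | \<phi>. multilinear_r n \<phi>}"
  unfolding rpow_def by (rule presentationI[OF presents_tensor_power])

text \<open>Balanced cochains detect zero since they include the linear forms on the chains of each
  degree, extended by zero to all other degrees.\<close>

lemma presents_chains: "presents fscale (homog n) (chain_of n) (chains H n) cochains"
proof (cases "n = 0")
  case True
  interpret A: presentation "scaleA H" UNIV "\<lambda>x. x" "algA H" "{l. Vector_Spaces.linear (scaleA H) (*) l}"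
    by (intro presentationI presents_type_algebra vsA)
  have "presents fscale (homog 0) (\<lambda>F. lext (scaleA H) fst F) (algA H) cochains"
  proof (rule A.presents_comp[OF free.vector_space_axioms A.linear_lext subspace_homog])
    have "a = lext (scaleA H) fst (fsingle (a, []))" for a by (simp add: A.lext_fsingle)
    then show "lext (scaleA H) fst ` homog 0 = UNIV" by (metis UNIV_eq_I fsingle_homog imageI list.size(3))
    show "Vector_Spaces.linear fscale (*) l" if "l \<in> cochains" for l
      using that linear_pair by auto
    fix F assume F: "F \<in> homog 0" "\<And>l. l \<in> cochains \<Longrightarrow> l F = 0"
    show "lext (scaleA H) fst F = \<zero>\<^bsub>algA H\<^esub>"
    proof (rule A.separation)
      fix l assume "l \<in> {l. Vector_Spaces.linear (scaleA H) (*) l}"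
      then have l: "Vector_Spaces.linear (scaleA H) (*) l" by simp
      have "pair F (\<lambda>a us. if us = [] then l a else 0) = 0"
        using F(2) balanced_if_linear[OF l] by auto
      then show "l (lext (scaleA H) fst F) = 0"
        unfolding linear_of_homog_0[OF F(1) l]
        by (subst (asm) pair_homog_cong[OF F(1), where \<psi> = "\<lambda>a us. l a"]) auto
    qed simp
  qed
  then interpret C: presentation fscale "homog 0" "\<lambda>F. lext (scaleA H) fst F" "algA H" cochains
    by (rule presentationI)
  show ?thesis
    using C.presents_copy[of projl "Inl :: 'a \<Rightarrow> ('k, 'a, 'u) chain"]
    by (simp add: True chain_of_def[abs_def] chains_def)
next
  case False
  interpret T: presentation fscale "words n" "rcoset n" "rpow H n" "{lext (*) \<phi> | \<phi>. multilinear_r n \<phi>}"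
    by (rule rpow_presentation)
  have "presents fscale (homog n) (\<lambda>F. rcoset n (rho F)) (rpow H n) cochains"
  proof (rule T.presents_comp[OF free.vector_space_axioms linear_rho subspace_homog])
    show "rho ` homog n = words n"
    proof (intro equalityI subsetI)
      fix G :: "'u list \<Rightarrow>\<^sub>0 'k" assume G: "G \<in> words n"
      \<comment> \<open>A plain word is hit by the same word with coefficient 1.\<close>
      have "rho (lext fscale (\<lambda>us. fsingle (1, us)) G) = lext fscale fsingle G"
        by (subst free_vs.linear_lext_comp[OF linear_rho], rule lext_cong)
          (use G False in \<open>auto simp: rho_fsingle words_def absorb_1 subset_eq simp flip: length_greater_0_conv\<close>)
      moreover have "lext fscale (\<lambda>us. fsingle (1, us)) G \<in> homog n"
        using G by (intro free_vs.lext_mem[OF subspace_homog]) (auto simp: words_def)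
      ultimately show "G \<in> rho ` homog n" by (auto simp: lext_fsingle_self intro!: image_eqI)
    qed (use rho_words False in auto)
    show "Vector_Spaces.linear fscale (*) l" if "l \<in> cochains" for l
      using that linear_pair by auto
    fix F assume F: "F \<in> homog n" "\<And>l. l \<in> cochains \<Longrightarrow> l F = 0"
    show "rcoset n (rho F) = \<zero>\<^bsub>rpow H n\<^esub>"
    proof (rule T.separation)
      show "rho F \<in> words n" using F False by (simp add: rho_words)
      fix l assume "l \<in> {lext (*) \<phi> | \<phi>. multilinear_r n \<phi>}"
      then obtain \<phi> where \<phi>: "l = lext (*) \<phi>" "multilinear_r n \<phi>" by blast
      have "lext (*) \<phi> (rho F) = pair F (\<lambda>a us. \<phi> (absorb a us))"
        unfolding rho_def pair_def by (subst free_vs.linear_lext_comp[OF field_vs.linear_lext]) simp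
      also have "\<dots> = pair F (\<lambda>a us. if length us = n then \<phi> (absorb a us) else 0)"
        by (rule pair_homog_cong[OF F(1)]) simp
      also have "\<dots> = 0"
        using F(2) balanced_if_multilinear[OF \<phi>(2)] False by blast
      finally show "l (rho F) = 0" by (simp add: \<phi>)
    qed
  qed
  then interpret C: presentation fscale "homog n" "\<lambda>F. rcoset n (rho F)" "rpow H n" cochains
    by (rule presentationI)
  show ?thesis
    using C.presents_copy[of projr "Inr :: _ \<Rightarrow> ('k, 'a, 'u) chain"] False
    by (simp add: chain_of_def[abs_def] chains_def)
qed

lemma chains_presentation: "presentation fscale (homog n) (chain_of n) (chains H n) cochains"
  by (rule presentationI[OF presents_chains])

lemma chain_of_eqI:
  assumes "F \<in> homog n" "G \<in> homog n" "\<And>\<phi>. balanced \<phi> \<Longrightarrow> pair F \<phi> = pair G \<phi>"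
  shows "chain_of n F = chain_of n G"
  using presentation.hom_eqI[OF chains_presentation assms(1,2)] assms(3) by blast

text \<open>The converse of separation: every balanced cochain vanishes on representatives of the
  zero chain. This identifies the kernel of \<open>diff\<close> with the cycles in
  \<open>Z\<close>.\<close>

lemma chain_of_zeroD:
  assumes "F \<in> homog n" "chain_of n F = \<zero>\<^bsub>chains H n\<^esub>" "balanced \<phi>"
  shows "pair F \<phi> = 0"
proof (cases "n = 0")
  case True
  have l: "Vector_Spaces.linear (scaleA H) (*) (\<lambda>a. \<phi> a [])"
    by (rule linearI) (simp_all add: vsA balancedD[OF assms(3)])
  have "lext (scaleA H) fst F = 0"
    using assms True by (simp add: chain_of_def chains_def copy_module_def type_algebra_def)
  then have "pair F (\<lambda>a us. \<phi> a []) = 0"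
    using linear_of_homog_0[OF _ l, of F] assms True by (simp add: linear_facts[OF l])
  then show ?thesis using assms True by (subst pair_homog_cong[of F 0 \<phi> "\<lambda>a us. \<phi> a []"]) auto
next
  case False
  have "rcoset n (rho F) = \<zero>\<^bsub>rpow H n\<^esub>"
    using assms False by (simp add: chain_of_def chains_def copy_module_def)
  then have "lext (*) (\<phi> 1) (rho F) = 0"
    using tcoset_zero_iff[OF rho_words[OF assms(1)], of "scaleU H" "\<lambda>a u. u * sR H a" "\<lambda>a u. sR H a * u"] False balanced_multilinear[OF assms(3), of n 1]
    by (simp add: rpow_def)
  then show ?thesis using lext_rho[OF assms(1) _ assms(3), of 1] False by simp
qed

lemma projr_chain_of: "n > 0 \<Longrightarrow> projr (chain_of n F) = rcoset n (rho F)"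
  by (simp add: chain_of_def)

text \<open>A lift from chains is well defined if each functional of the target composed with
  \<open>g\<close> is a balanced cochain at coefficient 1. Coefficient 1 suffices because
  \<open>rho\<close> has absorbed the coefficient.\<close>

lemma tensor_lift_chain_of:
  assumes "presentation sc S h M \<Phi>" "F \<in> homog n" "n > 0"
    and "\<And>us. length us = n \<Longrightarrow> f us = h (g us)" "\<And>us. length us = n \<Longrightarrow> g us \<in> S"
    and bal: "\<And>l. l \<in> \<Phi> \<Longrightarrow> \<exists>\<phi>. balanced \<phi> \<and> (\<forall>us. length us = n \<longrightarrow> l (g us) = \<phi> 1 us)"
  shows "tensor_lift M f (rcoset n (rho F)) = h (lext sc g (rho F))"
proof (rule presentation.tensor_lift_tcoset[OF assms(1) rho_words[OF assms(2,3)] assms(4,5)])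
  fix l assume "l \<in> \<Phi>"
  then obtain \<phi> where \<phi>: "balanced \<phi>" "\<And>us. length us = n \<Longrightarrow> l (g us) = \<phi> 1 us"
    using bal by blast
  show "multilinear_r n (\<lambda>us. l (g us))"
    using balanced_multilinear[OF \<phi>(1), of n 1] by (simp add: multilinear_def \<phi>(2))
qed

lemma lext_rho_words:
  assumes "F \<in> homog n" "n > 0" "balanced \<phi>" "\<And>us. length us = n \<Longrightarrow> f us = \<phi> 1 us"
  shows "lext (*) f (rho F) = pair F \<phi>"
proof -
  have "lext (*) f (rho F) = lext (*) (\<phi> 1) (rho F)"
    using rho_words[OF assms(1,2)] by (intro lext_cong assms(4)) (auto simp: words_def)
  then show ?thesis using lext_rho[OF assms(1-3), of 1] by simp
qed

end

section \<open>Single faces of a word with coefficient\<close>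

context bar
begin

text \<open>The counterpart of \<open>face\<close> in which the two outer faces leave the
  augmentation as a coefficient instead of multiplying it into a letter.\<close>

definition faceE :: "nat \<Rightarrow> 'u list \<Rightarrow> ('a \<Rightarrow> 'u list \<Rightarrow> 'm) \<Rightarrow> 'm" where
  "faceE i us \<phi> =
     (if i = 0 then \<phi> (e1 (hd us)) (tl us)
      else if i < length us then \<phi> 1 (take (i - 1) us @ [us ! (i - 1) * us ! i] @ drop (i + 1) us)
      else \<phi> (e2 (last us)) (butlast us))"

lemma JE_eq_sum_faceE:
  fixes \<phi> :: "'a \<Rightarrow> 'u list \<Rightarrow> 'k"
  shows "JE us \<phi> = (\<Sum>i<length us. (- 1) ^ i * faceE (Suc i) us \<phi>)"
proof (induction us arbitrary: \<phi>)
  case (Cons u w)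
  have "faceE (Suc 0) (u # w) \<phi> = ME u w \<phi>"
    by (cases w) (simp_all add: faceE_def)
  moreover have "faceE (Suc (Suc i)) (u # w) \<phi> = faceE (Suc i) w (\<lambda>b ws. \<phi> b (u # ws))"
    if "i < length w" for i
    using that by (auto simp: faceE_def)
  ultimately show ?case
    by (simp add: Cons.IH sum.lessThan_Suc_shift sum_negf del: sum.lessThan_Suc)
qed simp

lemma sum_faceE:
  fixes \<phi> :: "'a \<Rightarrow> 'u list \<Rightarrow> 'k"
  assumes "us \<noteq> []"
  shows "(\<Sum>i\<le>length us. (- 1) ^ i * faceE i us \<phi>) = dE 1 us \<phi>"
proof -
  have "(\<Sum>i\<le>length us. (- 1) ^ i * faceE i us \<phi>) = \<phi> (e1 (hd us)) (tl us) - JE us \<phi>"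
    by (simp add: lessThan_Suc_atMost[symmetric] sum.lessThan_Suc_shift JE_eq_sum_faceE faceE_def sum_negf
        del: sum.lessThan_Suc)
  then show ?thesis using assms by (cases us) (simp_all add: dE_def)
qed

text \<open>The last face and the product by a degree 0 chain from the left put an element of A at
  the end of the word; for balanced cochains this amounts to putting it into the
  coefficient.\<close>

lemma balanced_last:
  assumes "balanced \<phi>" "us \<noteq> []"
  shows "\<phi> 1 (butlast us @ [last us * t a]) = \<phi> a us"
  using balancedD(5)[OF assms(1), of 1 "butlast us" a "last us" "[]"] assms(2)
  by (simp add: comm_U[of _ "t a"])

end

context comm_hopf
begin

section \<open>The differential and the shuffle product of chains\<close>

lemma face_eq_chain_of:
  assumes "length us = Suc n" "i \<le> Suc n"
  shows "face H i us = chain_of n (faceE i us (\<lambda>b ws. fsingle (b, ws)))"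
proof (cases n)
  case 0
  then obtain u where us: "us = [u]" using assms by (cases us) auto
  show ?thesis by (simp add: us face_def faceE_def chain_of_def 0 vspace.lext_fsingle[OF vspace_A])
next
  case (Suc m)
  have len: "length us = Suc (Suc m)" using assms Suc by simp
  have rt: "Inr (rtens H ws) = chain_of n (fsingle (1, ws))" if "length ws = n" for ws
  proof -
    have "ws \<noteq> []" using that Suc by auto
    then show ?thesis using that Suc
      by (simp add: chain_of_def rtens_def tens_eq_tcoset rho_fsingle absorb_1)
  qed
  show ?thesis
  proof (cases "i < length us")
    case True
    show ?thesis
    proof (cases "i = 0")
      case True
      obtain u v ws where us: "us = u # v # ws" using len by (cases us; cases "tl us") auto
      have "face H i us = Inr (rtens H (absorb (epsR H u) (v # ws)))"
        using True len by (simp add: face_def us absorb_def sR_def)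
      also have "\<dots> = chain_of n (fsingle (epsR H u, v # ws))"
        using len Suc by (simp add: chain_of_def rtens_def tens_eq_tcoset rho_fsingle us absorb_def)
      finally show ?thesis using True by (simp add: faceE_def us)
    next
      case False
      then show ?thesis using True len Suc by (simp add: face_def faceE_def Let_def rt)
    qed
  next
    case False
    then have i: "i = length us" using assms by simp
    let ?e = "epsR H (antipode H (last us))"
    have bl: "butlast us \<noteq> []" "length (butlast us) = n" using len Suc by (auto simp flip: length_greater_0_conv)
    have idx: "take (length us - 2) us = butlast (butlast us)" "us ! (length us - 2) = last (butlast us)"
        "us ! (length us - 1) = last us"
      using len bl by (auto simp: butlast_conv_take last_conv_nth nth_butlast simp flip: length_greater_0_conv)
    have "face H i us = Inr (rtens H (butlast (butlast us) @ [last (butlast us) * tL H ?e]))"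
      using len idx by (simp add: face_def i Let_def sR_def)
    also have "\<dots> = chain_of n (fsingle (1, butlast (butlast us) @ [last (butlast us) * tL H ?e]))"
      using bl Suc by (intro rt) simp
    \<comment> \<open>Only for the last face does the agreement use tensor relations: the
      augmentation at the last remaining letter has to travel to the coefficient.\<close>
    also have "\<dots> = chain_of n (fsingle (?e, butlast us))"
      using bl Suc balanced_last[OF _ bl(1)] by (intro chain_of_eqI) auto
    finally show ?thesis using False len by (simp add: faceE_def i)
  qed
qed

lemma faceE_homog:
  "length us = Suc n \<Longrightarrow> i \<le> Suc n \<Longrightarrow> faceE i us (\<lambda>b ws. fsingle (b, ws)) \<in> homog n"
  by (auto simp: faceE_def)

lemma pair_faceE: "pair (faceE i us (\<lambda>b ws. fsingle (b, ws))) \<phi> = faceE i us \<phi>"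
  by (simp add: faceE_def)

text \<open>The alternating sum of faces, paired with a cochain, is its transposed differential.
  That this is again balanced makes the lift in \<open>diff\<close> well defined.\<close>

lemma diff_chain_of:
  assumes F: "F \<in> homog (Suc n)"
  shows "diff H (Suc n) (chain_of (Suc n) F) = chain_of n (D F)"
proof -
  interpret C: presentation fscale "homog n" "chain_of n" "chains H n" cochains by (rule chains_presentation)
  let ?g = "\<lambda>us. \<Sum>i\<le>Suc n. fscale ((- 1) ^ i) (faceE i us (\<lambda>b ws. fsingle (b, ws)))"
  have g: "?g us \<in> homog n" if "length us = Suc n" for us
    using that faceE_homog by (intro homog_closed(5) homog_closed(4)) auto
  have pg: "pair (?g us) \<phi> = dE 1 us \<phi>" if "length us = Suc n" for us and \<phi> :: "'a \<Rightarrow> 'u list \<Rightarrow> 'k"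
    using that sum_faceE[of us \<phi>] length_greater_0_conv[of us] by (auto simp: pair_linear pair_faceE simp del: sum.atMost_Suc)
  have f: "(\<Oplus>\<^bsub>chains H n\<^esub>i\<in>{..Suc n}. (- 1) ^ i \<odot>\<^bsub>chains H n\<^esub> face H i us) = chain_of n (?g us)"
    if "length us = Suc n" for us
  proof -
    have "(\<Oplus>\<^bsub>chains H n\<^esub>i\<in>{..Suc n}. (- 1) ^ i \<odot>\<^bsub>chains H n\<^esub> face H i us) =
      (\<Oplus>\<^bsub>chains H n\<^esub>i\<in>{..Suc n}. chain_of n (fscale ((- 1) ^ i) (faceE i us (\<lambda>b ws. fsingle (b, ws)))))"
    proof -
      interpret abelian_group "chains H n" by (rule C.abelian_group)
      have "(- 1) ^ i \<odot>\<^bsub>chains H n\<^esub> face H i us =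
          chain_of n (fscale ((- 1) ^ i) (faceE i us (\<lambda>b ws. fsingle (b, ws))))" if "i \<in> {..Suc n}" for i
        using that \<open>length us = Suc n\<close> by (simp add: face_eq_chain_of C.hom_scale faceE_homog)
      then show ?thesis using that
        by (intro finsum_cong' refl) (auto intro!: C.hom_closed homog_closed(4) faceE_homog)
    qed
    also have "\<dots> = chain_of n (?g us)"
      using that faceE_homog by (intro C.hom_sum homog_closed(4)) auto
    finally show ?thesis .
  qed
  have "diff H (Suc n) (chain_of (Suc n) F) = chain_of n (lext fscale ?g (rho F))"
    unfolding diff_def projr_chain_of[OF zero_less_Suc] diff_Suc_1
  proof (rule tensor_lift_chain_of[OF chains_presentation F zero_less_Suc f g])
    fix l assume "l \<in> cochains"
    then obtain \<phi> where \<phi>: "l = (\<lambda>F. pair F \<phi>)" "balanced \<phi>" by blast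
    then show "\<exists>\<psi>. balanced \<psi> \<and> (\<forall>us. length us = Suc n \<longrightarrow> l (?g us) = \<psi> 1 us)"
      using pg balanced_dE[OF \<phi>(2)] by (intro exI[of _ "\<lambda>a us. dE a us \<phi>"]) blast
  qed
  also have "\<dots> = chain_of n (D F)"
  proof (rule chain_of_eqI)
    show "lext fscale ?g (rho F) \<in> homog n"
      using rho_words[OF F] by (intro free_vs.lext_mem[OF subspace_homog] g) (auto simp: words_def)
    show "D F \<in> homog n" by (rule D_homog[OF F])
    fix \<phi> :: "'a \<Rightarrow> 'u list \<Rightarrow> 'k" assume \<phi>: "balanced \<phi>"
    show "pair (lext fscale ?g (rho F)) \<phi> = pair (D F) \<phi>"
      unfolding pair_lext pair_D by (rule lext_rho_words[OF F zero_less_Suc balanced_dE[OF \<phi>] pg])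
  qed
  finally show ?thesis .
qed

lemma shuffle_sum_chain_of:
  assumes "length us = p" "length vs = q" "p + q > 0"
  defines "g \<equiv> \<Sum>\<sigma>\<in>shuffle_perms p q. fscale (of_int (sign \<sigma>))
    (fsingle (1, map (\<lambda>i. (us @ vs) ! inv_into UNIV \<sigma> i) [0..<p + q]))"
  shows "(\<Oplus>\<^bsub>chains H (p + q)\<^esub>\<sigma>\<in>shuffle_perms p q.
      of_int (sign \<sigma>) \<odot>\<^bsub>chains H (p + q)\<^esub>
        Inr (rtens H (map (\<lambda>i. (us @ vs) ! (inv_into UNIV \<sigma> i)) [0..<p + q]))) = chain_of (p + q) g"
    and "g \<in> homog (p + q)" and "pair g \<phi> = shE us vs (\<phi> 1)"
proof -
  interpret C: presentation fscale "homog (p + q)" "chain_of (p + q)" "chains H (p + q)" cochains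
    by (rule chains_presentation)
  interpret abelian_group "chains H (p + q)" by (rule C.abelian_group)
  let ?w = "\<lambda>\<sigma>. map (\<lambda>i. (us @ vs) ! inv_into UNIV \<sigma> i) [0..<p + q]"
  have mem: "fscale c (fsingle (1, ?w \<sigma>)) \<in> homog (p + q)" for \<sigma> c
    by (rule homog_closed(4)) simp
  then show "g \<in> homog (p + q)" unfolding g_def by (intro homog_closed(5))
  have rt: "Inr (rtens H (?w \<sigma>)) = chain_of (p + q) (fsingle (1, ?w \<sigma>))" for \<sigma>
    using assms(3) absorb_1[of "?w \<sigma>"]
    by (auto simp: chain_of_def rtens_def tens_eq_tcoset rho_fsingle simp del: upt_Suc)
  have eq: "of_int (sign \<sigma>) \<odot>\<^bsub>chains H (p + q)\<^esub> Inr (rtens H (?w \<sigma>)) =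
      chain_of (p + q) (fscale (of_int (sign \<sigma>)) (fsingle (1, ?w \<sigma>)))" for \<sigma>
    by (simp add: rt C.hom_scale)
  have "(\<Oplus>\<^bsub>chains H (p + q)\<^esub>\<sigma>\<in>shuffle_perms p q. of_int (sign \<sigma>) \<odot>\<^bsub>chains H (p + q)\<^esub> Inr (rtens H (?w \<sigma>))) =
    (\<Oplus>\<^bsub>chains H (p + q)\<^esub>\<sigma>\<in>shuffle_perms p q. chain_of (p + q) (fscale (of_int (sign \<sigma>)) (fsingle (1, ?w \<sigma>))))"
    using mem eq by (intro finsum_cong' refl) (auto intro!: C.hom_closed)
  also have "\<dots> = chain_of (p + q) g"
    unfolding g_def using mem by (intro C.hom_sum finite_shuffle_perms)
  finally show "(\<Oplus>\<^bsub>chains H (p + q)\<^esub>\<sigma>\<in>shuffle_perms p q. of_int (sign \<sigma>) \<odot>\<^bsub>chains H (p + q)\<^esub>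
      Inr (rtens H (?w \<sigma>))) = chain_of (p + q) g" .
  show "pair g \<phi> = shE us vs (\<phi> 1)"
    unfolding g_def pair_linear pair_fsingle by (rule sum_shuffle_perms_eq_shE[OF assms(1,2)])
qed

lemma linear_mult_left: "Vector_Spaces.linear (scaleA H) (scaleA H) (\<lambda>b. a * b)"
  by (intro linearI vsA) (simp_all add: distrib_left scA_mult_right)

lemma sh_chain_of_0_0:
  assumes "F \<in> homog 0" "G \<in> homog 0"
  shows "sh H 0 0 (chain_of 0 F) (chain_of 0 G) = chain_of 0 (shuffle F G)"
proof -
  have A: "Vector_Spaces.linear fscale (scaleA H) (lext (scaleA H) fst)"
    by (rule vspace.linear_lext[OF vspace_A])
  have "lext (scaleA H) fst (shuffle F G) =
    lext (scaleA H) (\<lambda>g. lext (scaleA H) (\<lambda>h. lext (scaleA H) fst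
      (shE (snd g) (snd h) (\<lambda>w. fsingle (fst g * fst h, w)))) G) F"
    unfolding shuffle_def by (simp add: free_vs.linear_lext_comp[OF A])
  also have "\<dots> = lext (scaleA H) (\<lambda>g. lext (scaleA H) (\<lambda>h. fst g * fst h) G) F"
    using assms by (intro lext_cong) (force simp: homog_def vspace.lext_fsingle[OF vspace_A])
  also have "\<dots> = lext (scaleA H) (\<lambda>g. fst g * lext (scaleA H) fst G) F"
    by (simp add: vspace.linear_lext_comp[OF vspace_A linear_mult_left])
  also have "\<dots> = lext (scaleA H) fst F * lext (scaleA H) fst G"
    unfolding comm_A[of _ "lext (scaleA H) fst G"]
    by (simp add: vspace.linear_lext_comp[OF vspace_A linear_mult_left])
  finally show ?thesis by (simp add: sh_def chain_of_def)
qed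

lemma pair_homog_0_mult:
  assumes "G \<in> homog 0" "balanced \<phi>"
  shows "pair G (\<lambda>b vs. \<phi> (a * b) us) = \<phi> (a * lext (scaleA H) fst G) us"
proof -
  have l: "Vector_Spaces.linear (scaleA H) (*) (\<lambda>b. \<phi> (a * b) us)"
    by (rule linearI) (simp_all add: vsA balancedD[OF assms(2)] distrib_left scA_mult_right)
  show ?thesis using linear_of_homog_0[OF assms(1) l] by simp
qed

text \<open>Covers both mixed cases of the shuffle product, where a chain of degree 0 only changes
  the coefficient.\<close>

lemma tensor_lift_coefficient:
  assumes F: "F \<in> homog n" "n > 0"
    and f: "\<And>us. length us = n \<Longrightarrow> f us = chain_of n (fsingle (a, us))"
    and G: "G \<in> homog n" "\<And>\<phi>. balanced \<phi> \<Longrightarrow> pair G \<phi> = pair F (\<lambda>b. \<phi> (a * b))"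
  shows "tensor_lift (chains H n) f (rcoset n (rho F)) = chain_of n G"
proof -
  let ?g = "\<lambda>us. fsingle (a, us)"
  have "tensor_lift (chains H n) f (rcoset n (rho F)) = chain_of n (lext fscale ?g (rho F))"
  proof (rule tensor_lift_chain_of[OF chains_presentation F f])
    fix l assume "l \<in> cochains"
    then obtain \<phi> where \<phi>: "l = (\<lambda>F. pair F \<phi>)" "balanced \<phi>" by blast
    then show "\<exists>\<psi>. balanced \<psi> \<and> (\<forall>us. length us = n \<longrightarrow> l (?g us) = \<psi> 1 us)"
      using balanced_mult[OF \<phi>(2), of a] by (intro exI[of _ "\<lambda>b us. \<phi> (a * b) us"]) simp
  qed simp_all
  also have "\<dots> = chain_of n G"
  proof (rule chain_of_eqI[OF _ G(1)])
    show "lext fscale ?g (rho F) \<in> homog n"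
      using rho_words[OF F] by (intro free_vs.lext_mem[OF subspace_homog]) (auto simp: words_def)
    fix \<phi> :: "'a \<Rightarrow> 'u list \<Rightarrow> 'k" assume \<phi>: "balanced \<phi>"
    show "pair (lext fscale ?g (rho F)) \<phi> = pair G \<phi>"
      unfolding pair_lext pair_fsingle G(2)[OF \<phi>]
      by (rule lext_rho_words[OF F balanced_mult[OF \<phi>]]) simp
  qed
  finally show ?thesis .
qed

text \<open>In positive degrees the definition nests two lifts. The inner one is well defined
  because the shuffle is balanced in the second word, the outer one because it stays balanced in the
  first word after pairing with \<open>G\<close>.\<close>

lemma sh_chain_of:
  assumes F: "F \<in> homog p" and G: "G \<in> homog q"
  shows "sh H p q (chain_of p F) (chain_of q G) = chain_of (p + q) (shuffle F G)"
proof -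
  note C = chains_presentation
  let ?lA = "lext (scaleA H) fst"
  have lext_deg: "lext fscale g (rho E) \<in> homog m"
    if "E \<in> homog n" "n > 0" "\<And>us. length us = n \<Longrightarrow> g us \<in> homog m" for n m g E
    using rho_words[OF that(1,2)] by (intro free_vs.lext_mem[OF subspace_homog] that) (auto simp: words_def)
  consider "p = 0" "q = 0" | "p > 0" "q = 0" | "p = 0" "q > 0" | "p > 0" "q > 0" by blast
  then show ?thesis
  proof cases
    case 1
    then show ?thesis using sh_chain_of_0_0 F G by simp
  next
    case 2
    have "sh H p q (chain_of p F) (chain_of q G) =
        tensor_lift (chains H p) (\<lambda>us. Inr (rtens H ((tL H (?lA G) * hd us) # tl us))) (rcoset p (rho F))"
      using 2 by (simp add: sh_def chain_of_def)
    also have "\<dots> = chain_of p (shuffle F G)"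
    proof (rule tensor_lift_coefficient[OF F 2(1)])
      show "Inr (rtens H ((tL H (?lA G) * hd us) # tl us)) = chain_of p (fsingle (?lA G, us))" if "length us = p" for us
        using that 2 by (auto simp: chain_of_def rtens_def tens_eq_tcoset rho_fsingle absorb_def)
      show "shuffle F G \<in> homog p" using shuffle_homog[OF F G] 2 by simp
      fix \<phi> :: "'a \<Rightarrow> 'u list \<Rightarrow> 'k" assume \<phi>: "balanced \<phi>"
      have "pair F (\<lambda>a. \<phi> (?lA G * a)) = pair F (\<lambda>a us. pair G (\<lambda>b vs. \<phi> (a * b) us))"
        using G 2 by (simp add: pair_homog_0_mult[OF _ \<phi>] comm_A)
      also have "\<dots> = pair (shuffle F G) \<phi>"
        unfolding pair_shuffle using G 2 by (intro pair_cong) (auto dest: homog_keys)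
      finally show "pair (shuffle F G) \<phi> = pair F (\<lambda>a. \<phi> (?lA G * a))" by simp
    qed
    finally show ?thesis using 2 by simp
  next
    case 3
    have "sh H p q (chain_of p F) (chain_of q G) =
        tensor_lift (chains H q) (\<lambda>us. Inr (rtens H (butlast us @ [last us * tL H (?lA F)]))) (rcoset q (rho G))"
      using 3 by (simp add: sh_def chain_of_def)
    also have "\<dots> = chain_of q (shuffle F G)"
    proof (rule tensor_lift_coefficient[OF G 3(2)])
      fix us :: "'u list" assume us: "length us = q"
      then have ne: "us \<noteq> []" using 3 by auto
      have "Inr (rtens H (butlast us @ [last us * tL H (?lA F)])) =
        chain_of q (fsingle (1, butlast us @ [last us * tL H (?lA F)]))"
        using us 3 by (simp add: chain_of_def rtens_def tens_eq_tcoset rho_fsingle absorb_1)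
      \<comment> \<open>The factor at the last letter and the coefficient are the same modulo the
        tensor relations.\<close>
      also have "\<dots> = chain_of q (fsingle (?lA F, us))"
        using us 3 ne by (intro chain_of_eqI) (auto simp: balanced_last)
      finally show "Inr (rtens H (butlast us @ [last us * tL H (?lA F)])) = chain_of q (fsingle (?lA F, us))" .
    next
      show "shuffle F G \<in> homog q" using shuffle_homog[OF F G] 3 by simp
      fix \<phi> :: "'a \<Rightarrow> 'u list \<Rightarrow> 'k" assume \<phi>: "balanced \<phi>"
      have "pair G (\<lambda>b. \<phi> (?lA F * b)) = pair G (\<lambda>b us. pair F (\<lambda>a vs. \<phi> (b * a) us))"
        using F 3 by (simp add: pair_homog_0_mult[OF _ \<phi>] comm_A[of "?lA F"])
      also have "\<dots> = pair F (\<lambda>a vs. pair G (\<lambda>b us. \<phi> (b * a) us))"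
        by (rule pair_swap)
      also have "\<dots> = pair (shuffle F G) \<phi>"
        unfolding pair_shuffle using F 3 by (intro pair_cong) (auto dest: homog_keys simp: comm_A)
      finally show "pair (shuffle F G) \<phi> = pair G (\<lambda>b. \<phi> (?lA F * b))" by simp
    qed
    finally show ?thesis using 3 by simp
  next
    case 4
    let ?n = "p + q"
    let ?f = "\<lambda>us vs. \<Oplus>\<^bsub>chains H ?n\<^esub>\<sigma>\<in>shuffle_perms p q. of_int (sign \<sigma>) \<odot>\<^bsub>chains H ?n\<^esub>
      Inr (rtens H (map (\<lambda>i. (us @ vs) ! (inv_into UNIV \<sigma> i)) [0..<?n]))"
    let ?g = "\<lambda>us vs. \<Sum>\<sigma>\<in>shuffle_perms p q. fscale (of_int (sign \<sigma>))
      (fsingle (1 :: 'a, map (\<lambda>i. (us @ vs) ! inv_into UNIV \<sigma> i) [0..<?n]))"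
    have pq: "p + q > 0" using 4 by simp
    note sp = shuffle_sum_chain_of[OF _ _ pq]
    have inner: "tensor_lift (chains H ?n) (?f us) (rcoset q (rho G)) = chain_of ?n (lext fscale (?g us) (rho G))"
      if us: "length us = p" for us
    proof (rule tensor_lift_chain_of[OF C G 4(2) sp(1)[OF us] sp(2)[OF us]])
      fix l assume "l \<in> cochains"
      then obtain \<phi> where \<phi>: "l = (\<lambda>F. pair F \<phi>)" "balanced \<phi>" by blast
      then show "\<exists>\<psi>. balanced \<psi> \<and> (\<forall>vs. length vs = q \<longrightarrow> l (?g us vs) = \<psi> 1 vs)"
        using balanced_shE_right[OF \<phi>(2), of us 1] us sp(3)
        by (intro exI[of _ "\<lambda>b vs. shE us vs (\<phi> (1 * b))"]) auto
    qed
    have pG: "pair (lext fscale (?g us) (rho G)) \<phi> = pair G (\<lambda>b vs. shE us vs (\<phi> (1 * b)))"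
      if "length us = p" "balanced \<phi>" for us \<phi>
      unfolding pair_lext using that sp(3)[OF that(1)]
      by (intro lext_rho_words[OF G 4(2) balanced_shE_right[OF that(2)]]) simp
    have "sh H p q (chain_of p F) (chain_of q G) =
        tensor_lift (chains H ?n) (\<lambda>us. tensor_lift (chains H ?n) (?f us) (rcoset q (rho G))) (rcoset p (rho F))"
      using 4 by (simp add: sh_def chain_of_def)
    also have "\<dots> = chain_of ?n (lext fscale (\<lambda>us. lext fscale (?g us) (rho G)) (rho F))"
    proof (rule tensor_lift_chain_of[OF C F 4(1) inner])
      show "lext fscale (?g us) (rho G) \<in> homog ?n" if "length us = p" for us
        using sp(2)[OF that] by (intro lext_deg[OF G 4(2)])
      fix l assume "l \<in> cochains"
      then obtain \<phi> where \<phi>: "l = (\<lambda>F. pair F \<phi>)" "balanced \<phi>" by blast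
      show "\<exists>\<psi>. balanced \<psi> \<and> (\<forall>us. length us = p \<longrightarrow> l (lext fscale (?g us) (rho G)) = \<psi> 1 us)"
      proof (intro exI[of _ "\<lambda>a us. pair G (\<lambda>b vs. shE us vs (\<phi> (a * b)))"] conjI allI impI)
        show "balanced (\<lambda>a us. pair G (\<lambda>b vs. shE us vs (\<phi> (a * b))))"
          by (rule balanced_pair[OF balanced_shE_left[OF \<phi>(2)]])
        show "l (lext fscale (?g us) (rho G)) = pair G (\<lambda>b vs. shE us vs (\<phi> (1 * b)))"
          if "length us = p" for us
          unfolding \<phi>(1) by (rule pG[OF that \<phi>(2)])
      qed
    qed
    also have "\<dots> = chain_of ?n (shuffle F G)"
    proof (rule chain_of_eqI)
      show "shuffle F G \<in> homog ?n" by (rule shuffle_homog[OF F G])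
      show "lext fscale (\<lambda>us. lext fscale (?g us) (rho G)) (rho F) \<in> homog ?n"
        using sp(2) by (intro lext_deg[OF F 4(1)] lext_deg[OF G 4(2)])
      fix \<phi> :: "'a \<Rightarrow> 'u list \<Rightarrow> 'k" assume \<phi>: "balanced \<phi>"
      show "pair (lext fscale (\<lambda>us. lext fscale (?g us) (rho G)) (rho F)) \<phi> = pair (shuffle F G) \<phi>"
        unfolding pair_lext[of "\<lambda>us. lext fscale (?g us) (rho G)"] pair_shuffle
        by (rule lext_rho_words[OF F 4(1) balanced_pair[OF balanced_shE_left[OF \<phi>]] pG[OF _ \<phi>]])
    qed
    finally show ?thesis .
  qed
qed

section \<open>The homology algebra\<close>

definition cycles_of :: "nat \<Rightarrow> ('a \<times> 'u list \<Rightarrow>\<^sub>0 'k) set" where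
  "cycles_of n = Z \<inter> homog n"

definition homology_class :: "nat \<Rightarrow> ('a \<times> 'u list \<Rightarrow>\<^sub>0 'k) \<Rightarrow> ('k, 'a, 'u) chain set" where
  "homology_class n F = hclass H n (chain_of n F)"

lemma subspace_cycles_of: "free.subspace (cycles_of n)"
  unfolding cycles_of_def by (rule free.subspace_inter[OF subspace_Z subspace_homog])

lemma subspace_boundaries: "free.subspace (D ` homog (Suc n))"
proof -
  interpret vector_space_pair fscale fscale
    by (intro vector_space_pair.intro free.vector_space_axioms)
  show ?thesis by (rule linear_subspace_image[OF linear_D subspace_homog])
qed

lemma boundaries_subset: "D ` homog (Suc n) \<subseteq> cycles_of n"
  by (auto simp: cycles_of_def D_Z D_homog)

lemma boundaries_eq: "boundaries H n = chain_of n ` (D ` homog (Suc n))"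
proof -
  interpret C: presentation fscale "homog (Suc n)" "chain_of (Suc n)" "chains H (Suc n)" cochains
    by (rule chains_presentation)
  show ?thesis unfolding boundaries_def using diff_chain_of by (auto simp flip: C.image_S simp: image_iff)
qed

text \<open>The differential of a chain is zero exactly when all balanced cochains vanish on
  \<open>D F\<close>, by separation and by \<open>chain_of_zeroD\<close>.\<close>

lemma cycles_eq: "cycles H n = chain_of n ` cycles_of n"
proof (cases n)
  case 0
  interpret C: presentation fscale "homog 0" "chain_of 0" "chains H 0" cochains
    by (rule chains_presentation)
  show ?thesis using homog_0_Z by (auto simp: 0 cycles_def cycles_of_def simp flip: C.image_S)
next
  case (Suc m)
  interpret C: presentation fscale "homog n" "chain_of n" "chains H n" cochains
    by (rule chains_presentation)
  interpret C': presentation fscale "homog m" "chain_of m" "chains H m" cochains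
    by (rule chains_presentation)
  have "diff H n (chain_of n F) = \<zero>\<^bsub>chains H m\<^esub> \<longleftrightarrow> F \<in> Z" if "F \<in> homog n" for F
    using that diff_chain_of[of F m] chain_of_zeroD[of "D F" m] D_homog[of F m] C'.separation[of "D F"]
    unfolding Suc by (auto simp: Z_def)
  then show ?thesis
    by (auto simp: cycles_def cycles_of_def Suc a_kernel_def' simp flip: C.image_S[unfolded Suc])
qed

lemma presents_HH: "presents fscale (cycles_of n) (homology_class n) (HH H n) cochains"
proof -
  interpret C: presentation fscale "homog n" "chain_of n" "chains H n" cochains
    by (rule chains_presentation)
  have sub: "cycles_of n \<subseteq> homog n" by (simp add: cycles_of_def)
  interpret R: presentation fscale "cycles_of n" "chain_of n"
    "chains H n\<lparr>carrier := chain_of n ` cycles_of n\<rparr>" cochains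
    by (rule presentationI[OF C.presents_restrict[OF subspace_cycles_of sub]])
  have "\<exists>b\<in>D ` homog (Suc n). chain_of n F = chain_of n b"
    if "F \<in> cycles_of n" "\<And>l. l \<in> cochains \<Longrightarrow> l F = 0" for F
  \<comment> \<open>A combination on which all cochains vanish already represents the zero chain, so
    the boundary 0 serves as witness.\<close>
  proof (rule bexI[of _ 0])
    have "chain_of n F = \<zero>\<^bsub>chains H n\<lparr>carrier := chain_of n ` cycles_of n\<rparr>\<^esub>"
      using that by (rule R.separation)
    then show "chain_of n F = chain_of n 0" using R.hom_0 by simp
    show "0 \<in> D ` homog (Suc n)" using subspace_boundaries free.subspace_0 by blast
  qed
  then show ?thesis
    using R.presents_quot[OF subspace_boundaries boundaries_subset R.linear_functional, of cochains]
    by (simp add: HH_def homology_class_def[abs_def] hclass_def boundaries_eq cycles_eq a_r_coset_def r_coset_def)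
qed

lemma HH_presentation: "presentation fscale (cycles_of n) (homology_class n) (HH H n) cochains"
  by (rule presentationI[OF presents_HH])

lemma mem_homology_class:
  assumes "F \<in> homog n"
  shows "z \<in> homology_class n F \<longleftrightarrow> (\<exists>B\<in>homog (Suc n). z = chain_of n (D B + F))"
proof -
  interpret C: presentation fscale "homog n" "chain_of n" "chains H n" cochains
    by (rule chains_presentation)
  show ?thesis
    using C.mem_coset_iff[OF _ assms, of "D ` homog (Suc n)" z] D_homog
    by (auto simp: homology_class_def hclass_def boundaries_eq)
qed

text \<open>\<open>F\<close> and \<open>G + D B\<close> only have to agree modulo the tensor
  relations, which testing on balanced cochains expresses.\<close>

lemma homology_class_eqI:
  assumes "F \<in> homog n" "G \<in> homog n" "B \<in> homog (Suc n)"
    and "\<And>\<phi>. balanced \<phi> \<Longrightarrow> pair F \<phi> = pair G \<phi> + pair (D B) \<phi>"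
  shows "homology_class n F = homology_class n G"
proof -
  interpret C: presentation fscale "homog n" "chain_of n" "chains H n" cochains
    by (rule chains_presentation)
  have sub: "D ` homog (Suc n) \<subseteq> homog n" using D_homog by auto
  have "chain_of n (F - G) = chain_of n (D B)"
    using assms by (intro chain_of_eqI homog_closed D_homog) (auto simp: pair_linear)
  then show ?thesis
    using C.coset_eqI[OF subspace_boundaries sub assms(1,2) imageI[OF assms(3)]]
    by (simp add: homology_class_def hclass_def boundaries_eq)
qed

text \<open>Independence of the representing cycles: modulo the tensor relations, the product of D A
  + F and D B + G exceeds that of F and G by the boundary of A G plus, with the sign of p, (D A + F)
  B.\<close>

lemma hsh_homology_class:
  assumes F: "F \<in> cycles_of p" and G: "G \<in> cycles_of q"
  shows "hsh H p q (homology_class p F) (homology_class q G) = homology_class (p + q) (shuffle F G)"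
proof -
  have FG: "F \<in> Z" "F \<in> homog p" "G \<in> Z" "G \<in> homog q" using F G by (auto simp: cycles_of_def)
  have *: "hclass H (p + q) (sh H p q z w) = homology_class (p + q) (shuffle F G)"
    if zw: "z \<in> homology_class p F" "w \<in> homology_class q G" for z w
  proof -
    obtain A where A: "A \<in> homog (Suc p)" "z = chain_of p (D A + F)"
      using zw(1) mem_homology_class[OF FG(2)] by auto
    obtain B where B: "B \<in> homog (Suc q)" "w = chain_of q (D B + G)"
      using zw(2) mem_homology_class[OF FG(4)] by auto
    have d: "D A + F \<in> homog p" "D B + G \<in> homog q"
      using A B FG by (auto intro!: homog_closed D_homog)
    have z: "D A + F \<in> Z" using FG D_Z free.subspace_add[OF subspace_Z] by auto
    have d2: "shuffle A G \<in> homog (Suc (p + q))" "shuffle (D A + F) B \<in> homog (Suc (p + q))"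
      using shuffle_homog[OF A(1) FG(4)] shuffle_homog[OF d(1) B(1)] by simp_all
    have "homology_class (p + q) (shuffle (D A + F) (D B + G)) = homology_class (p + q) (shuffle F G)"
    proof (rule homology_class_eqI)
      show "shuffle A G + alt p (shuffle (D A + F) B) \<in> homog (Suc (p + q))"
        using d2 by (intro homog_closed(2) alt_mem subspace_homog)
      fix \<phi> :: "'a \<Rightarrow> 'u list \<Rightarrow> 'k" assume \<phi>: "balanced \<phi>"
      show "pair (shuffle (D A + F) (D B + G)) \<phi> =
          pair (shuffle F G) \<phi> + pair (D (shuffle A G + alt p (shuffle (D A + F) B))) \<phi>"
        by (simp add: shuffle_linear(2)[of "D A + F"] D_linear pair_linear
            pair_shuffle_D_right[OF z d(1) \<phi>, symmetric] pair_shuffle_D_left[OF FG(3) \<phi>, symmetric])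
          (simp add: shuffle_linear pair_linear)
    qed (use d FG in \<open>auto intro!: shuffle_homog\<close>)
    then show ?thesis using sh_chain_of[OF d] by (simp add: A B homology_class_def)
  qed
  have mem: "chain_of p F \<in> homology_class p F" "chain_of q G \<in> homology_class q G"
    using FG by (auto simp: mem_homology_class intro!: bexI[of _ 0] homog_closed simp: D_linear)
  have "{hclass H (p + q) (sh H p q z w) | z w. z \<in> homology_class p F \<and> w \<in> homology_class q G} =
    {homology_class (p + q) (shuffle F G)}"
    using * mem by blast
  then show ?thesis by (simp add: hsh_def)
qed

section \<open>The direct sum of all degrees\<close>

definition total_class :: "('a \<times> 'u list \<Rightarrow>\<^sub>0 'k) \<Rightarrow> nat \<Rightarrow> ('k, 'a, 'u) chain set" where
  "total_class F n = homology_class n (comp n F)"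

lemma comp_cycles_of: "F \<in> Z \<Longrightarrow> comp n F \<in> cycles_of n"
  by (simp add: cycles_of_def comp_Z)

lemma shuffle_cycles_of: "F \<in> cycles_of p \<Longrightarrow> G \<in> cycles_of q \<Longrightarrow> shuffle F G \<in> cycles_of (p + q)"
  by (simp add: cycles_of_def shuffle_Z shuffle_homog)

text \<open>An element of the direct sum has finite support, so the sum of representing cycles of
  its components is one combination that represents all of it. A truncated cochain tests each
  component separately.\<close>

lemma presents_HH_algebra: "presents fscale Z total_class (HH_algebra H) cochains"
proof -
  have HH: "presentation fscale (cycles_of n) (homology_class n) (HH H n) cochains" for n
    by (rule HH_presentation)
  note image = presentation.image_S[OF HH] and zero = presentation.hom_0[OF HH]
    and add = presentation.hom_add[OF HH] and scale = presentation.hom_scale[OF HH]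
    and sep = presentation.separation[OF HH]
  have fin: "finite {n. total_class F n \<noteq> \<zero>\<^bsub>HH H n\<^esub>}" for F
  proof (rule finite_subset)
    show "{n. total_class F n \<noteq> \<zero>\<^bsub>HH H n\<^esub>} \<subseteq> (\<lambda>g. length (snd g)) ` Poly_Mapping.keys F"
    proof
      fix n assume n: "n \<in> {n. total_class F n \<noteq> \<zero>\<^bsub>HH H n\<^esub>}"
      show "n \<in> (\<lambda>g. length (snd g)) ` Poly_Mapping.keys F"
      proof (rule ccontr)
        assume "n \<notin> (\<lambda>g. length (snd g)) ` Poly_Mapping.keys F"
        then have "comp n F = 0"
          by (intro pair_eqI) (force simp: pair_comp pair_linear intro!: pair_cong[where \<psi> = "\<lambda>_ _. 0", simplified])
        then show False using n by (simp add: total_class_def zero)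
      qed
    qed
  qed simp
  have surj: "\<alpha> \<in> total_class ` Z" if \<alpha>: "\<alpha> \<in> carrier (HH_algebra H)" for \<alpha>
  proof -
    let ?N = "{n. \<alpha> n \<noteq> \<zero>\<^bsub>HH H n\<^esub>}"
    have N: "finite ?N" and "\<alpha> n \<in> homology_class n ` cycles_of n" for n
      using \<alpha> by (auto simp: HH_algebra_def image)
    then have "\<forall>n. \<exists>F\<in>cycles_of n. \<alpha> n = homology_class n F" by blast
    then obtain f where f: "\<And>n. f n \<in> cycles_of n" "\<And>n. \<alpha> n = homology_class n (f n)" by metis
    have "comp n (\<Sum>m\<in>?N. f m) = (if n \<in> ?N then f n else 0)" for n
    proof -
      have "comp n (\<Sum>m\<in>?N. f m) = (\<Sum>m\<in>?N. if n = m then f m else 0)"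
        unfolding comp_linear using f(1)
        by (intro sum.cong refl comp_of_homog[of "f _", THEN trans]) (auto simp: cycles_of_def)
      then show ?thesis using N by simp
    qed
    then have "\<alpha> = total_class (\<Sum>m\<in>?N. f m)"
      using f(2) by (auto simp: fun_eq_iff total_class_def zero)
    moreover have "(\<Sum>m\<in>?N. f m) \<in> Z"
      using f(1) by (intro free.subspace_sum[OF subspace_Z]) (auto simp: cycles_of_def)
    ultimately show ?thesis by blast
  qed
  have onto: "total_class ` Z = carrier (HH_algebra H)"
    using surj fin by (auto simp: HH_algebra_def) (auto simp: total_class_def comp_cycles_of simp flip: image)
  have null: "total_class F = \<zero>\<^bsub>HH_algebra H\<^esub>"
    if "F \<in> Z" "\<And>l. l \<in> cochains \<Longrightarrow> l F = 0" for F
  proof -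
    have "homology_class n (comp n F) = \<zero>\<^bsub>HH H n\<^esub>" for n
    proof (rule sep[OF comp_cycles_of[OF that(1)]])
      fix l assume "l \<in> cochains"
      then obtain \<phi> where \<phi>: "l = (\<lambda>F. pair F \<phi>)" "balanced \<phi>" by blast
      then show "l (comp n F) = 0"
        using that(2) balanced_truncate[OF \<phi>(2), of "\<lambda>m. m = n"] by (auto simp: pair_comp)
    qed
    then show ?thesis by (simp add: HH_algebra_def total_class_def[abs_def])
  qed
  show ?thesis unfolding presents_def
  proof (intro conjI ballI allI impI)
    show "Vector_Spaces.linear fscale (*) l" if "l \<in> cochains" for l
      using that linear_pair by auto
    show "total_class F = \<zero>\<^bsub>HH_algebra H\<^esub>" if "F \<in> Z" "\<forall>l\<in>cochains. l F = 0" for F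
      using that by (intro null) auto
  qed (auto simp: free.vector_space_axioms subspace_Z onto
      HH_algebra_def total_class_def fun_eq_iff comp_linear zero add scale comp_cycles_of)
qed

lemma HH_algebra_presentation: "presentation fscale Z total_class (HH_algebra H) cochains"
  by (rule presentationI[OF presents_HH_algebra])

lemma total_class_mult:
  assumes "F \<in> Z" "G \<in> Z"
  shows "total_class F \<otimes>\<^bsub>HH_algebra H\<^esub> total_class G = total_class (shuffle F G)"
proof
  fix n
  interpret P: presentation fscale "cycles_of n" "homology_class n" "HH H n" cochains
    by (rule HH_presentation)
  interpret abelian_group "HH H n" by (rule P.abelian_group)
  have mem: "shuffle (comp p F) (comp (n - p) G) \<in> cycles_of n" if "p \<in> {..n}" for p
    using shuffle_cycles_of[OF comp_cycles_of[OF assms(1), of p] comp_cycles_of[OF assms(2), of "n - p"]] that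
    by simp
  have "(total_class F \<otimes>\<^bsub>HH_algebra H\<^esub> total_class G) n =
    (\<Oplus>\<^bsub>HH H n\<^esub>p\<in>{..n}. hsh H p (n - p) (homology_class p (comp p F)) (homology_class (n - p) (comp (n - p) G)))"
    by (simp add: HH_algebra_def total_class_def)
  also have "\<dots> = (\<Oplus>\<^bsub>HH H n\<^esub>p\<in>{..n}. homology_class n (shuffle (comp p F) (comp (n - p) G)))"
  proof (rule finsum_cong')
    show "hsh H p (n - p) (homology_class p (comp p F)) (homology_class (n - p) (comp (n - p) G)) =
        homology_class n (shuffle (comp p F) (comp (n - p) G))" if "p \<in> {..n}" for p
      using that hsh_homology_class[OF comp_cycles_of[OF assms(1), of p] comp_cycles_of[OF assms(2), of "n - p"]]
      by simp
  qed (use mem P.hom_closed in auto)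
  also have "\<dots> = homology_class n (\<Sum>p\<in>{..n}. shuffle (comp p F) (comp (n - p) G))"
    using mem by (intro P.hom_sum) auto
  finally show "(total_class F \<otimes>\<^bsub>HH_algebra H\<^esub> total_class G) n = total_class (shuffle F G) n"
    by (simp add: total_class_def comp_shuffle)
qed

lemma one_Z: "fsingle (1, []) \<in> Z"
  by (rule homog_0_Z) simp

lemma total_class_one: "total_class (fsingle (1, [])) = \<one>\<^bsub>HH_algebra H\<^esub>"
proof
  fix n
  have "homology_class m 0 = \<zero>\<^bsub>HH H m\<^esub>" for m by (rule presentation.hom_0[OF HH_presentation])
  moreover have "chain_of 0 (fsingle (1, [])) = Inl 1"
    by (simp add: chain_of_def vspace.lext_fsingle[OF vspace_A])
  ultimately show "total_class (fsingle (1, [])) n = \<one>\<^bsub>HH_algebra H\<^esub> n"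
    by (simp add: total_class_def comp_of_homog[of _ 0] homology_class_def HH_algebra_def)
qed

text \<open>Every law is pulled back along \<open>total_class\<close> to the shuffle product of
  combinations, where it holds on the nose.\<close>

lemma k_algebra_HH: "k_algebra (HH_algebra H)"
proof -
  interpret P: presentation fscale Z total_class "HH_algebra H" cochains
    by (rule HH_algebra_presentation)
  note hom = total_class_mult[symmetric] P.hom_add[symmetric] P.hom_scale[symmetric] total_class_one[symmetric]
  note mem = P.mem_add P.mem_scale shuffle_Z one_Z
  have "ring (HH_algebra H)"
  proof (rule ringI[OF P.abelian_group])
    show "monoid (HH_algebra H)"
      by (rule monoidI; unfold P.image_S[symmetric] total_class_one[symmetric])
        (auto simp: total_class_mult mem shuffle_assoc shuffle_one)
    fix x y z assume "x \<in> carrier (HH_algebra H)" "y \<in> carrier (HH_algebra H)" "z \<in> carrier (HH_algebra H)"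
    then obtain F G E where "F \<in> Z" "G \<in> Z" "E \<in> Z" "x = total_class F" "y = total_class G" "z = total_class E"
      by (auto simp flip: P.image_S)
    then show "(x \<oplus>\<^bsub>HH_algebra H\<^esub> y) \<otimes>\<^bsub>HH_algebra H\<^esub> z =
        x \<otimes>\<^bsub>HH_algebra H\<^esub> z \<oplus>\<^bsub>HH_algebra H\<^esub> y \<otimes>\<^bsub>HH_algebra H\<^esub> z"
      "z \<otimes>\<^bsub>HH_algebra H\<^esub> (x \<oplus>\<^bsub>HH_algebra H\<^esub> y) =
        z \<otimes>\<^bsub>HH_algebra H\<^esub> x \<oplus>\<^bsub>HH_algebra H\<^esub> z \<otimes>\<^bsub>HH_algebra H\<^esub> y"
      by (simp_all add: total_class_mult mem shuffle_linear flip: P.hom_add)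
  qed
  then show ?thesis unfolding k_algebra_def using P.k_module
    by (auto simp: total_class_mult mem shuffle_linear simp flip: P.image_S P.hom_scale)
qed

end

section \<open>Sweedler calculus\<close>

abbreviation functional :: "('k::field \<Rightarrow> 'w::ab_group_add \<Rightarrow> 'w) \<Rightarrow> ('w \<Rightarrow> 'k) \<Rightarrow> bool" where
  "functional s f \<equiv> Vector_Spaces.linear s (*) f"

lemma functionalI:
  assumes "vector_space s" "\<And>x y. f (x + y) = f x + f y" "\<And>c x. f (s c x) = c * f x"
  shows "functional s f"
  using assms by (intro linearI) auto

lemma functional_lext:
  assumes "vector_space s" "\<And>g. functional s (\<lambda>x. B x g)"
  shows "functional s (\<lambda>x. lext (*) (B x) E)"
proof -
  have "B (x + y) = (\<lambda>g. B x g + B y g)" "B (s c x) = (\<lambda>g. c * B x g)" for x y c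
    by (auto simp: fun_eq_iff linear_facts[OF assms(2)])
  then show ?thesis
    by (intro functionalI assms(1)) (simp_all add: field_vs.lext_add_fun field_vs.lext_scale_fun)
qed

lemma functional_comp:
  assumes "functional s' f" "Vector_Spaces.linear s s' g" "vector_space s"
  shows "functional s (\<lambda>x. f (g x))"
  by (rule functionalI[OF assms(3)]) (simp_all add: linear_facts[OF assms(1)] linear_facts[OF assms(2)])

lemma functional_times:
  assumes "functional s f" "vector_space s"
  shows "functional s (\<lambda>x. c * f x)" "functional s (\<lambda>x. f x * c)"
proof -
  show "functional s (\<lambda>x. c * f x)"
  proof (rule functionalI[OF assms(2)])
    show "c * f (x + y) = c * f x + c * f y" for x y
      unfolding linear_facts(1)[OF assms(1)] by (rule distrib_left)
    show "c * f (s d x) = d * (c * f x)" for d x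
      unfolding linear_facts(2)[OF assms(1)] by (rule mult.left_commute)
  qed
  then show "functional s (\<lambda>x. f x * c)" by (simp add: mult.commute)
qed

lemma shE_lext_swap:
  "shE us vs (\<lambda>w. lext (*) (\<chi> w) E) = lext (*) (\<lambda>g. shE us vs (\<lambda>w. \<chi> w g)) E"
proof (induction "length us + length vs" arbitrary: us vs \<chi> rule: less_induct)
  case less
  have "lext (*) (\<lambda>g. \<phi> g - alt n (\<psi> g)) E = lext (*) \<phi> E - alt n (lext (*) \<psi> E)" for \<phi> \<psi> n
    using field_vs.lext_add_fun[of \<phi> "\<lambda>g. (if even n then - 1 else 1) * \<psi> g" E]
      field_vs.lext_scale_fun[of "if even n then - 1 else 1" \<psi> E]
    by (cases "even n") (simp_all add: alt_def)
  then show ?case by (cases us; cases vs) (simp_all add: less.hyps)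
qed

lemma functional_shE:
  assumes "vector_space s" "\<And>w. functional s (\<lambda>x. B x w)"
  shows "functional s (\<lambda>x. shE us vs (B x))"
proof -
  have "B (x + y) = (\<lambda>g. B x g + B y g)" "B (s c x) = (\<lambda>g. c * B x g)" for x y c
    by (auto simp: fun_eq_iff linear_facts[OF assms(2)])
  then show ?thesis
    by (intro functionalI assms(1))
      (simp_all add: shE_add shE_hom[of "(*) _", OF distrib_left, symmetric])
qed

section \<open>Scalar-valued sums over the comultiplication\<close>

locale cocomm_coalg =
  fixes C :: "('k::field, 'c::ab_group_add) coalg"
  assumes coalgebra: "coalgebra C" and cocommutative: "cocommutative C"
begin

abbreviation lin :: "('c \<Rightarrow> 'k) \<Rightarrow> bool" where
  "lin \<equiv> functional (cscale C)"

abbreviation ccoset :: "nat \<Rightarrow> ('c list \<Rightarrow>\<^sub>0 'k) \<Rightarrow> ('c list \<Rightarrow>\<^sub>0 'k) set" where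
  "ccoset \<equiv> tcoset (cscale C) (cscale C) (cscale C)"

abbreviation cmultilinear :: "nat \<Rightarrow> ('c list \<Rightarrow> 'k) \<Rightarrow> bool" where
  "cmultilinear \<equiv> multilinear (cscale C) (cscale C) (cscale C)"

lemma coalgebra_facts:
  "k_module (type_module (cscale C))" "comult C \<in> Vect (type_module (cscale C)) (cpow C 2)"
  "counit C \<in> Vect (type_module (cscale C)) (type_algebra (*))"
  "\<forall>x. sweedler (cpow C 3) (comult C x)
      (\<lambda>y z. sweedler (cpow C 3) (comult C y) (\<lambda>p q. ctens C [p, q, z])) =
    sweedler (cpow C 3) (comult C x)
      (\<lambda>y z. sweedler (cpow C 3) (comult C z) (\<lambda>p q. ctens C [y, p, q]))"
  "\<forall>x. sweedler (type_module (cscale C)) (comult C x) (\<lambda>y z. cscale C (counit C y) z) = x"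
  by (insert coalgebra, unfold coalgebra_def, elim conjE, assumption)+

lemma vsC: "vector_space (cscale C)"
  using coalgebra_facts(1) vector_space_if_k_module[of "type_module (cscale C)" "cscale C"]
  by (simp add: type_module_def)

lemma cpow_presentation:
  "presentation fscale (words n) (ccoset n) (cpow C n) {lext (*) \<phi> | \<phi>. cmultilinear n \<phi>}"
  unfolding cpow_def by (rule presentationI[OF presents_tensor_power])

lemma ctens_eq: "length xs = n \<Longrightarrow> ctens C xs = ccoset n (fsingle xs)"
  by (auto simp: ctens_def tens_eq_tcoset)

text \<open>Over k the balancing clause is automatic: a scalar can be pulled out of either of the
  two neighbouring slots.\<close>

lemma cmultilinearI:
  assumes "\<And>xs ys. length xs + 1 + length ys = n \<Longrightarrow> lin (\<lambda>x. \<phi> (xs @ x # ys))"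
  shows "cmultilinear n \<phi>"
  unfolding multilinear_def
proof (intro conjI allI impI)
  fix xs ys :: "'c list" and a u v assume l: "length xs + 2 + length ys = n"
  show "\<phi> (xs @ cscale C a u # v # ys) = \<phi> (xs @ u # cscale C a v # ys)"
    using linear_facts(2)[OF assms[of xs "v # ys"], of a u] linear_facts(2)[OF assms[of "xs @ [u]" ys], of a v] l
    by simp
qed (rule linear_facts(1)[OF assms] linear_facts(2)[OF assms], assumption)+

lemma cmultilinearD:
  assumes "cmultilinear n \<phi>" "length xs + 1 + length ys = n"
  shows "lin (\<lambda>x. \<phi> (xs @ x # ys))"
  using assms unfolding multilinear_def by (intro functionalI vsC) blast+

text \<open>A chosen representative of the comultiplication in the free space. It need not depend
  linearly on x; the sums \<open>sw x B\<close> do, for bilinear \<open>B\<close>.\<close>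

definition delta :: "'c \<Rightarrow> ('c list \<Rightarrow>\<^sub>0 'k)" where
  "delta x = (SOME F. F \<in> words 2 \<and> comult C x = ccoset 2 F)"

text \<open>As a finite sum over a fixed representative it is defined for any \<open>B\<close> and
  commutes with other finite sums. Bilinearity is required only where laws of the coalgebra
  enter.\<close>

definition sw :: "'c \<Rightarrow> ('c \<Rightarrow> 'c \<Rightarrow> 'k) \<Rightarrow> 'k" where
  "sw x B = lext (*) (\<lambda>us. B (us ! 0) (us ! 1)) (delta x)"

lemma delta: "delta x \<in> words 2" "comult C x = ccoset 2 (delta x)"
proof -
  interpret P: presentation fscale "words 2" "ccoset 2" "cpow C 2" "{lext (*) \<phi> | \<phi>. cmultilinear 2 \<phi>}"
    by (rule cpow_presentation)
  have "comult C x \<in> carrier (cpow C 2)"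
    using coalgebra_facts(2) by (auto simp: Vect_def type_module_def)
  then have "comult C x \<in> ccoset 2 ` words 2" by (simp only: P.image_S)
  then have "\<exists>F. F \<in> words 2 \<and> comult C x = ccoset 2 F" by blast
  from someI_ex[OF this] show "delta x \<in> words 2" "comult C x = ccoset 2 (delta x)"
    unfolding delta_def by blast+
qed

lemma bilinear_cmultilinear:
  assumes "\<And>z. lin (\<lambda>y. B y z)" "\<And>y. lin (B y)"
  shows "cmultilinear 2 (\<lambda>us. B (us ! 0) (us ! 1))"
proof (rule cmultilinearI)
  fix xs ys :: "'c list" assume "length xs + 1 + length ys = 2"
  then consider y where "xs = []" "ys = [y]" | y where "xs = [y]" "ys = []"
    by (cases xs; cases ys) auto
  then show "lin (\<lambda>x. B ((xs @ x # ys) ! 0) ((xs @ x # ys) ! 1))"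
    by cases (use assms in auto)
qed

lemma sweedler_eq:
  assumes M: "presentation sc S h M \<Phi>" and g: "\<And>y z. g y z \<in> S" "\<And>y z. f y z = h (g y z)"
    and bil: "\<And>l z. l \<in> \<Phi> \<Longrightarrow> lin (\<lambda>y. l (g y z))" "\<And>l y. l \<in> \<Phi> \<Longrightarrow> lin (\<lambda>z. l (g y z))"
  shows "sweedler M (comult C x) f = h (lext sc (\<lambda>us. g (us ! 0) (us ! 1)) (delta x))"
  unfolding sweedler_def delta(2)
proof (rule presentation.tensor_lift_tcoset[OF M delta(1)])
  show "cmultilinear 2 (\<lambda>us. l (g (us ! 0) (us ! 1)))" if "l \<in> \<Phi>" for l
    using that bil by (intro bilinear_cmultilinear[of "\<lambda>y z. l (g y z)"])
qed (simp_all add: g)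

lemma functional_sweedler:
  assumes "Vector_Spaces.linear sc (*) l" "vspace sc"
  shows "l (lext sc (\<lambda>us. g (us ! 0) (us ! 1)) (delta x)) = sw x (\<lambda>y z. l (g y z))"
  unfolding sw_def by (rule vspace.linear_lext_comp[OF assms(2,1)])

text \<open>The representative of a sum and the sum of the representatives give the same tensor, on
  which a bilinear form takes one value; likewise for multiples.\<close>

lemma lin_sw:
  assumes "\<And>z. lin (\<lambda>y. B y z)" "\<And>y. lin (B y)"
  shows "lin (\<lambda>x. sw x B)"
proof (rule functionalI[OF vsC])
  interpret P: presentation fscale "words 2" "ccoset 2" "cpow C 2" "{lext (*) \<phi> | \<phi>. cmultilinear 2 \<phi>}"
    by (rule cpow_presentation)
  note ml = bilinear_cmultilinear[OF assms]
  have V: "comult C \<in> Vect (type_module (cscale C)) (cpow C 2)"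
    by (rule coalgebra_facts)
  fix x y c
  have "ccoset 2 (delta (x + y)) = ccoset 2 (delta x + delta y)"
    using V by (simp add: Vect_def type_module_def P.hom_add delta(1) flip: delta(2))
  then show "sw (x + y) B = sw x B + sw y B"
    using ml P.mem_add[OF delta(1)[of x] delta(1)[of y]]
    by (simp add: tcoset_eq_iff delta(1) sw_def field_vs.lext_linear_facts)
  have "ccoset 2 (delta (cscale C c x)) = ccoset 2 (fscale c (delta x))"
    using V by (simp add: Vect_def type_module_def P.hom_scale delta(1) flip: delta(2))
  then show "sw (cscale C c x) B = c * sw x B"
    using ml P.mem_scale[OF delta(1)[of x]]
    by (simp add: tcoset_eq_iff delta(1) sw_def field_vs.lext_linear_facts)
qed

lemma functional_sw:
  assumes "vector_space s" "\<And>y z. functional s (\<lambda>x. B x y z)"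
  shows "functional s (\<lambda>x. sw w (B x))"
  unfolding sw_def by (rule functional_lext[OF assms])

lemma sw_cong: "(\<And>y z. B y z = B' y z) \<Longrightarrow> sw x B = sw x B'"
  by (simp add: sw_def)

lemma sw_times: "sw x (\<lambda>y z. c * B y z) = c * sw x B"
  by (simp add: sw_def field_vs.lext_scale_fun)

lemma sw_add: "sw x (\<lambda>y z. B y z + B' y z) = sw x B + sw x B'"
  by (simp add: sw_def field_vs.lext_add_fun)

lemma sw_uminus: "sw x (\<lambda>y z. - B y z) = - sw x B"
  using sw_times[of x "- 1" B] by simp

lemma sw_diff: "sw x (\<lambda>y z. B y z - B' y z) = sw x B - sw x B'"
  using sw_add[of x B "\<lambda>y z. - B' y z"] by (simp add: sw_uminus)

lemma sw_alt: "sw x (\<lambda>y z. alt n (B y z)) = alt n (sw x B)"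
  by (simp add: alt_def sw_uminus)

lemma sw_lext_swap: "sw x (\<lambda>y z. lext (*) (B y z) E) = lext (*) (\<lambda>g. sw x (\<lambda>y z. B y z g)) E"
  unfolding sw_def by (rule lext_swap)

lemma sw_sw_swap: "sw x (\<lambda>y z. sw w (T y z)) = sw w (\<lambda>p q. sw x (\<lambda>y z. T y z p q))"
  unfolding sw_def by (rule lext_swap)

lemma sw_shE_swap: "shE us vs (\<lambda>w. sw x (B w)) = sw x (\<lambda>y z. shE us vs (\<lambda>w. B w y z))"
  unfolding sw_def by (rule shE_lext_swap)

text \<open>The axiom equates two threefold tensors. Both nested sums are first evaluated to
  explicit combinations of words of length 3, and the trilinear form \<open>T\<close> is then
  applied to them.\<close>

lemma sw_coassoc:
  assumes "\<And>q z. lin (\<lambda>p. T p q z)" "\<And>p z. lin (\<lambda>q. T p q z)" "\<And>p q. lin (\<lambda>z. T p q z)"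
  shows "sw x (\<lambda>y z. sw y (\<lambda>p q. T p q z)) = sw x (\<lambda>y z. sw z (\<lambda>p q. T y p q))"
proof -
  have P: "presentation fscale (words 3) (ccoset 3) (cpow C 3) {lext (*) \<phi> | \<phi>. cmultilinear 3 \<phi>}"
    by (rule cpow_presentation)
  have lin3: "lin (\<lambda>p. \<phi> [p, q, z])" "lin (\<lambda>p. \<phi> [q, p, z])" "lin (\<lambda>p. \<phi> [q, z, p])"
    if "cmultilinear 3 \<phi>" for \<phi> q z
    using cmultilinearD[OF that, of "[]" "[q, z]"] cmultilinearD[OF that, of "[q]" "[z]"]
      cmultilinearD[OF that, of "[q, z]" "[]"] by simp_all
  let ?l = "\<lambda>y z. lext fscale (\<lambda>us. fsingle [us ! 0, us ! 1, z]) (delta y)"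
  let ?r = "\<lambda>y z. lext fscale (\<lambda>us. fsingle [y, us ! 0, us ! 1]) (delta z)"
  have mem: "lext fscale (\<lambda>us. fsingle (f us)) (delta y) \<in> words 3" if "\<And>us. length (f us) = 3" for f y
    by (intro free_vs.lext_mem[OF subspace_words]) (simp add: that)
  have eval: "lext (*) \<phi> (lext fscale (\<lambda>us. fsingle (f (us ! 0) (us ! 1))) (delta y)) = sw y (\<lambda>p q. \<phi> (f p q))"
    for \<phi> :: "'c list \<Rightarrow> 'k" and f y
    using functional_sweedler[OF field_vs.linear_lext vspace_fscale, of \<phi> "\<lambda>p q. fsingle (f p q)" y] by simp
  have eval_l: "lext (*) \<phi> (?l y z) = sw y (\<lambda>p q. \<phi> [p, q, z])"
    and eval_r: "lext (*) \<phi> (?r y z) = sw z (\<lambda>p q. \<phi> [y, p, q])" for \<phi> y z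
    by (rule eval)+
  have inner_l: "sweedler (cpow C 3) (comult C y) (\<lambda>p q. ctens C [p, q, z]) = ccoset 3 (?l y z)" for y z
    by (rule sweedler_eq[OF P, where g = "\<lambda>p q. fsingle [p, q, z]"]) (auto simp: lin3 intro!: ctens_eq)
  have inner_r: "sweedler (cpow C 3) (comult C z) (\<lambda>p q. ctens C [y, p, q]) = ccoset 3 (?r y z)" for y z
    by (rule sweedler_eq[OF P, where g = "\<lambda>p q. fsingle [y, p, q]"]) (auto simp: lin3 intro!: ctens_eq)
  have l: "sweedler (cpow C 3) (comult C x) (\<lambda>y z. ccoset 3 (?l y z)) =
      ccoset 3 (lext fscale (\<lambda>us. ?l (us ! 0) (us ! 1)) (delta x))"
  proof (rule sweedler_eq[OF P])
    fix l y z assume "l \<in> {lext (*) \<phi> | \<phi>. cmultilinear 3 \<phi>}"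
    then obtain \<phi> where \<phi>: "l = lext (*) \<phi>" "cmultilinear 3 \<phi>" by blast
    show "lin (\<lambda>y. l (?l y z))" "lin (\<lambda>z. l (?l y z))"
      unfolding \<phi>(1) eval_l by (intro lin_sw functional_sw vsC lin3[OF \<phi>(2)])+
  qed (auto intro!: mem)
  have r: "sweedler (cpow C 3) (comult C x) (\<lambda>y z. ccoset 3 (?r y z)) =
      ccoset 3 (lext fscale (\<lambda>us. ?r (us ! 0) (us ! 1)) (delta x))"
  proof (rule sweedler_eq[OF P])
    fix l y z assume "l \<in> {lext (*) \<phi> | \<phi>. cmultilinear 3 \<phi>}"
    then obtain \<phi> where \<phi>: "l = lext (*) \<phi>" "cmultilinear 3 \<phi>" by blast
    show "lin (\<lambda>y. l (?r y z))" "lin (\<lambda>z. l (?r y z))"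
      unfolding \<phi>(1) eval_r by (intro lin_sw functional_sw vsC lin3[OF \<phi>(2)])+
  qed (auto intro!: mem)
  have "sweedler (cpow C 3) (comult C x) (\<lambda>y z. sweedler (cpow C 3) (comult C y) (\<lambda>p q. ctens C [p, q, z])) =
    sweedler (cpow C 3) (comult C x) (\<lambda>y z. sweedler (cpow C 3) (comult C z) (\<lambda>p q. ctens C [y, p, q]))"
    using coalgebra_facts(4) by blast
  then have eq: "ccoset 3 (lext fscale (\<lambda>us. ?l (us ! 0) (us ! 1)) (delta x)) =
      ccoset 3 (lext fscale (\<lambda>us. ?r (us ! 0) (us ! 1)) (delta x))"
    unfolding inner_l inner_r l r .
  have ml: "cmultilinear 3 (\<lambda>us. T (us ! 0) (us ! 1) (us ! 2))"
  proof (rule cmultilinearI)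
    fix xs ys :: "'c list" assume "length xs + 1 + length ys = 3"
    then consider y z where "xs = []" "ys = [y, z]" | y z where "xs = [y]" "ys = [z]" | y z where "xs = [y, z]" "ys = []"
      by (cases xs; cases "tl xs"; cases ys; cases "tl ys") auto
    then show "lin (\<lambda>x. T ((xs @ x # ys) ! 0) ((xs @ x # ys) ! 1) ((xs @ x # ys) ! 2))"
      by cases (use assms in auto)
  qed
  have m: "lext fscale (\<lambda>us. ?l (us ! 0) (us ! 1)) (delta x) \<in> words 3"
    "lext fscale (\<lambda>us. ?r (us ! 0) (us ! 1)) (delta x) \<in> words 3"
    by (intro free_vs.lext_mem[OF subspace_words] mem; simp)+
  let ?T = "\<lambda>us. T (us ! 0) (us ! 1) (us ! 2)"
  have "lext (*) ?T (lext fscale (\<lambda>us. ?l (us ! 0) (us ! 1)) (delta x)) = sw x (\<lambda>y z. sw y (\<lambda>p q. T p q z))"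
    unfolding functional_sweedler[OF field_vs.linear_lext vspace_fscale, of ?T ?l x] eval_l by simp
  moreover have "lext (*) ?T (lext fscale (\<lambda>us. ?r (us ! 0) (us ! 1)) (delta x)) = sw x (\<lambda>y z. sw z (\<lambda>p q. T y p q))"
    unfolding functional_sweedler[OF field_vs.linear_lext vspace_fscale, of ?T ?r x] eval_r by simp
  ultimately show ?thesis
    using eq[unfolded tcoset_eq_iff[OF m], rule_format, OF ml] by (simp only:)
qed

lemma lin_counit: "lin (counit C)"
  using coalgebra_facts(3) by (intro functionalI vsC) (auto simp: Vect_def type_module_def type_algebra_def)

lemma sw_counit_left:
  assumes "lin f"
  shows "sw x (\<lambda>y z. counit C y * f z) = f x"
proof -
  have P: "presentation (cscale C) UNIV (\<lambda>x. x) (type_module (cscale C)) {l. lin l}"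
    by (rule presentationI[OF presents_type_module[OF vsC]])
  have "sweedler (type_module (cscale C)) (comult C x) (\<lambda>y z. cscale C (counit C y) z) =
    lext (cscale C) (\<lambda>us. cscale C (counit C (us ! 0)) (us ! 1)) (delta x)"
  proof (rule sweedler_eq[OF P])
    fix l y z assume "l \<in> {l. lin l}"
    then have l: "lin l" by simp
    show "lin (\<lambda>y. l (cscale C (counit C y) z))" "lin (\<lambda>z. l (cscale C (counit C y) z))"
      unfolding linear_facts(2)[OF l] by (rule functional_times[OF lin_counit vsC] functional_times[OF l vsC])+
  qed simp_all
  then have "lext (cscale C) (\<lambda>us. cscale C (counit C (us ! 0)) (us ! 1)) (delta x) = x"
    using coalgebra_facts(5) by simp
  then show ?thesis
    using functional_sweedler[OF assms, of "\<lambda>y z. cscale C (counit C y) z" x] vsC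
    by (simp add: vspace_def linear_facts[OF assms])
qed

lemma sw_cocomm:
  assumes "\<And>z. lin (\<lambda>y. B y z)" "\<And>y. lin (B y)"
  shows "sw x (\<lambda>y z. B z y) = sw x B"
proof -
  have P: "presentation fscale (words 2) (ccoset 2) (cpow C 2) {lext (*) \<phi> | \<phi>. cmultilinear 2 \<phi>}"
    by (rule cpow_presentation)
  have lin2: "lin (\<lambda>p. \<phi> [p, q])" "lin (\<lambda>p. \<phi> [q, p])"
    if "cmultilinear 2 \<phi>" for \<phi> q
    using cmultilinearD[OF that, of "[]" "[q]"] cmultilinearD[OF that, of "[q]" "[]"] by simp_all
  have "sweedler (cpow C 2) (comult C x) (\<lambda>y z. ctens C [z, y]) =
      ccoset 2 (lext fscale (\<lambda>us. fsingle [us ! 1, us ! 0]) (delta x))"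
    by (rule sweedler_eq[OF P, where g = "\<lambda>y z. fsingle [z, y]"]) (auto simp: lin2 intro!: ctens_eq)
  then have eq: "ccoset 2 (lext fscale (\<lambda>us. fsingle [us ! 1, us ! 0]) (delta x)) = ccoset 2 (delta x)"
    using cocommutative by (simp add: cocommutative_def flip: delta(2))
  have m: "lext fscale (\<lambda>us. fsingle [us ! 1, us ! 0]) (delta x) \<in> words 2"
    by (intro free_vs.lext_mem[OF subspace_words]) simp
  have "lext (*) (\<lambda>us. B (us ! 0) (us ! 1)) (lext fscale (\<lambda>us. fsingle [us ! 1, us ! 0]) (delta x)) = sw x B"
    using eq bilinear_cmultilinear[OF assms] unfolding tcoset_eq_iff[OF m delta(1)] by (simp add: sw_def)
  then show ?thesis
    using functional_sweedler[OF field_vs.linear_lext vspace_fscale, of "\<lambda>us. B (us ! 0) (us ! 1)" "\<lambda>y z. fsingle [z, y]" x]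
    by simp
qed

lemma sw_counit_right:
  assumes "lin f"
  shows "sw x (\<lambda>y z. counit C z * f y) = f x"
  using sw_cocomm[of "\<lambda>y z. counit C y * f z" x, OF functional_times(2)[OF lin_counit vsC]
      functional_times(1)[OF assms vsC]] sw_counit_left[OF assms, of x]
  by (rule trans)

text \<open>Coassociativity groups the first two of three factors, cocommutativity exchanges them,
  and coassociativity restores the grouping.\<close>

lemma sw_swap12:
  assumes "\<And>q z. lin (\<lambda>p. T p q z)" "\<And>p z. lin (\<lambda>q. T p q z)" "\<And>p q. lin (\<lambda>z. T p q z)"
  shows "sw x (\<lambda>y z. sw z (\<lambda>p q. T y p q)) = sw x (\<lambda>y z. sw z (\<lambda>p q. T p y q))"
proof -
  have "sw x (\<lambda>y z. sw z (\<lambda>p q. T y p q)) = sw x (\<lambda>y z. sw y (\<lambda>p q. T p q z))"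
    by (rule sw_coassoc[symmetric]) (rule assms)+
  also have "\<dots> = sw x (\<lambda>y z. sw y (\<lambda>p q. T q p z))"
    by (rule sw_cong, rule sw_cocomm[symmetric]) (rule assms)+
  also have "\<dots> = sw x (\<lambda>y z. sw z (\<lambda>p q. T p y q))"
    by (rule sw_coassoc) (rule assms)+
  finally show ?thesis .
qed

end

section \<open>The action of a measuring on words\<close>

context bar
begin

lemma ME_lext_swap: "ME u us (\<lambda>b ws. lext (*) (\<chi> b ws) E) = lext (*) (\<lambda>g. ME u us (\<lambda>b ws. \<chi> b ws g)) E"
  by (cases us) simp_all

lemma JE_lext_swap: "JE us (\<lambda>b ws. lext (*) (\<chi> b ws) E) = lext (*) (\<lambda>g. JE us (\<lambda>b ws. \<chi> b ws g)) E"
proof (induction us arbitrary: \<chi>)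
  case Nil
  have "lext (*) (\<lambda>g. 0) E = 0" using field_vs.lext_scale_fun[of 0 "\<lambda>g. 0" E] by simp
  then show ?case by simp
next
  case (Cons u us)
  have d: "lext (*) (\<lambda>g. \<phi> g - \<psi> g) E = lext (*) \<phi> E - lext (*) \<psi> E" for \<phi> \<psi>
    using field_vs.lext_add_fun[of \<phi> "\<lambda>g. - 1 * \<psi> g" E] field_vs.lext_scale_fun[of "- 1" \<psi> E] by simp
  show ?case unfolding JE.simps Cons.IH[of "\<lambda>b ws. \<chi> b (u # ws)"] ME_lext_swap d ..
qed

text \<open>Linearity over k in every letter, without balancing over A: this is all that is required
  as long as x acts on words without a coefficient.\<close>

definition multiadditive :: "('u list \<Rightarrow> 'k) \<Rightarrow> bool" where
  "multiadditive \<phi> \<longleftrightarrow> (\<forall>xs ys. functional scU (\<lambda>u. \<phi> (xs @ u # ys)))"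

lemma multiadditiveD:
  assumes "multiadditive \<phi>"
  shows "functional scU (\<lambda>u. \<phi> (xs @ u # ys))" "functional scU (\<lambda>u. \<phi> (u # ys))"
    "multiadditive (\<lambda>us. \<phi> (v # us))"
proof -
  show *: "functional scU (\<lambda>u. \<phi> (xs @ u # ys))" for xs ys using assms by (simp add: multiadditive_def)
  show "functional scU (\<lambda>u. \<phi> (u # ys))" using *[of "[]"] by simp
  show "multiadditive (\<lambda>us. \<phi> (v # us))" using *[of "v # _"] by (simp add: multiadditive_def)
qed

lemma multiadditive_balanced:
  assumes "balanced \<phi>"
  shows "multiadditive (\<phi> a)"
  unfolding multiadditive_def by (intro allI functionalI vsU) (simp_all add: balancedD[OF assms])

lemma functional_balanced:
  assumes "balanced \<phi>"
  shows "functional scA (\<lambda>a. \<phi> a us)" "functional scA (\<lambda>a. \<phi> (a * b) us)" "functional scA (\<lambda>a. \<phi> (b * a) us)"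
  by (rule functionalI[OF vsA]; simp add: balancedD[OF assms] distrib_left distrib_right scA_mult scA_mult_right)+

lemma multiadditive_shE_left:
  assumes "multiadditive \<phi>"
  shows "multiadditive (\<lambda>us. shE us vs \<phi>)"
  unfolding multiadditive_def
proof (intro allI functionalI vsU)
  note f = linear_facts(1,2)[OF multiadditiveD(1)[OF assms]]
  fix xs u v ys c
  show "shE (xs @ (u + v) # ys) vs \<phi> = shE (xs @ u # ys) vs \<phi> + shE (xs @ v # ys) vs \<phi>"
    by (rule shE_combine_left) (rule f)
  have "shE (xs @ scU c u # ys) vs \<phi> = shE (xs @ u # ys) vs (\<lambda>w. c * \<phi> w) + shE (xs @ u # ys) vs (\<lambda>w. 0)"
    by (rule shE_combine_left) (simp only: f add_0_right)
  then show "shE (xs @ scU c u # ys) vs \<phi> = c * shE (xs @ u # ys) vs \<phi>"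
    by (simp add: shE_hom[of "(*) c", OF distrib_left])
qed

lemma multiadditive_shE_right:
  assumes "multiadditive \<phi>"
  shows "multiadditive (\<lambda>vs. shE us vs \<phi>)"
  unfolding multiadditive_def
proof (intro allI functionalI vsU)
  note f = linear_facts(1,2)[OF multiadditiveD(1)[OF assms]]
  fix xs u v ys c
  show "shE us (xs @ (u + v) # ys) \<phi> = shE us (xs @ u # ys) \<phi> + shE us (xs @ v # ys) \<phi>"
    by (rule shE_combine_right) (rule f)
  have "shE us (xs @ scU c u # ys) \<phi> = shE us (xs @ u # ys) (\<lambda>w. c * \<phi> w) + shE us (xs @ u # ys) (\<lambda>w. 0)"
    by (rule shE_combine_right) (simp only: f add_0_right)
  then show "shE us (xs @ scU c u # ys) \<phi> = c * shE us (xs @ u # ys) \<phi>"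
    by (simp add: shE_hom[of "(*) c", OF distrib_left])
qed

lemma multiadditive_lext:
  assumes "\<And>g. multiadditive (\<lambda>us. \<chi> us g)"
  shows "multiadditive (\<lambda>us. lext (*) (\<chi> us) E)"
  unfolding multiadditive_def
  by (intro allI functional_lext vsU) (rule multiadditiveD(1)[OF assms])

lemma multiadditive_ME:
  assumes "balanced \<phi>"
  shows "multiadditive (\<lambda>us. ME v us \<phi>)" "functional scU (\<lambda>u. ME u us \<phi>)"
  unfolding multiadditive_def by (intro allI functionalI vsU, (rule ME_balanced[OF assms])+)+

end

section \<open>Measurings tested by scalar functionals\<close>

lemma algebra_measuringD:
  assumes "algebra_measuring C (type_algebra s) (type_algebra s') \<psi>" "vector_space s" "vector_space s'"
  shows "Vector_Spaces.linear s s' (\<psi> x)" "\<psi> (x + y) a = \<psi> x a + \<psi> y a" "\<psi> (cscale C c x) a = s' c (\<psi> x a)"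
    "\<psi> x (a * b) = sweedler (type_algebra s') (comult C x) (\<lambda>y z. \<psi> y a * \<psi> z b)"
    "\<psi> x 1 = s' (counit C x) 1"
proof -
  show "Vector_Spaces.linear s s' (\<psi> x)"
    using assms unfolding algebra_measuring_def by (intro linear_if_Vect) auto
  show "\<psi> (x + y) a = \<psi> x a + \<psi> y a" "\<psi> (cscale C c x) a = s' c (\<psi> x a)"
    "\<psi> x (a * b) = sweedler (type_algebra s') (comult C x) (\<lambda>y z. \<psi> y a * \<psi> z b)"
    "\<psi> x 1 = s' (counit C x) 1"
    using assms(1) unfolding algebra_measuring_def by (simp_all add: type_algebra_def)
qed

locale measuring = cocomm_coalg C + S: comm_hopf H + T: comm_hopf H'
  for C :: "('k::field, 'c::ab_group_add) coalg"
    and H :: "('k, 'a::{ring,monoid_mult}, 'u::{ring,monoid_mult}) hopf"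
    and H' :: "('k, 'b::{ring,monoid_mult}, 'v::{ring,monoid_mult}) hopf" +
  fixes \<Psi> :: "'c \<Rightarrow> 'u \<Rightarrow> 'v" and \<psi> :: "'c \<Rightarrow> 'a \<Rightarrow> 'b"
  assumes measuring: "hopf_measuring C H H' \<Psi> \<psi>"
begin

lemma measuring_facts:
  "algebra_measuring C (algU H) (algU H') \<Psi>" "algebra_measuring C (algA H) (algA H') \<psi>"
  "\<Psi> x (tL H a) = tL H' (\<psi> x a)" "\<Psi> x (antipode H u) = antipode H' (\<Psi> x u)"
  "\<psi> x (epsL H u) = epsL H' (\<Psi> x u)"
  using measuring unfolding hopf_measuring_def by blast+

lemmas Psi = algebra_measuringD[OF measuring_facts(1) S.vsU T.vsU]
lemmas psi = algebra_measuringD[OF measuring_facts(2) S.vsA T.vsA]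

lemma psi_e1: "\<psi> x (epsR H u) = epsR H' (\<Psi> x u)"
  by (simp add: epsR_def measuring_facts(4,5))

lemma psi_e2: "\<psi> x (epsR H (antipode H u)) = epsR H' (antipode H' (\<Psi> x u))"
  by (simp add: psi_e1 measuring_facts(4))

lemma lin_Psi: "functional (scaleU H') f \<Longrightarrow> lin (\<lambda>x. f (\<Psi> x u))"
  by (rule functionalI[OF vsC]) (simp_all only: Psi linear_facts(1,2)[of "scaleU H'" "(*)" f])

lemma lin_psi: "functional (scaleA H') f \<Longrightarrow> lin (\<lambda>x. f (\<psi> x a))"
  by (rule functionalI[OF vsC]) (simp_all only: psi linear_facts(1,2)[of "scaleA H'" "(*)" f])

lemma Psi_mult:
  assumes "functional (scaleU H') f"
  shows "f (\<Psi> x (u * v)) = sw x (\<lambda>y z. f (\<Psi> y u * \<Psi> z v))"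
proof -
  have P: "presentation (scaleU H') UNIV (\<lambda>x. x) (algU H') {l. functional (scaleU H') l}"
    by (rule presentationI[OF presents_type_algebra[OF T.vsU]])
  have m: "functional (scaleU H') (\<lambda>a. l (a * b))" "functional (scaleU H') (\<lambda>a. l (b * a))"
    if "functional (scaleU H') l" for l b
    by (rule functionalI[OF T.vsU];
        simp add: distrib_left distrib_right T.scU_mult T.scU_mult_right linear_facts(1,2)[OF that])+
  have "\<Psi> x (u * v) = lext (scaleU H') (\<lambda>us. \<Psi> (us ! 0) u * \<Psi> (us ! 1) v) (delta x)"
    unfolding Psi(4) by (rule sweedler_eq[OF P]) (auto intro: lin_Psi m)
  then show ?thesis
    using functional_sweedler[OF assms T.vspace_U, of "\<lambda>y z. \<Psi> y u * \<Psi> z v" x] by (simp only:)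
qed

lemma psi_mult:
  assumes "functional (scaleA H') f"
  shows "f (\<psi> x (a * b)) = sw x (\<lambda>y z. f (\<psi> y a * \<psi> z b))"
proof -
  have P: "presentation (scaleA H') UNIV (\<lambda>x. x) (algA H') {l. functional (scaleA H') l}"
    by (rule presentationI[OF presents_type_algebra[OF T.vsA]])
  have m: "functional (scaleA H') (\<lambda>a. l (a * b))" "functional (scaleA H') (\<lambda>a. l (b * a))"
    if "functional (scaleA H') l" for l b
    by (rule functionalI[OF T.vsA];
        simp add: distrib_left distrib_right T.scA_mult T.scA_mult_right linear_facts(1,2)[OF that])+
  have "\<psi> x (a * b) = lext (scaleA H') (\<lambda>us. \<psi> (us ! 0) a * \<psi> (us ! 1) b) (delta x)"
    unfolding psi(4) by (rule sweedler_eq[OF P]) (auto intro: lin_psi m)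
  then show ?thesis
    using functional_sweedler[OF assms T.vspace_A, of "\<lambda>y z. \<psi> y a * \<psi> z b" x] by (simp only:)
qed

text \<open>The combination of the words x_1(u_1) ... x_n(u_n). The empty word still consumes a
  factor, whose counit it carries, so the recursion is uniform and the counit law removes the
  surplus factor.\<close>

primrec act_word :: "'c \<Rightarrow> 'u list \<Rightarrow> ('v list \<Rightarrow>\<^sub>0 'k)" where
  "act_word x [] = fscale (counit C x) (fsingle [])"
| "act_word x (u # us) =
     lext fscale (\<lambda>p. lext fscale (\<lambda>vs. fsingle (\<Psi> (p ! 0) u # vs)) (act_word (p ! 1) us)) (delta x)"

definition hw :: "'c \<Rightarrow> 'u list \<Rightarrow> ('v list \<Rightarrow> 'k) \<Rightarrow> 'k" where
  "hw x us \<phi> = lext (*) \<phi> (act_word x us)"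

lemma hw_Nil [simp]: "hw x [] \<phi> = counit C x * \<phi> []"
  by (simp add: hw_def field_vs.lext_linear_facts)

lemma hw_Cons [simp]: "hw x (u # us) \<phi> = sw x (\<lambda>y z. hw z us (\<lambda>vs. \<phi> (\<Psi> y u # vs)))"
proof -
  have "lext (*) \<phi> (lext fscale (\<lambda>vs. fsingle (v # vs)) E) = lext (*) (\<lambda>vs. \<phi> (v # vs)) E" for v E
    by (subst free_vs.linear_lext_comp[OF field_vs.linear_lext]) simp
  then show ?thesis
    unfolding hw_def act_word.simps
    using functional_sweedler[OF field_vs.linear_lext vspace_fscale, of \<phi>
        "\<lambda>y z. lext fscale (\<lambda>vs. fsingle (\<Psi> y u # vs)) (act_word z us)" x]
    by (simp only:)
qed

lemma act_word_words: "act_word x us \<in> words (length us)"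
proof (induction us arbitrary: x)
  case (Cons u us)
  have "lext fscale (\<lambda>vs. fsingle (v # vs)) (act_word z us) \<in> words (length (u # us))" for v z
    using Cons[of z] by (intro free_vs.lext_mem[OF subspace_words]) (auto simp: words_def)
  then show ?case unfolding act_word.simps by (rule free_vs.lext_mem[OF subspace_words])
qed (simp add: free.subspace_scale[OF subspace_words])

lemma hw_cong: "(\<And>vs. length vs = length us \<Longrightarrow> \<phi> vs = \<phi>' vs) \<Longrightarrow> hw x us \<phi> = hw x us \<phi>'"
  unfolding hw_def using act_word_words[of x us] by (intro lext_cong) (auto simp: words_def)

lemma hw_add: "hw x us (\<lambda>vs. \<phi> vs + \<phi>' vs) = hw x us \<phi> + hw x us \<phi>'"
  by (simp add: hw_def field_vs.lext_add_fun)

lemma hw_times: "hw x us (\<lambda>vs. c * \<phi> vs) = c * hw x us \<phi>"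
  by (simp add: hw_def field_vs.lext_scale_fun)

lemma hw_alt: "hw x us (\<lambda>vs. alt n (\<phi> vs)) = alt n (hw x us \<phi>)"
  using hw_times[of x us "- 1" \<phi>] by (simp add: alt_def)

lemma hw_diff: "hw x us (\<lambda>vs. \<phi> vs - \<phi>' vs) = hw x us \<phi> - hw x us \<phi>'"
  using hw_add[of x us \<phi> "\<lambda>vs. - 1 * \<phi>' vs"] hw_times[of x us "- 1" \<phi>'] by simp

lemma hw_sw_swap: "hw x us (\<lambda>vs. sw w (B vs)) = sw w (\<lambda>y z. hw x us (\<lambda>vs. B vs y z))"
  unfolding hw_def sw_def by (rule lext_swap)

lemma functional_hw:
  assumes "vector_space s" "\<And>vs. functional s (\<lambda>x. B x vs)"
  shows "functional s (\<lambda>x. hw w us (B x))"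
  unfolding hw_def by (rule functional_lext[OF assms])

lemma multiadditive_hw:
  assumes "\<And>vs. T.multiadditive (\<lambda>us. \<chi> us vs)"
  shows "T.multiadditive (\<lambda>us. hw w ws (\<chi> us))"
  unfolding hw_def by (rule T.multiadditive_lext[OF assms])

lemma lin_hw:
  assumes "T.multiadditive \<phi>"
  shows "lin (\<lambda>x. hw x us \<phi>)"
  using assms
proof (induction us arbitrary: \<phi>)
  case Nil
  then show ?case by (simp add: functional_times(2)[OF lin_counit vsC])
next
  case (Cons u us)
  show ?case unfolding hw_Cons
    by (intro lin_sw Cons.IH functional_hw vsC lin_Psi[of "\<lambda>v. \<phi> (v # _)"] T.multiadditiveD[OF Cons.prems])
qed

lemma sw_hw_counit_left:
  assumes "T.multiadditive \<phi>"
  shows "sw x (\<lambda>y z. counit C y * hw z us \<phi>) = hw x us \<phi>"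
  by (rule sw_counit_left[OF lin_hw[OF assms]])

text \<open>Cocommutativity lets a letter of the second word pass the letters of the first one.\<close>

lemma shE_hw:
  assumes "T.multiadditive \<phi>"
  shows "shE us vs (\<lambda>w. hw x w \<phi>) = sw x (\<lambda>y z. hw y us (\<lambda>us'. hw z vs (\<lambda>vs'. shE us' vs' \<phi>)))"
  using assms
proof (induction "length us + length vs" arbitrary: us vs x \<phi> rule: less_induct)
  case less
  note \<phi> = less.prems
  show ?case
  proof (cases us)
    case Nil
    then show ?thesis by (simp add: sw_hw_counit_left[OF \<phi>])
  next
    case us: (Cons u us')
    show ?thesis
    proof (cases vs)
      case Nil
      then show ?thesis
        using sw_counit_right[OF lin_hw[OF \<phi>], of x us] by (simp only: Nil shE_Nil2 hw_Nil hw_times)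
    next
      case vs: (Cons v vs')
      let ?\<phi> = "\<lambda>w ws. \<phi> (w # ws)"
      let ?n = "Suc (length us')"
      note \<phi>' = T.multiadditiveD(3)[OF \<phi>]
      have IH1: "shE us' vs (\<lambda>w. hw z w (?\<phi> a)) =
          sw z (\<lambda>p q. hw p us' (\<lambda>us'. hw q vs (\<lambda>vs'. shE us' vs' (?\<phi> a))))" for z a
        by (rule less.hyps[OF _ \<phi>']) (simp add: us vs)
      have IH2: "shE us vs' (\<lambda>w. hw z w (?\<phi> a)) =
          sw z (\<lambda>p q. hw p us (\<lambda>us'. hw q vs' (\<lambda>vs'. shE us' vs' (?\<phi> a))))" for z a
        by (rule less.hyps[OF _ \<phi>']) (simp add: us vs)
      have lv: "functional (scaleU H') (\<lambda>a. shE us1 vs1 (?\<phi> a))" for us1 vs1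
        by (intro functional_shE T.vsU T.multiadditiveD(2)[OF \<phi>])
      have ml: "T.multiadditive (\<lambda>us1. shE us1 vs1 (?\<phi> a))" "T.multiadditive (\<lambda>vs1. shE us1 vs1 (?\<phi> a))"
        for us1 vs1 a
        by (rule T.multiadditive_shE_left[OF \<phi>'] T.multiadditive_shE_right[OF \<phi>'])+
      have first: "shE us' vs (\<lambda>w. hw x (u # w) \<phi>) =
        sw x (\<lambda>y z. hw y us (\<lambda>us1. hw z vs (\<lambda>vs1. shE (tl us1) vs1 (?\<phi> (hd us1)))))"
      proof -
        have "shE us' vs (\<lambda>w. hw x (u # w) \<phi>) =
          sw x (\<lambda>y z. sw z (\<lambda>p q. hw p us' (\<lambda>us1. hw q vs (\<lambda>vs1. shE us1 vs1 (?\<phi> (\<Psi> y u))))))"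
          unfolding hw_Cons sw_shE_swap IH1 ..
        \<comment> \<open>The factor of \<open>u\<close> directly precedes those of
          \<open>us'\<close>, so coassociativity alone collects them into one factor for the whole
          first word.\<close>
        also have "\<dots> =
          sw x (\<lambda>y z. sw y (\<lambda>p q. hw q us' (\<lambda>us1. hw z vs (\<lambda>vs1. shE us1 vs1 (?\<phi> (\<Psi> p u))))))"
          by (rule sw_coassoc[symmetric])
            (intro lin_hw functional_hw vsC multiadditive_hw ml lin_Psi[OF lv])+
        finally show ?thesis by (simp add: us)
      qed
      have second: "shE us vs' (\<lambda>w. hw x (v # w) \<phi>) =
        sw x (\<lambda>y z. hw y us (\<lambda>us1. hw z vs (\<lambda>vs1. shE us1 (tl vs1) (?\<phi> (hd vs1)))))"
      proof -
        have "shE us vs' (\<lambda>w. hw x (v # w) \<phi>) =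
          sw x (\<lambda>y z. sw z (\<lambda>p q. hw p us (\<lambda>us1. hw q vs' (\<lambda>vs1. shE us1 vs1 (?\<phi> (\<Psi> y v))))))"
          unfolding hw_Cons sw_shE_swap IH2 ..
        \<comment> \<open>The factor of \<open>v\<close> stands in front of those of the first word;
          \<open>sw_swap12\<close> moves it behind them.\<close>
        also have "\<dots> =
          sw x (\<lambda>y z. sw z (\<lambda>p q. hw y us (\<lambda>us1. hw q vs' (\<lambda>vs1. shE us1 vs1 (?\<phi> (\<Psi> p v))))))"
          by (rule sw_swap12)
            (intro lin_hw functional_hw vsC multiadditive_hw ml lin_Psi[OF lv])+
        finally show ?thesis by (simp add: vs hw_sw_swap)
      qed
      have step: "shE us1 vs1 \<phi> =
          shE (tl us1) vs1 (?\<phi> (hd us1)) + alt ?n (shE us1 (tl vs1) (?\<phi> (hd vs1)))"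
        if "length us1 = length us" "length vs1 = length vs" for us1 vs1
        using that us vs by (cases us1; cases vs1) auto
      have "sw x (\<lambda>y z. hw y us (\<lambda>us1. hw z vs (\<lambda>vs1. shE us1 vs1 \<phi>))) =
        sw x (\<lambda>y z. hw y us (\<lambda>us1. hw z vs (\<lambda>vs1.
          shE (tl us1) vs1 (?\<phi> (hd us1)) + alt ?n (shE us1 (tl vs1) (?\<phi> (hd vs1))))))"
        by (intro sw_cong hw_cong step)
      also have "\<dots> = shE us' vs (\<lambda>w. hw x (u # w) \<phi>) + alt ?n (shE us vs' (\<lambda>w. hw x (v # w) \<phi>))"
        unfolding first second by (simp only: hw_add hw_alt sw_add sw_alt)
      also have "\<dots> = shE us vs (\<lambda>w. hw x w \<phi>)"
        unfolding us vs shE.simps ..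
      finally show ?thesis by simp
    qed
  qed
qed

section \<open>The action of a measuring on chains\<close>

text \<open>The coefficient takes the first factor of x by \<open>\<psi>\<close>, and the letters
  share the remaining one.\<close>

definition act :: "'c \<Rightarrow> 'a \<Rightarrow> 'u list \<Rightarrow> ('b \<times> 'v list \<Rightarrow>\<^sub>0 'k)" where
  "act x a us = lext fscale (\<lambda>p. lext fscale (\<lambda>vs. fsingle (\<psi> (p ! 0) a, vs)) (act_word (p ! 1) us)) (delta x)"

definition hE :: "'c \<Rightarrow> 'a \<Rightarrow> 'u list \<Rightarrow> ('b \<Rightarrow> 'v list \<Rightarrow> 'k) \<Rightarrow> 'k" where
  "hE x a us \<phi> = sw x (\<lambda>y z. hw z us (\<phi> (\<psi> y a)))"

lemma pair_act: "pair (act x a us) \<phi> = hE x a us \<phi>"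
proof -
  have "pair (lext fscale (\<lambda>vs. fsingle (b, vs)) E) \<phi> = lext (*) (\<phi> b) E" for b E
    by (simp add: pair_lext)
  then show ?thesis
    unfolding act_def hE_def hw_def
    using functional_sweedler[OF linear_pair[of \<phi>] vspace_fscale,
        where g = "\<lambda>y z. lext fscale (\<lambda>vs. fsingle (\<psi> y a, vs)) (act_word z us)" and x = x]
    by (simp only:)
qed

lemma act_homog: "act x a us \<in> homog (length us)"
proof -
  have "lext fscale (\<lambda>vs. fsingle (b, vs)) (act_word z us) \<in> homog (length us)" for b z
    using act_word_words[of z us] by (intro free_vs.lext_mem[OF subspace_homog]) (auto simp: words_def)
  then show ?thesis unfolding act_def by (rule free_vs.lext_mem[OF subspace_homog])
qed

lemma hE_cong: "(\<And>b vs. length vs = length us \<Longrightarrow> \<phi> b vs = \<phi>' b vs) \<Longrightarrow> hE x a us \<phi> = hE x a us \<phi>'"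
  unfolding hE_def by (intro sw_cong hw_cong) simp

context
  fixes \<phi> :: "'b \<Rightarrow> 'v list \<Rightarrow> 'k"
  assumes \<phi>: "T.balanced \<phi>"
begin

lemma lin_act_parts:
  "lin (\<lambda>x. hw x us (\<phi> b))" "functional (scaleA H') (\<lambda>b. hw x us (\<phi> b))"
  "functional (scaleA H') (\<lambda>b. hw x us (\<phi> (b * c)))" "functional (scaleA H') (\<lambda>b. hw x us (\<phi> (c * b)))"
  by (intro lin_hw functional_hw T.vsA T.multiadditive_balanced T.functional_balanced \<phi>)+

lemma lin_hE: "lin (\<lambda>x. hE x a us \<phi>)"
  unfolding hE_def by (intro lin_sw lin_act_parts lin_psi)

text \<open>The measuring sends 1 to a multiple of 1 by the counit, which the counit law
  absorbs.\<close>

lemma hE_one: "hE x 1 us \<phi> = hw x us (\<phi> 1)"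
proof -
  have "hw z us (\<phi> (\<psi> y 1)) = counit C y * hw z us (\<phi> 1)" for y z
    unfolding psi(5) by (rule linear_facts(2)[OF lin_act_parts(2)])
  then show ?thesis unfolding hE_def by (simp only: sw_hw_counit_left[OF T.multiadditive_balanced[OF \<phi>]])
qed

lemma hE_Nil: "hE x a [] \<phi> = \<phi> (\<psi> x a) []"
  unfolding hE_def hw_Nil by (rule sw_counit_right[OF lin_psi[OF T.functional_balanced(1)[OF \<phi>]]])

text \<open>The factor of the first letter is moved in front of that of the coefficient, so that
  inductions on the word can remove letters while the coefficient stays.\<close>

lemma hE_Cons: "hE x a (u # us) \<phi> = sw x (\<lambda>y z. hE z a us (\<lambda>b vs. \<phi> b (\<Psi> y u # vs)))"
  unfolding hE_def hw_Cons
  by (rule sw_swap12)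
    (intro lin_hw functional_hw vsC T.multiadditiveD(3) T.multiadditive_balanced \<phi>
      lin_psi[OF functional_hw[OF T.vsA]] T.functional_balanced lin_Psi
      T.multiadditiveD(2)[OF T.multiadditive_balanced[OF \<phi>]] T.balanced_Cons[OF \<phi>])+

lemma hE_mult: "hE x (a * b) us \<phi> = sw x (\<lambda>y z. hE z b us (\<lambda>c. \<phi> (\<psi> y a * c)))"
proof -
  have "hE x (a * b) us \<phi> = sw x (\<lambda>y z. sw y (\<lambda>p q. hw z us (\<phi> (\<psi> p a * \<psi> q b))))"
    unfolding hE_def psi_mult[OF lin_act_parts(2)] ..
  also have "\<dots> = sw x (\<lambda>y z. sw z (\<lambda>p q. hw q us (\<phi> (\<psi> y a * \<psi> p b))))"
    by (rule sw_coassoc) (intro lin_act_parts lin_psi)+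
  finally show ?thesis by (simp add: hE_def)
qed

end

text \<open>The action respects balancing over A. At the letter t(b) u the measuring property splits
  its factor into one for b and one for u; since the measuring commutes with target maps, the part
  of b passes into the coefficient, where it merges with that of a.\<close>

lemma hE_t:
  assumes \<phi>: "T.balanced \<phi>"
  shows "hE x a (xs @ (tL H b * u) # ys) \<phi> = hE x (a * b) (xs @ u # ys) \<phi>"
  using \<phi>
proof (induction xs arbitrary: x \<phi>)
  case (Cons v xs)
  then show ?case by (simp only: append_Cons hE_Cons[OF Cons.prems] Cons.IH[OF T.balanced_Cons[OF Cons.prems]])
next
  case Nil
  note ma = T.multiadditive_balanced[OF Nil]
  let ?K = "\<lambda>y q r s. hw s ys (\<lambda>vs. \<phi> (\<psi> y a * \<psi> q b) (\<Psi> r u # vs))"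
  have lK: "lin (\<lambda>y. ?K y q r s)" "lin (\<lambda>q. ?K y q r s)" "lin (\<lambda>r. ?K y q r s)" "lin (?K y q r)" for y q r s
    by (intro lin_hw T.multiadditiveD(3) ma functional_hw vsC lin_Psi T.multiadditiveD(2)
        lin_psi[of "\<lambda>b. \<phi> (b * _) _"] lin_psi[of "\<lambda>b. \<phi> (_ * b) _"] T.functional_balanced[OF Nil])+
  have Psi_t: "hw s ys (\<lambda>vs. \<phi> c (\<Psi> p (tL H b * u) # vs)) =
      sw p (\<lambda>q r. hw s ys (\<lambda>vs. \<phi> (c * \<psi> q b) (\<Psi> r u # vs)))" for s c p
  proof -
    have f: "functional (scaleU H') (\<lambda>v. hw s ys (\<lambda>vs. \<phi> c (v # vs)))"
      by (intro functional_hw T.vsU T.multiadditiveD(2) ma)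
    show ?thesis
      unfolding Psi_mult[OF f] measuring_facts(3) T.balanced_hd(3)[OF Nil] ..
  qed
  have "hE x a ((tL H b * u) # ys) \<phi> = sw x (\<lambda>y z. sw z (\<lambda>p s. sw p (\<lambda>q r. ?K y q r s)))"
    unfolding hE_def hw_Cons Psi_t ..
  also have "\<dots> = sw x (\<lambda>y z. sw z (\<lambda>q w. sw w (\<lambda>r s. ?K y q r s)))"
    by (intro sw_cong sw_coassoc lK)
  \<comment> \<open>The factors for \<open>a\<close> and \<open>b\<close> now stand together, as the
    measuring property of \<open>\<psi>\<close> at \<open>a * b\<close> requires.\<close>
  also have "\<dots> = sw x (\<lambda>y w. sw y (\<lambda>y q. sw w (\<lambda>r s. ?K y q r s)))"
    by (rule sw_coassoc[symmetric]) (intro functional_sw lin_sw vsC lK)+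
  also have "\<dots> = hE x (a * b) (u # ys) \<phi>"
  proof -
    have f: "functional (scaleA H') (\<lambda>b. hw z (u # ys) (\<phi> b))" for z
      by (rule lin_act_parts(2)[OF Nil])
    show ?thesis unfolding hE_def psi_mult[OF f] unfolding hw_Cons ..
  qed
  finally show ?case by simp
qed

lemma hE_word_linear:
  assumes \<phi>: "T.balanced \<phi>"
  shows "functional (scaleU H) (\<lambda>u. hE x a (xs @ u # ys) \<phi>)"
  using \<phi>
proof (induction xs arbitrary: x \<phi>)
  case Nil
  have "functional (scaleU H) (\<lambda>u. hw s ys (\<lambda>vs. \<phi> c (\<Psi> p u # vs)))" for s c p
  proof (rule functional_comp[OF _ Psi(1) S.vsU])
    show "functional (scaleU H') (\<lambda>v. hw s ys (\<lambda>vs. \<phi> c (v # vs)))"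
      by (intro functional_hw T.vsU T.multiadditiveD(2) T.multiadditive_balanced Nil)
  qed
  then show ?case unfolding hE_def by (simp add: functional_sw S.vsU)
next
  case (Cons v xs)
  show ?case unfolding append_Cons hE_Cons[OF Cons.prems]
    by (intro functional_sw S.vsU Cons.IH T.balanced_Cons Cons.prems)
qed

text \<open>The transposed action preserves balanced cochains, so the action is well defined on
  chains.\<close>

lemma balanced_hE:
  assumes \<phi>: "T.balanced \<phi>"
  shows "S.balanced (\<lambda>a us. hE x a us \<phi>)"
proof -
  have lA: "functional (scaleA H) (\<lambda>a. hE x a us \<phi>)" for us
    unfolding hE_def
    by (intro functional_sw S.vsA functional_comp[OF lin_act_parts(2)[OF \<phi>] psi(1)])
  show ?thesis unfolding S.balanced_def
    by (intro conjI allI linear_facts(1,2)[OF lA] linear_facts(1,2)[OF hE_word_linear[OF \<phi>]] hE_t[OF \<phi>])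
qed

text \<open>An inner face multiplies two letters, and the measuring property splits the factor of
  the product into the two consecutive factors of these letters. At the last face
  \<open>\<psi>\<close> commutes with the augmentation, and the counit of the empty word
  disappears.\<close>

lemma JE_hE:
  assumes "T.balanced \<phi>"
  shows "S.JE us (\<lambda>b ws. hE x b ws \<phi>) = hw x us (\<lambda>vs. T.JE vs \<phi>)"
  using assms
proof (induction us arbitrary: x \<phi>)
  case Nil
  then show ?case by simp
next
  case (Cons u w)
  note \<phi> = Cons.prems
  have ma: "T.multiadditive (\<lambda>vs. \<phi> b (v # vs))" "functional (scaleU H') (\<lambda>v. \<phi> b (v # vs))" for b v vs
    by (intro T.multiadditiveD T.multiadditive_balanced \<phi>)+
  have "S.ME u w (\<lambda>b ws. hE x b ws \<phi>) = sw x (\<lambda>y z. hw z w (\<lambda>vs. T.ME (\<Psi> y u) vs \<phi>))"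
  proof (cases w)
    case Nil
    have "sw x (\<lambda>y z. counit C z * T.ME (\<Psi> y u) [] \<phi>) = T.ME (\<Psi> x u) [] \<phi>"
      by (rule sw_counit_right[OF lin_Psi[OF T.multiadditive_ME(2)[OF \<phi>]]])
    then show ?thesis by (simp add: Nil hE_Nil[OF \<phi>] psi_e2)
  next
    case (Cons v ws)
    have f: "functional (scaleU H') (\<lambda>v. hw z ws (\<lambda>vs. \<phi> 1 (v # vs)))" for z
      by (intro functional_hw T.vsU ma)
    have mult: "functional (scaleU H') (\<lambda>a. \<phi> 1 (a * b # vs))" "functional (scaleU H') (\<lambda>a. \<phi> 1 (b * a # vs))" for b vs
      by (rule functionalI[OF T.vsU]; simp add: distrib_left distrib_right T.scU_mult T.scU_mult_right
          linear_facts(1,2)[OF ma(2)])+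
    have "S.ME u w (\<lambda>b ws. hE x b ws \<phi>) = sw x (\<lambda>y z. hw z ws (\<lambda>vs. \<phi> 1 (\<Psi> y (u * v) # vs)))"
      by (simp add: Cons hE_one[OF \<phi>])
    also have "\<dots> = sw x (\<lambda>y z. sw y (\<lambda>p q. hw z ws (\<lambda>vs. \<phi> 1 (\<Psi> p u * \<Psi> q v # vs))))"
      unfolding Psi_mult[OF f] ..
    also have "\<dots> = sw x (\<lambda>y z. sw z (\<lambda>p q. hw q ws (\<lambda>vs. \<phi> 1 (\<Psi> y u * \<Psi> p v # vs))))"
      by (rule sw_coassoc)
        (intro lin_hw functional_hw vsC ma lin_Psi[of "\<lambda>b. \<phi> 1 (b * _ # _)"] lin_Psi[of "\<lambda>b. \<phi> 1 (_ * b # _)"] mult)+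
    finally show ?thesis by (simp add: Cons)
  qed
  moreover have "S.JE w (\<lambda>b ws. hE x b (u # ws) \<phi>) =
      sw x (\<lambda>y z. hw z w (\<lambda>vs. T.JE vs (\<lambda>b ws. \<phi> b (\<Psi> y u # ws))))"
  proof -
    have "S.JE w (\<lambda>b ws. hE x b (u # ws) \<phi>) =
      sw x (\<lambda>y z. S.JE w (\<lambda>b ws. hE z b ws (\<lambda>b vs. \<phi> b (\<Psi> y u # vs))))"
      unfolding hE_Cons[OF \<phi>] unfolding sw_def by (rule S.JE_lext_swap)
    then show ?thesis unfolding Cons.IH[OF T.balanced_Cons[OF \<phi>]] .
  qed
  ultimately show ?case by (simp add: hw_diff sw_diff)
qed

text \<open>The action is a chain map: after a face, the new coefficient is multiplied to
  \<open>a\<close>, and \<open>hE_mult\<close> distributes the factors of x to both.\<close>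

lemma dE_hE:
  assumes \<phi>: "T.balanced \<phi>"
  shows "S.dE a us (\<lambda>b ws. hE x b ws \<phi>) = hE x a us (\<lambda>b ws. T.dE b ws \<phi>)"
proof -
  have b: "T.balanced (\<lambda>c. \<phi> (b * c))" for b using T.balanced_mult[OF \<phi>] by simp
  have "S.JE us (\<lambda>b ws. hE x (a * b) ws \<phi>) = sw x (\<lambda>y z. S.JE us (\<lambda>b ws. hE z b ws (\<lambda>c. \<phi> (\<psi> y a * c))))"
    unfolding hE_mult[OF \<phi>] unfolding sw_def by (rule S.JE_lext_swap)
  then have J: "S.JE us (\<lambda>b ws. hE x (a * b) ws \<phi>) = sw x (\<lambda>y z. hw z us (\<lambda>vs. T.JE vs (\<lambda>c. \<phi> (\<psi> y a * c))))"
    unfolding JE_hE[OF b] .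
  have L: "S.LE us (\<lambda>b ws. hE x (a * b) ws \<phi>) = sw x (\<lambda>y z. hw z us (\<lambda>vs. T.LE vs (\<lambda>c. \<phi> (\<psi> y a * c))))"
  proof (cases us)
    case Nil
    have "sw x (\<lambda>y z. counit C z * 0) = 0" using sw_times[of x 0 "\<lambda>y z. 0"] by simp
    then show ?thesis by (simp add: Nil)
  next
    case (Cons u w)
    show ?thesis unfolding Cons S.LE.simps hE_mult[OF \<phi>] unfolding hE_def hw_Cons T.LE.simps psi_e1 ..
  qed
  show ?thesis
    unfolding S.dE_def J L unfolding hE_def T.dE_def by (simp add: hw_diff sw_diff)
qed

lemma shE_hE:
  assumes \<phi>: "T.balanced \<phi>"
  shows "shE us vs (\<lambda>w. hE x (a * b) w \<phi>) =
    sw x (\<lambda>y z. hE y a us (\<lambda>c us'. hE z b vs (\<lambda>d vs'. shE us' vs' (\<phi> (c * d)))))"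
proof -
  note ma = T.multiadditive_balanced[OF \<phi>]
  let ?Q = "\<lambda>p q r s. hw r us (\<lambda>us'. hw s vs (\<lambda>vs'. shE us' vs' (\<phi> (\<psi> p a * \<psi> q b))))"
  have fA: "functional (scaleA H') (\<lambda>c. hw r us (\<lambda>us'. hw s vs (\<lambda>vs'. shE us' vs' (\<phi> c))))"
      "functional (scaleA H') (\<lambda>c. hw r us (\<lambda>us'. hw s vs (\<lambda>vs'. shE us' vs' (\<phi> (c * d)))))"
      "functional (scaleA H') (\<lambda>c. hw r us (\<lambda>us'. hw s vs (\<lambda>vs'. shE us' vs' (\<phi> (d * c)))))" for r s d
    by (intro functional_hw functional_shE T.vsA T.functional_balanced[OF \<phi>])+
  have lQ: "lin (\<lambda>p. ?Q p q r s)" "lin (\<lambda>q. ?Q p q r s)" "lin (\<lambda>r. ?Q p q r s)" "lin (?Q p q r)" for p q r s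
    by (intro lin_psi fA lin_hw functional_hw vsC multiadditive_hw T.multiadditive_shE_left
        T.multiadditive_shE_right ma)+
  have "shE us vs (\<lambda>w. hE x (a * b) w \<phi>) =
      sw x (\<lambda>y z. sw z (\<lambda>r s. hw r us (\<lambda>us'. hw s vs (\<lambda>vs'. shE us' vs' (\<phi> (\<psi> y (a * b)))))))"
    unfolding hE_def sw_shE_swap shE_hw[OF ma] ..
  also have "\<dots> = sw x (\<lambda>y z. sw z (\<lambda>r s. sw y (\<lambda>p q. ?Q p q r s)))"
    unfolding psi_mult[OF fA(1)] ..
  also have "\<dots> = sw x (\<lambda>y z. sw y (\<lambda>p q. sw z (\<lambda>r s. ?Q p q r s)))"
    by (rule sw_cong, rule sw_sw_swap)
  also have "\<dots> = sw x (\<lambda>p w. sw w (\<lambda>q z. sw z (\<lambda>r s. ?Q p q r s)))"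
    by (rule sw_coassoc) (intro functional_sw lin_sw vsC lQ)+
  \<comment> \<open>Four factors serve \<open>a\<close>, \<open>b\<close>, \<open>us\<close>,
    \<open>vs\<close> in this order. Exchanging the middle two puts \<open>a\<close> next to
    \<open>us\<close> and \<open>b\<close> next to \<open>vs\<close>, one pair for each of the two
    chains.\<close>
  also have "\<dots> = sw x (\<lambda>p w. sw w (\<lambda>r z. sw z (\<lambda>q s. ?Q p q r s)))"
    by (intro sw_cong sw_swap12 lQ)
  also have "\<dots> = sw x (\<lambda>y z. sw y (\<lambda>p r. sw z (\<lambda>q s. ?Q p q r s)))"
    by (rule sw_coassoc[symmetric]) (intro functional_sw lin_sw vsC lQ)+
  finally show ?thesis by (simp add: hE_def hw_sw_swap)
qed

section \<open>The action on combinations of words\<close>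

definition induced :: "'c \<Rightarrow> ('a \<times> 'u list \<Rightarrow>\<^sub>0 'k) \<Rightarrow> ('b \<times> 'v list \<Rightarrow>\<^sub>0 'k)" where
  "induced x F = lext fscale (\<lambda>g. act x (fst g) (snd g)) F"

lemma linear_induced: "Vector_Spaces.linear fscale fscale (induced x)"
  unfolding induced_def[abs_def] by (rule free_vs.linear_lext)

lemmas induced_linear = linear_facts[OF linear_induced]

lemma pair_induced: "pair (induced x F) \<phi> = pair F (\<lambda>a us. hE x a us \<phi>)"
  unfolding induced_def pair_lext_pair[where f = "act x"] pair_act ..

lemma induced_homog: "F \<in> homog n \<Longrightarrow> induced x F \<in> homog n"
  unfolding induced_def by (rule lext_homog[where f = "act x"]) (metis act_homog homog_keys)

lemma pair_induced_D: "T.balanced \<phi> \<Longrightarrow> pair (T.D (induced x F)) \<phi> = pair (induced x (S.D F)) \<phi>"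
  by (simp add: T.pair_D S.pair_D pair_induced dE_hE)

lemma induced_Z: "F \<in> S.Z \<Longrightarrow> induced x F \<in> T.Z"
  unfolding T.Z_def using S.ZD[OF _ balanced_hE] by (simp add: pair_induced_D pair_induced)

lemma induced_comp: "induced x (S.comp n F) = T.comp n (induced x F)"
proof (rule pair_eqI)
  fix \<phi>
  have "hE x a us (\<lambda>b vs. if length vs = n then \<phi> b vs else 0) = (if length us = n then hE x a us \<phi> else 0)"
    for a us
  proof (cases "length us = n")
    case True
    then show ?thesis by (auto intro!: hE_cong)
  next
    case False
    then have "hE x a us (\<lambda>b vs. if length vs = n then \<phi> b vs else 0) = hE x a us (\<lambda>b vs. 0)"
      by (intro hE_cong) auto
    also have "\<dots> = 0"
      using hw_times[of _ us 0 "\<lambda>_. 0"] sw_times[of x 0 "\<lambda>_ _. 0"] by (simp add: hE_def)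
    finally show ?thesis using False by simp
  qed
  then show "pair (induced x (S.comp n F)) \<phi> = pair (T.comp n (induced x F)) \<phi>"
    by (simp add: pair_induced S.pair_comp T.pair_comp)
qed

lemma lin_pair_induced:
  assumes "T.balanced \<phi>"
  shows "lin (\<lambda>x. pair (induced x F) \<phi>)"
  unfolding pair_induced unfolding pair_def by (intro functional_lext vsC lin_hE assms)

text \<open>\<open>shE_hE\<close> summed over the words of both chains; the sum over x is
  independent of these words and moves to the outside.\<close>

lemma pair_induced_shuffle:
  assumes \<phi>: "T.balanced \<phi>"
  shows "pair (induced x (S.shuffle F G)) \<phi> =
    sw x (\<lambda>y z. pair (T.shuffle (induced y F) (induced z G)) \<phi>)"
proof -
  have "pair (induced x (S.shuffle F G)) \<phi> = pair F (\<lambda>a us. pair G (\<lambda>b vs.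
      sw x (\<lambda>y z. hE y a us (\<lambda>c us'. hE z b vs (\<lambda>d vs'. shE us' vs' (\<phi> (c * d)))))))"
    unfolding pair_induced S.pair_shuffle shE_hE[OF \<phi>] ..
  also have "\<dots> = sw x (\<lambda>y z. pair F (\<lambda>a us. pair G (\<lambda>b vs.
      hE y a us (\<lambda>c us'. hE z b vs (\<lambda>d vs'. shE us' vs' (\<phi> (c * d)))))))"
    unfolding pair_def sw_lext_swap ..
  also have "\<dots> = sw x (\<lambda>y z. pair F (\<lambda>a us. hE y a us (\<lambda>c us'. pair G (\<lambda>b vs.
      hE z b vs (\<lambda>d vs'. shE us' vs' (\<phi> (c * d)))))))"
    unfolding pair_act[symmetric] by (intro sw_cong pair_cong pair_swap)
  finally show ?thesis unfolding T.pair_shuffle pair_induced .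
qed

section \<open>The induced map on chains and homology\<close>

text \<open>A representative of \<open>iter_comult\<close>, built by the same recursion from the
  chosen representatives \<open>delta\<close>.\<close>

primrec iter_delta :: "nat \<Rightarrow> 'c \<Rightarrow> ('c list \<Rightarrow>\<^sub>0 'k)" where
  "iter_delta 0 x = fsingle [x]"
| "iter_delta (Suc n) x =
     lext fscale (\<lambda>p. lext fscale (\<lambda>zs. fsingle (p ! 0 # zs)) (iter_delta n (p ! 1))) (delta x)"

lemma iter_delta_words: "iter_delta n x \<in> words (Suc n)"
proof (induction n arbitrary: x)
  case (Suc n)
  have "lext fscale (\<lambda>zs. fsingle (y # zs)) (iter_delta n z) \<in> words (Suc (Suc n))" for y z
    using Suc[of z] by (intro free_vs.lext_mem[OF subspace_words]) (auto simp: words_def)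
  then show ?case unfolding iter_delta.simps by (rule free_vs.lext_mem[OF subspace_words])
qed simp

lemma lext_cons: "lext (*) \<phi> (lext fscale (\<lambda>zs. fsingle (y # zs)) E) = lext (*) (\<lambda>zs. \<phi> (y # zs)) E"
  by (subst free_vs.linear_lext_comp[OF field_vs.linear_lext]) simp

lemma lext_iter_delta_Suc:
  "lext (*) \<phi> (iter_delta (Suc n) x) = sw x (\<lambda>y z. lext (*) (\<lambda>zs. \<phi> (y # zs)) (iter_delta n z))"
  unfolding iter_delta.simps
  using functional_sweedler[OF field_vs.linear_lext[of \<phi>] vspace_fscale,
      where g = "\<lambda>y z. lext fscale (\<lambda>zs. fsingle (y # zs)) (iter_delta n z)" and x = x]
  by (simp only: lext_cons)

lemma cmultilinear_Cons:
  assumes "cmultilinear (Suc n) \<phi>"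
  shows "cmultilinear n (\<lambda>zs. \<phi> (y # zs))"
  using cmultilinearD[OF assms, of "y # _"] by (intro cmultilinearI) simp

lemma lext_words_lin:
  assumes "E \<in> words n" "\<And>us. length us = n \<Longrightarrow> lin (\<lambda>x. B x us)"
  shows "lin (\<lambda>x. lext (*) (B x) E)"
proof -
  \<comment> \<open>The family is extended by zero to words of other lengths, as
    \<open>functional_lext\<close> asks for linearity at every word.\<close>
  have "lin (\<lambda>x. lext (*) (\<lambda>us. if length us = n then B x us else 0) E)"
  proof (rule functional_lext[OF vsC])
    have "lin (\<lambda>x. 0)" by (rule functionalI[OF vsC]) simp_all
    then show "lin (\<lambda>x. if length us = n then B x us else 0)" for us
      using assms(2)[of us] by (cases "length us = n") simp_all
  qed
  moreover have "lext (*) (\<lambda>us. if length us = n then B x us else 0) E = lext (*) (B x) E" for x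
    using assms(1) by (intro lext_cong) (auto simp: words_def)
  ultimately show ?thesis by simp
qed

lemma lin_iter_delta:
  assumes "cmultilinear (Suc n) \<phi>"
  shows "lin (\<lambda>x. lext (*) \<phi> (iter_delta n x))"
  using assms
proof (induction n arbitrary: \<phi>)
  case 0
  then show ?case using cmultilinearD[OF 0, of "[]" "[]"] by simp
next
  case (Suc n)
  show ?case unfolding lext_iter_delta_Suc
  proof (rule lin_sw)
    show "lin (\<lambda>z. lext (*) (\<lambda>zs. \<phi> (y # zs)) (iter_delta n z))" for y
      by (rule Suc.IH[OF cmultilinear_Cons[OF Suc.prems]])
    show "lin (\<lambda>y. lext (*) (\<lambda>zs. \<phi> (y # zs)) (iter_delta n z))" for z
      using cmultilinearD[OF Suc.prems, of "[]"] by (intro lext_words_lin[OF iter_delta_words]) simp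
  qed
qed

text \<open>Both nested lifts are well defined: a multilinear form is linear in the letter put in
  front and, with this letter fixed, multilinear in the rest.\<close>

lemma iter_comult_eq: "iter_comult C n x = ccoset (Suc n) (iter_delta n x)"
proof (induction n arbitrary: x)
  case 0
  then show ?case by (simp add: ctens_eq)
next
  case (Suc n)
  have P: "presentation fscale (words (n + 2)) (ccoset (n + 2)) (cpow C (n + 2)) {lext (*) \<phi> | \<phi>. cmultilinear (n + 2) \<phi>}"
    by (rule cpow_presentation)
  let ?g = "\<lambda>y z. lext fscale (\<lambda>zs. fsingle (y # zs)) (iter_delta n z)"
  have g: "?g y z \<in> words (n + 2)" for y z
    using iter_delta_words[of n z] by (intro free_vs.lext_mem[OF subspace_words]) (auto simp: words_def)
  have inner: "tensor_lift (cpow C (n + 2)) (\<lambda>zs. ctens C (y # zs)) (iter_comult C n z) = ccoset (n + 2) (?g y z)"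
    for y z
    unfolding Suc
  proof (rule presentation.tensor_lift_tcoset[OF P iter_delta_words])
    fix l assume "l \<in> {lext (*) \<phi> | \<phi>. cmultilinear (n + 2) \<phi>}"
    then obtain \<phi> where \<phi>: "l = lext (*) \<phi>" "cmultilinear (n + 2) \<phi>" by blast
    show "cmultilinear (Suc n) (\<lambda>zs. l (fsingle (y # zs)))"
      using cmultilinear_Cons[of "Suc n" \<phi> y] \<phi> by simp
  qed (simp_all add: ctens_eq)
  have "iter_comult C (Suc n) x = sweedler (cpow C (n + 2)) (comult C x) (\<lambda>y z. ccoset (n + 2) (?g y z))"
    unfolding iter_comult.simps inner ..
  also have "\<dots> = ccoset (n + 2) (lext fscale (\<lambda>p. ?g (p ! 0) (p ! 1)) (delta x))"
  proof (rule sweedler_eq[OF P g refl])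
    fix l y z assume "l \<in> {lext (*) \<phi> | \<phi>. cmultilinear (n + 2) \<phi>}"
    then obtain \<phi> where \<phi>: "l = lext (*) \<phi>" "cmultilinear (Suc (Suc n)) \<phi>" by auto
    show "lin (\<lambda>z. l (?g y z))" unfolding \<phi>(1) lext_cons
      by (rule lin_iter_delta[OF cmultilinear_Cons[OF \<phi>(2)]])
    show "lin (\<lambda>y. l (?g y z))" unfolding \<phi>(1) lext_cons
      using cmultilinearD[OF \<phi>(2), of "[]"] by (intro lext_words_lin[OF iter_delta_words]) simp
  qed
  finally show ?case by simp
qed

text \<open>The definition uses exactly as many factors of x as there are letters, \<open>hw\<close>
  one more for the empty word. The counit law for a single letter reconciles the two.\<close>

lemma lext_iter_delta_map2:
  assumes "T.multiadditive \<phi>" "length us = Suc n"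
  shows "lext (*) (\<lambda>xs. \<phi> (map2 \<Psi> xs us)) (iter_delta n x) = hw x us \<phi>"
  using assms
proof (induction n arbitrary: us x \<phi>)
  case 0
  then obtain u where us: "us = [u]" by (auto simp: length_Suc_conv)
  have "sw x (\<lambda>y z. counit C z * \<phi> [\<Psi> y u]) = \<phi> [\<Psi> x u]"
    by (rule sw_counit_right[OF lin_Psi[OF T.multiadditiveD(2)[OF 0(1)]]])
  then show ?case by (simp add: us)
next
  case (Suc n)
  then obtain u us' where us: "us = u # us'" "length us' = Suc n" by (auto simp: length_Suc_conv)
  show ?case
    unfolding us(1) lext_iter_delta_Suc hw_Cons
    using Suc.IH[OF T.multiadditiveD(3)[OF Suc.prems(1)] us(2)] by simp
qed

lemma cmultilinear_map2:
  assumes "T.multiadditive \<phi>" "length us = n"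
  shows "cmultilinear n (\<lambda>xs. \<phi> (map2 \<Psi> xs us))"
proof (rule cmultilinearI)
  fix xs ys :: "'c list" assume "length xs + 1 + length ys = n"
  then have "map2 \<Psi> (xs @ x # ys) us =
      map2 \<Psi> xs (take (length xs) us) @ \<Psi> x (us ! length xs) # map2 \<Psi> ys (drop (Suc (length xs)) us)" for x
    using assms(2) Cons_nth_drop_Suc[of "length xs" us, symmetric] by (simp add: zip_append1)
  then show "lin (\<lambda>x. \<phi> (map2 \<Psi> (xs @ x # ys) us))"
    using lin_Psi[OF T.multiadditiveD(1)[OF assms(1)]] by simp
qed

text \<open>In positive degree the definition acts on plain words, which is the action at
  coefficient 1; the coefficient that \<open>rho\<close> puts into the first letter is accounted for
  because \<open>hE\<close> is balanced.\<close>

lemma hoc_chain_chain_of: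
  assumes F: "F \<in> homog n"
  shows "hoc_chain C H' \<Psi> \<psi> x n (S.chain_of n F) = T.chain_of n (induced x F)"
proof (cases n)
  case 0
  let ?a = "lext (scaleA H) fst F"
  have "hoc_chain C H' \<Psi> \<psi> x n (S.chain_of n F) = T.chain_of 0 (fsingle (\<psi> x ?a, []))"
    by (simp add: 0 hoc_chain_def S.chain_of_def T.chain_of_def vspace.lext_fsingle[OF T.vspace_A])
  also have "\<dots> = T.chain_of 0 (induced x F)"
  proof (rule T.chain_of_eqI)
    fix \<phi> :: "'b \<Rightarrow> 'v list \<Rightarrow> 'k" assume \<phi>: "T.balanced \<phi>"
    have l: "functional (scaleA H) (\<lambda>a. \<phi> (\<psi> x a) [])"
      by (rule functional_comp[OF T.functional_balanced(1)[OF \<phi>] psi(1) S.vsA])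
    have "\<phi> (\<psi> x ?a) [] = pair F (\<lambda>a us. \<phi> (\<psi> x a) [])"
      using S.linear_of_homog_0[OF _ l] F 0 by simp
    also have "\<dots> = pair (induced x F) \<phi>"
      unfolding pair_induced using F 0 by (intro pair_homog_cong[of F 0]) (simp_all add: hE_Nil[OF \<phi>])
    finally show "pair (fsingle (\<psi> x ?a, [])) \<phi> = pair (induced x F) \<phi>" by simp
  qed (use induced_homog[of F 0 x] F 0 in simp_all)
  finally show ?thesis by (simp add: 0)
next
  case (Suc m)
  let ?g = "\<lambda>us. lext fscale (\<lambda>xs. fsingle (1, map2 \<Psi> xs us)) (iter_delta m x)"
  have n: "n > 0" using Suc by simp
  have g: "?g us \<in> homog n" if "length us = n" for us
    using iter_delta_words[of m x] that Suc
    by (intro free_vs.lext_mem[OF subspace_homog]) (auto simp: words_def)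
  have pg: "pair (?g us) \<phi> = hE x 1 us \<phi>" if "length us = n" "T.balanced \<phi>" for us \<phi>
    using lext_iter_delta_map2[OF T.multiadditive_balanced[OF that(2)], of us m 1 x] that Suc
    by (simp add: pair_lext hE_one)
  have inner: "tensor_lift (chains H' n) (\<lambda>xs. Inr (rtens H' (map2 \<Psi> xs us))) (iter_comult C m x) = T.chain_of n (?g us)"
    if us: "length us = n" for us
    unfolding iter_comult_eq
  proof (rule presentation.tensor_lift_tcoset[OF T.chains_presentation iter_delta_words])
    show "Inr (rtens H' (map2 \<Psi> xs us)) = T.chain_of n (fsingle (1, map2 \<Psi> xs us))" if "length xs = Suc m" for xs
    proof -
      have "length (map2 \<Psi> xs us) = n" using that us Suc by simp
      then show ?thesis using n T.absorb_1[of "map2 \<Psi> xs us"]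
        by (auto simp: T.chain_of_def rtens_def tens_eq_tcoset T.rho_fsingle simp del: length_map)
    qed
    show "fsingle (1, map2 \<Psi> xs us) \<in> homog n" if "length xs = Suc m" for xs
      using that us Suc by simp
    fix l assume "l \<in> T.cochains"
    then obtain \<phi> where \<phi>: "l = (\<lambda>F. pair F \<phi>)" "T.balanced \<phi>" by blast
    show "cmultilinear (Suc m) (\<lambda>xs. l (fsingle (1, map2 \<Psi> xs us)))"
      unfolding \<phi>(1) pair_fsingle using us Suc
      by (intro cmultilinear_map2 T.multiadditive_balanced \<phi>) simp
  qed
  have "hoc_chain C H' \<Psi> \<psi> x n (S.chain_of n F) = tensor_lift (chains H' n)
      (\<lambda>us. tensor_lift (chains H' n) (\<lambda>xs. Inr (rtens H' (map2 \<Psi> xs us))) (iter_comult C m x)) (S.rcoset n (S.rho F))"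
    by (simp add: hoc_chain_def S.chain_of_def Suc)
  also have "\<dots> = T.chain_of n (lext fscale ?g (S.rho F))"
  proof (rule S.tensor_lift_chain_of[OF T.chains_presentation F n inner g])
    fix l assume "l \<in> T.cochains"
    then obtain \<phi> where \<phi>: "l = (\<lambda>F. pair F \<phi>)" "T.balanced \<phi>" by blast
    show "\<exists>\<chi>. S.balanced \<chi> \<and> (\<forall>us. length us = n \<longrightarrow> l (?g us) = \<chi> 1 us)"
      using balanced_hE[OF \<phi>(2)] pg[OF _ \<phi>(2)] unfolding \<phi>(1)
      by (intro exI[of _ "\<lambda>a us. hE x a us \<phi>"]) blast
  qed
  also have "\<dots> = T.chain_of n (induced x F)"
  proof (rule T.chain_of_eqI)
    show "lext fscale ?g (S.rho F) \<in> homog n"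
      using S.rho_words[OF F n] by (intro free_vs.lext_mem[OF subspace_homog] g) (auto simp: words_def)
    show "induced x F \<in> homog n" by (rule induced_homog[OF F])
    fix \<phi> :: "'b \<Rightarrow> 'v list \<Rightarrow> 'k" assume \<phi>: "T.balanced \<phi>"
    show "pair (lext fscale ?g (S.rho F)) \<phi> = pair (induced x F) \<phi>"
      unfolding pair_lext[of ?g] pair_induced
      by (rule S.lext_rho_words[OF F n balanced_hE[OF \<phi>] pg[OF _ \<phi>]])
  qed
  finally show ?thesis .
qed

text \<open>Cycles that differ by D B have images that differ, modulo the tensor relations, by the
  boundary of the image of B. So any choice of cycle gives the same class.\<close>

lemma hoc_total_class:
  assumes "F \<in> S.Z"
  shows "hoc C H' \<Psi> \<psi> x (S.total_class F) = T.total_class (induced x F)"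
proof
  fix n
  let ?F = "S.comp n F"
  have *: "hclass H' n (hoc_chain C H' \<Psi> \<psi> x n z) = T.homology_class n (induced x ?F)"
    if z: "z \<in> S.homology_class n ?F" for z
  proof -
    obtain B where B: "B \<in> homog (Suc n)" "z = S.chain_of n (S.D B + ?F)"
      using z S.mem_homology_class[of ?F n] by auto
    have d: "S.D B + ?F \<in> homog n" by (intro homog_closed S.D_homog B S.comp_homog)
    have "T.homology_class n (induced x (S.D B + ?F)) = T.homology_class n (induced x ?F)"
    proof (rule T.homology_class_eqI)
      show "induced x B \<in> homog (Suc n)" by (rule induced_homog[OF B(1)])
      show "pair (induced x (S.D B + ?F)) \<phi> = pair (induced x ?F) \<phi> + pair (T.D (induced x B)) \<phi>"
        if "T.balanced \<phi>" for \<phi>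
        by (simp add: induced_linear pair_linear pair_induced_D[OF that])
    qed (intro induced_homog d S.comp_homog)+
    then show ?thesis using hoc_chain_chain_of[OF d] by (simp add: B(2) T.homology_class_def)
  qed
  have "S.chain_of n ?F \<in> S.homology_class n ?F"
    using S.mem_homology_class[of ?F n] homog_closed(1) by (auto simp: S.D_linear intro!: bexI[of _ 0])
  then have "{hclass H' n (hoc_chain C H' \<Psi> \<psi> x n z) | z. z \<in> S.homology_class n ?F} = {T.homology_class n (induced x ?F)}"
    using * by blast
  then show "hoc C H' \<Psi> \<psi> x (S.total_class F) n = T.total_class (induced x F) n"
    by (simp add: hoc_def S.total_class_def T.total_class_def induced_comp)
qed

lemma algebra_measuring_hoc: "algebra_measuring C (HH_algebra H) (HH_algebra H') (hoc C H' \<Psi> \<psi>)"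
proof -
  interpret HS: presentation fscale S.Z S.total_class "HH_algebra H" S.cochains
    by (rule S.HH_algebra_presentation)
  interpret HT: presentation fscale T.Z T.total_class "HH_algebra H'" T.cochains
    by (rule T.HH_algebra_presentation)
  note Z = induced_Z HS.mem_add HS.mem_scale
  have Vect: "hoc C H' \<Psi> \<psi> x \<in> Vect (HH_algebra H) (HH_algebra H')" for x
    unfolding Vect_def HS.image_S[symmetric]
    by (auto simp: hoc_total_class Z induced_linear HT.hom_add HT.hom_scale
        simp flip: HS.hom_add HS.hom_scale intro!: HT.hom_closed)
  have add: "hoc C H' \<Psi> \<psi> (x + y) \<alpha> = hoc C H' \<Psi> \<psi> x \<alpha> \<oplus>\<^bsub>HH_algebra H'\<^esub> hoc C H' \<Psi> \<psi> y \<alpha>"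
    and scale: "hoc C H' \<Psi> \<psi> (cscale C c x) \<alpha> = c \<odot>\<^bsub>HH_algebra H'\<^esub> hoc C H' \<Psi> \<psi> x \<alpha>"
    if \<alpha>: "\<alpha> \<in> carrier (HH_algebra H)" for c x y \<alpha>
  proof -
    obtain F where F: "F \<in> S.Z" "\<alpha> = S.total_class F" using \<alpha> by (auto simp flip: HS.image_S)
    have "T.total_class (induced (x + y) F) = T.total_class (induced x F + induced y F)"
      "T.total_class (induced (cscale C c x) F) = T.total_class (fscale c (induced x F))"
      by (rule HT.hom_eqI; auto intro!: HT.mem_add HT.mem_scale induced_Z F(1)
          simp: pair_linear linear_facts(1,2)[OF lin_pair_induced])+
    then show "hoc C H' \<Psi> \<psi> (x + y) \<alpha> = hoc C H' \<Psi> \<psi> x \<alpha> \<oplus>\<^bsub>HH_algebra H'\<^esub> hoc C H' \<Psi> \<psi> y \<alpha>"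
      "hoc C H' \<Psi> \<psi> (cscale C c x) \<alpha> = c \<odot>\<^bsub>HH_algebra H'\<^esub> hoc C H' \<Psi> \<psi> x \<alpha>"
      by (simp_all add: F hoc_total_class HT.hom_add HT.hom_scale induced_Z)
  qed
  have mult: "hoc C H' \<Psi> \<psi> x (\<alpha> \<otimes>\<^bsub>HH_algebra H\<^esub> \<beta>) =
      sweedler (HH_algebra H') (comult C x) (\<lambda>y z. hoc C H' \<Psi> \<psi> y \<alpha> \<otimes>\<^bsub>HH_algebra H'\<^esub> hoc C H' \<Psi> \<psi> z \<beta>)"
    if \<alpha>: "\<alpha> \<in> carrier (HH_algebra H)" and \<beta>: "\<beta> \<in> carrier (HH_algebra H)" for x \<alpha> \<beta>
  proof -
    obtain F where F: "F \<in> S.Z" "\<alpha> = S.total_class F" using \<alpha> by (auto simp flip: HS.image_S)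
    obtain G where G: "G \<in> S.Z" "\<beta> = S.total_class G" using \<beta> by (auto simp flip: HS.image_S)
    let ?g = "\<lambda>y z. T.shuffle (induced y F) (induced z G)"
    have g: "?g y z \<in> T.Z" for y z by (intro T.shuffle_Z induced_Z F G)
    have bil: "lin (\<lambda>y. pair (?g y z) \<phi>)" "lin (\<lambda>z. pair (?g y z) \<phi>)" if "T.balanced \<phi>" for y z \<phi>
    proof -
      show "lin (\<lambda>y. pair (?g y z) \<phi>)" unfolding T.pair_shuffle
        by (rule lin_pair_induced[OF T.balanced_pair[OF T.balanced_shE_left[OF that]]])
      \<comment> \<open>The two pairings are exchanged so that the chain depending on
        \<open>z\<close> is paired last, with a cochain that is balanced in its word.\<close>
      show "lin (\<lambda>z. pair (?g y z) \<phi>)" unfolding T.pair_shuffle pair_swap[of "induced y F"]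
        by (rule lin_pair_induced[OF T.balanced_pair[OF T.balanced_shE_right[OF that]]])
    qed
    have "sweedler (HH_algebra H') (comult C x) (\<lambda>y z. hoc C H' \<Psi> \<psi> y \<alpha> \<otimes>\<^bsub>HH_algebra H'\<^esub> hoc C H' \<Psi> \<psi> z \<beta>) =
      T.total_class (lext fscale (\<lambda>p. ?g (p ! 0) (p ! 1)) (delta x))"
    proof (rule sweedler_eq[OF T.HH_algebra_presentation g])
      show "hoc C H' \<Psi> \<psi> y \<alpha> \<otimes>\<^bsub>HH_algebra H'\<^esub> hoc C H' \<Psi> \<psi> z \<beta> = T.total_class (?g y z)" for y z
        using F G by (simp add: hoc_total_class T.total_class_mult induced_Z)
    qed (use bil in auto)
    also have "\<dots> = T.total_class (induced x (S.shuffle F G))"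
    proof (rule HT.hom_eqI)
      show "lext fscale (\<lambda>p. ?g (p ! 0) (p ! 1)) (delta x) \<in> T.Z"
        by (rule free_vs.lext_mem[OF T.subspace_Z]) (rule g)
      show "induced x (S.shuffle F G) \<in> T.Z" by (intro induced_Z S.shuffle_Z F G)
      fix l assume "l \<in> T.cochains"
      then obtain \<phi> where \<phi>: "l = (\<lambda>F. pair F \<phi>)" "T.balanced \<phi>" by blast
      show "l (lext fscale (\<lambda>p. ?g (p ! 0) (p ! 1)) (delta x)) = l (induced x (S.shuffle F G))"
        unfolding \<phi>(1) pair_induced_shuffle[OF \<phi>(2)]
        by (rule functional_sweedler[OF linear_pair vspace_fscale])
    qed
    finally show ?thesis
      using F G by (simp add: S.total_class_mult hoc_total_class S.shuffle_Z)
  qed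
  have one: "hoc C H' \<Psi> \<psi> x \<one>\<^bsub>HH_algebra H\<^esub> = counit C x \<odot>\<^bsub>HH_algebra H'\<^esub> \<one>\<^bsub>HH_algebra H'\<^esub>" for x
  proof -
    \<comment> \<open>The unit is the empty word with coefficient 1, on which x acts by its
      counit.\<close>
    have "T.total_class (induced x (fsingle (1, []))) = T.total_class (fscale (counit C x) (fsingle (1, [])))"
      by (rule HT.hom_eqI)
        (auto simp: pair_linear pair_induced hE_one intro!: induced_Z S.one_Z HT.mem_scale T.one_Z)
    then show ?thesis
      by (simp add: hoc_total_class S.one_Z HT.hom_scale T.one_Z
          flip: S.total_class_one T.total_class_one)
  qed
  show ?thesis
    unfolding algebra_measuring_def
    using coalgebra S.k_algebra_HH T.k_algebra_HH Vect add scale mult one by blast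
qed

end

theorem proposition4p1:
  fixes H :: "('k::field, 'a::{ring,monoid_mult}, 'u::{ring,monoid_mult}) hopf"
    and H' :: "('k, 'b::{ring,monoid_mult}, 'v::{ring,monoid_mult}) hopf"
    and C :: "('k, 'c::ab_group_add) coalg"
    and \<Psi> :: "'c \<Rightarrow> 'u \<Rightarrow> 'v"
    and \<psi> :: "'c \<Rightarrow> 'a \<Rightarrow> 'b"
  assumes "commutative_hopf_algebroid H"
    and "commutative_hopf_algebroid H'"
    and "coalgebra C"
    and "cocommutative C"
    and "hopf_measuring C H H' \<Psi> \<psi>"
  shows "algebra_measuring C (HH_algebra H) (HH_algebra H') (hoc C H' \<Psi> \<psi>)"
proof -
  interpret measuring C H H' \<Psi> \<psi>
    by (intro measuring.intro measuring_axioms.intro cocomm_coalg.intro comm_hopf.intro assms)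
  show ?thesis by (rule algebra_measuring_hoc)
qed

end
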